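(* Consider the target/source factor model, Assumptions (A1)–(A5) and (A6)(1), and the oracle TransPCA estimators described in the context, with the numbers of factors $s$ and $r_k$, $k\in\{0\}\cup\mathcal A$, fixed and known, and the weak factor strength matrix $\mathbf D_w$ known. Then, as $N\to\infty$ and $\min_{k\in\{0\}\cup\mathcal A}T_k\to\infty$, there exists an invertible $s\times s$ matrix $\mathbf H_w$ such that $$\frac{1}{\sqrt N}\big\|\hat{\boldsymbol\Lambda}_w^{(0)}-\boldsymbol\Lambda_w^{(0)}\mathbf H_w\big\|=\frac{\sqrt{N^{\alpha_1}}}{\sqrt N}\, O_p\Big(\frac{\sqrt{T_0}N}{TN^{\alpha_s}}+\frac{T_0}{TN^{\alpha_s}}+\sum_{k\in\mathcal A}\Big(\frac{\sqrt{T_k}}{T}+\frac{T_k}{TN}\Big)+\frac1T\sum_{k\in\mathcal A}T_k\varepsilon\Big),$$ $$\frac{1}{\sqrt {T_0}}\big\|\hat{\mathbf F}_w^{(0)}-\mathbf F_w^{(0)}(\mathbf H_w^{-1})^\top\big\|=\frac{\sqrt{N}}{\sqrt {N^{\alpha_s}}}\, O_p\Big(\frac{\sqrt{T_0}N}{TN^{\alpha_s}}+\frac{T_0}{TN^{\alpha_s}}+\sum_{k\in\mathcal A}\Big(\frac{\sqrt{T_k}}{T}+\frac{T_k}{TN}\Big)+\frac1T\sum_{k\in\mathcal A}T_k\varepsilon\Big)+O_p\Big(\frac{1}{\sqrt{N^{\alpha_s}}}\Big).$$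
   Context: Model. $N$ is the cross-sectional dimension. The target panel $\mathbf X^{(0)}\in\mathbb R^{T_0\times N}$ satisfies $\mathbf X^{(0)}=\mathbf F^{(0)}\boldsymbol\Lambda^{(0)\top}+\mathbf E^{(0)}$ with factors $\mathbf F^{(0)}=(\mathbf f^{(0)}_1,\dots,\mathbf f^{(0)}_{T_0})^\top\in\mathbb R^{T_0\times r_0}$, loadings $\boldsymbol\Lambda^{(0)}\in\mathbb R^{N\times r_0}$ and idiosyncratic errors $\mathbf E^{(0)}$ with entries $\epsilon^{(0)}_{ti}$. Source panels $\mathbf X^{(k)}=\mathbf F^{(k)}\boldsymbol\Lambda^{(k)\top}+\mathbf E^{(k)}\in\mathbb R^{T_k\times N}$, $k\in[K]$, have $r_k$ factors (same notation). $\mathcal A\subseteq[K]$ is the (known) set of informative sources and $T=\sum_{k\in\{0\}\cup\mathcal A}T_k$. The target has $s$ weak factors: $\boldsymbol\Lambda^{(0)}=(\boldsymbol\Lambda^{(0)}_s,\boldsymbol\Lambda^{(0)}_w)$ with $\boldsymbol\Lambda^{(0)}_s\in\mathbb R^{N\times(r_0-s)}$ (strong) and $\boldsymbol\Lambda^{(0)}_w\in\mathbb R^{N\times s}$ (weak), and $\mathbf F^{(0)}=(\mathbf F^{(0)}_s,\mathbf F^{(0)}_w)$ correspondingly. For $k\in\mathcal A$ the columns of $\boldsymbol\Lambda^{(k)}$ split into $\boldsymbol\Lambda^{(k)}_{\mathcal T}\in\mathbb R^{N\times s}$ and $\boldsymbol\Lambda^{(k)}_{\mathcal T^c}\in\mathbb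 R^{N\times (r_k-s)}$, with $\mathbf P_{\boldsymbol\Lambda^{(k)}}=\mathbf P_{\boldsymbol\Lambda^{(k)}_{\mathcal T}}+\mathbf P_{\boldsymbol\Lambda^{(k)}_{\mathcal T^c}}$ and likewise $\mathbf P_{\boldsymbol\Lambda^{(0)}}=\mathbf P_{\boldsymbol\Lambda^{(0)}_w}+\mathbf P_{\boldsymbol\Lambda^{(0)}_s}$, where $\mathbf P_{\mathbf A}=\mathbf A(\mathbf A^\top\mathbf A)^{-1}\mathbf A^\top$. $\|\cdot\|$ is the spectral (Euclidean) norm, $\|\cdot\|_F$ Frobenius, $\|\cdot\|_{\max}$ the max-entry norm, $\boldsymbol\Lambda_{i,\cdot}$ the $i$-th row, $M$ a finite constant, $a\asymp b$ means same order. Assumptions. (A1) For all $k\in\{0\}\cup[K]$: $E\|\mathbf f^{(k)}_t\|^4\le M$, and $\mathbf F^{(k)\top}\mathbf F^{(k)}/T_k\to\boldsymbol\Sigma^{(k)}_F$ in probability as $T_k\to\infty$, with $\boldsymbol\Sigma^{(k)}_F$ positive definite with bounded distinct eigenvalues. (A2) $\|\boldsymbol\Lambda^{(k)}\|_{\max}\le M$ for all $k\in\{0\}\cup[K]$; $\|\mathbf D^{-1/2}\boldsymbol\Lambda^{(0)\top}\boldsymbol\Lambda^{(0)}\mathbf D^{-1/2}-\mathbf I_{r_0}\|\to0$ where $\mathbf D=\mathrm{diag}(\mathbf D_s,\mathbf D_w)$ is diagonal with $(\mathbf D_s)_{ii}\asymp N$, $i\in[r_0-s]$, $(\mathbf D_w)_{ii}\asymp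 N^{\alpha_i}$, $i\in[s]$, $0<\alpha_s\le\dots\le\alpha_1<1$; and $\|N^{-1}\boldsymbol\Lambda^{(k)\top}\boldsymbol\Lambda^{(k)}-\mathbf I_{r_k}\|\to0$ for all $k\in[K]$. (A3) $\|\mathbf E^{(k)}\|^2=O_p(N\vee T_k)$ for all $k\in\{0\}\cup[K]$. (A4) For each $t$: $E\|\mathbf D^{-1/2}\sum_i\boldsymbol\Lambda^{(0)\top}_{i,\cdot}\epsilon^{(0)}_{ti}\|^2\le M$ and $E\|N^{-1/2}\sum_i\boldsymbol\Lambda^{(k)\top}_{i,\cdot}\epsilon^{(k)}_{ti}\|^2\le M$ for $k\in[K]$; for each $i$: $E\|T_k^{-1/2}\sum_t\mathbf f^{(k)}_t\epsilon^{(k)}_{ti}\|^2\le M$ for $k\in\{0\}\cup[K]$. (A5) $\|\mathbf P_{\boldsymbol\Lambda^{(k)}_{\mathcal T}}-\mathbf P_{\boldsymbol\Lambda^{(0)}_w}\|_F\le\varepsilon$ for all $k\in\mathcal A$, and there is a constant $\kappa>0$ with $T^{-1}\|T_0\mathbf P_{\boldsymbol\Lambda^{(0)}_s}+\sum_{k\in\mathcal A}T_k\mathbf P_{\boldsymbol\Lambda^{(k)}_{\mathcal T^c}}\|\le 1-\kappa$. (A6) As $N,T\to\infty$: (1) $N/(\sqrt{T_0}N^{\alpha_s})\to0$; (2) $T_0\sqrt N/(T\sqrt{N^{\alpha_s}})\to0$. Oracle TransPCA. For $k\in\{0\}\cup\mathcal A$ let $\hat{\mathbf Q}^{(k)}$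 be the $N\times r_k$ matrix of the leading $r_k$ orthonormal eigenvectors of $\mathbf X^{(k)\top}\mathbf X^{(k)}/(NT_k)$; let $\hat{\mathbf P}^w=T^{-1}\sum_{k\in\{0\}\cup\mathcal A}T_k\hat{\mathbf Q}^{(k)}\hat{\mathbf Q}^{(k)\top}$ and $\hat{\mathbf Q}^{(0)}_w$ its leading $s$ orthonormal eigenvectors; $\hat{\boldsymbol\Lambda}^{(0)}_w=\hat{\mathbf Q}^{(0)}_w\mathbf D_w^{1/2}$ and $\hat{\mathbf F}^{(0)}_w=\mathbf X^{(0)}\hat{\boldsymbol\Lambda}^{(0)}_w\mathbf D_w^{-1}$. Then $\hat{\mathbf Q}^{(0)}_s$ is the leading $r_0-s$ eigenvectors of $(\mathbf I_N-\hat{\mathbf Q}^{(0)}_w\hat{\mathbf Q}^{(0)\top}_w)\,\tfrac{1}{T_0}\mathbf X^{(0)\top}\mathbf X^{(0)}(\mathbf I_N-\hat{\mathbf Q}^{(0)}_w\hat{\mathbf Q}^{(0)\top}_w)$, $\hat{\boldsymbol\Lambda}^{(0)}_s=\sqrt N\hat{\mathbf Q}^{(0)}_s$ and $\hat{\mathbf F}^{(0)}_s=N^{-1}(\mathbf X^{(0)}-\hat{\mathbf F}^{(0)}_w\hat{\boldsymbol\Lambda}^{(0)\top}_w)\hat{\boldsymbol\Lambda}^{(0)}_s$. *)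

theory Defs
  imports "HOL-Probability.Probability" "Jordan_Normal_Form.Char_Poly"
begin

definition vnorm :: "real Matrix.vec \<Rightarrow> real" where
  "vnorm v = sqrt (\<Sum>i<dim_vec v. (v $ i)^2)"

definition spec_norm :: "real Matrix.mat \<Rightarrow> real" where
  "spec_norm A = Sup (insert 0 {vnorm (A *\<^sub>v v) | v. v \<in> carrier_vec (dim_col A) \<and> vnorm v = 1})"

definition frob_norm :: "real Matrix.mat \<Rightarrow> real" where
  "frob_norm A = sqrt (\<Sum>i<dim_row A. \<Sum>j<dim_col A. (A $$ (i,j))^2)"

definition max_norm :: "real Matrix.mat \<Rightarrow> real" where
  "max_norm A = Max (insert 0 {\<bar>A $$ (i,j)\<bar> | i j. i < dim_row A \<and> j < dim_col A})"

text \<open>Inverse of a square matrix (meaningful when the matrix is invertible).\<close>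
definition inv_mat :: "real Matrix.mat \<Rightarrow> real Matrix.mat" where
  "inv_mat A = (SOME B. B \<in> carrier_mat (dim_row A) (dim_row A) \<and>
                        A * B = 1\<^sub>m (dim_row A) \<and> B * A = 1\<^sub>m (dim_row A))"

definition proj :: "real Matrix.mat \<Rightarrow> real Matrix.mat" where
  "proj A = A * inv_mat (A\<^sup>T * A) * A\<^sup>T"

definition cols :: "real Matrix.mat \<Rightarrow> nat \<Rightarrow> nat \<Rightarrow> real Matrix.mat" where
  "cols A a b = mat (dim_row A) (b - a) (\<lambda>(i,j). A $$ (i, a + j))"

definition dmat :: "nat \<Rightarrow> (nat \<Rightarrow> real) \<Rightarrow> real Matrix.mat" where
  "dmat n d = mat n n (\<lambda>(i,j). if i = j then d i else 0)"

definition msum :: "nat \<Rightarrow> 'k set \<Rightarrow> ('k \<Rightarrow> real Matrix.mat) \<Rightarrow> real Matrix.mat" where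
  "msum n I f = mat n n (\<lambda>(i,j). \<Sum>k\<in>I. f k $$ (i,j))"

definition leading_eigvecs :: "real Matrix.mat \<Rightarrow> nat \<Rightarrow> real Matrix.mat \<Rightarrow> bool" where
  "leading_eigvecs S r Q \<longleftrightarrow>
     Q \<in> carrier_mat (dim_row S) r \<and> Q\<^sup>T * Q = 1\<^sub>m r \<and>
     (\<exists>lam :: nat \<Rightarrow> real.
        (\<forall>j<r. eigenvector S (col Q j) (lam j)) \<and>
        (\<forall>i j. i \<le> j \<and> j < r \<longrightarrow> lam j \<le> lam i) \<and>
        (\<forall>v mu. eigenvector S v mu \<and> (\<forall>j<r. col Q j \<bullet> v = 0) \<longrightarrow> (\<forall>j<r. mu \<le> lam j)))"

definition bigOp :: "(nat \<Rightarrow> 'a measure) \<Rightarrow> (nat \<Rightarrow> 'a \<Rightarrow> real) \<Rightarrow> (nat \<Rightarrow> real) \<Rightarrow> bool" where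
  "bigOp M X a \<longleftrightarrow>
     (\<forall>\<delta>>0. \<exists>C. \<exists>n0. \<forall>n\<ge>n0. \<exists>E\<in>sets (M n).
        measure (M n) E \<ge> 1 - \<delta> \<and> (\<forall>\<omega>\<in>E. \<bar>X n \<omega>\<bar> \<le> C * a n))"

definition to_zero_in_prob :: "(nat \<Rightarrow> 'a measure) \<Rightarrow> (nat \<Rightarrow> 'a \<Rightarrow> real) \<Rightarrow> bool" where
  "to_zero_in_prob M Z \<longleftrightarrow>
     (\<forall>\<eta>>0. \<forall>\<delta>>0. \<exists>n0. \<forall>n\<ge>n0. \<exists>E\<in>sets (M n).
        measure (M n) E \<ge> 1 - \<delta> \<and> (\<forall>\<omega>\<in>E. \<bar>Z n \<omega>\<bar> \<le> \<eta>))"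

definition same_order :: "(nat \<Rightarrow> real) \<Rightarrow> (nat \<Rightarrow> real) \<Rightarrow> bool" where
  "same_order a b \<longleftrightarrow> (\<exists>c C. 0 < c \<and> c \<le> C \<and>
     (\<forall>\<^sub>F n in sequentially. 0 < b n \<and> c * b n \<le> a n \<and> a n \<le> C * b n))"

definition fmat :: "nat \<Rightarrow> nat \<Rightarrow> (nat \<Rightarrow> real Matrix.vec) \<Rightarrow> real Matrix.mat" where
  "fmat T r f = mat T r (\<lambda>(t,j). f t $ j)"

definition emat :: "nat \<Rightarrow> nat \<Rightarrow> (nat \<Rightarrow> nat \<Rightarrow> real) \<Rightarrow> real Matrix.mat" where
  "emat T N e = mat T N (\<lambda>(t,i). e t i)"

definition panel :: "real Matrix.mat \<Rightarrow> real Matrix.mat \<Rightarrow> real Matrix.mat \<Rightarrow> real Matrix.mat" where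
  "panel F L E = F * L\<^sup>T + E"

definition pos_def :: "real Matrix.mat \<Rightarrow> bool" where
  "pos_def S \<longleftrightarrow> S \<in> carrier_mat (dim_row S) (dim_row S) \<and> S\<^sup>T = S \<and>
     (\<forall>v \<in> carrier_vec (dim_row S). v \<noteq> 0\<^sub>v (dim_row S) \<longrightarrow> v \<bullet> (S *\<^sub>v v) > 0)"

end

theory Submission
  imports Defs
begin

text \<open>Every perturbation step uses the variational form of the Davis--Kahan theorem due to Yu, Wang and
  Samworth: by the Ky Fan inequality the leading eigenvectors maximise the trace of the compression, and
  comparing them with the population projection bounds the Frobenius distance of the two projections by
  noise over population gap; no lower bound on empirical eigenvalues is needed. For a single panel the
  gap is of order \<open>N powr alpha (s - 1) / N\<close> (target) or constant (sources) and the noise is of order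
  \<open>1 / sqrt T + 1 / N\<close>. For the aggregated projections the gap is \<open>kappa\<close>, because the projections
  onto the complementary loadings are nearly orthogonal to the weak space.

  With the rotation whose inverse transpose is \<open>Lw\<^sup>T * Q * D\<close>, where \<open>D\<close> is diagonal with entries
  \<open>1 / sqrt (dw i)\<close>, the weak common component cancels in the factor error, and only the parts of
  the strong component and of the noise outside the weak space are left, together with the noise
  projected on the true weak space.\<close>

section \<open>Frobenius and spectral norms\<close>

text \<open>Comparisons are made in the Frobenius norm: the projections have fixed rank, so coming
  from the spectral norm costs only factors such as \<open>sqrt (real r)\<close>, and the trace form
  \<open>mip\<close> reduces perturbation theory to Cauchy-Schwarz. The noise matrices are the
  exception: (A3) controls only their spectral norm, so they are always applied to a matrix of
  bounded Frobenius norm first. Two obstacles shape the rest. \<open>leading_eigvecs\<close>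
  compares the chosen eigenvalues only with those of eigenvectors orthogonal to the chosen ones, so
  a bound on quadratic forms must be extracted by maximising over a compact sphere. And the average
  of the population projections does not leave the weak space invariant when sources and target
  disagree; it is replaced by a nearby matrix that does, at the price of a multiple of the
  disagreement. This is where the last term of the rate comes from. By (A4) the noise along the
  scaled loadings is bounded in mean square per period; division by the root of the weakest strength
  turns it into the separate term of the factor rate.\<close>

no_notation inner (infix "\<bullet>" 70)
no_notation vec_nth (infixl "$" 90)

declare minus_carrier_mat [simp]

text \<open>The trace form \<open>trace (A\<^sup>T * B)\<close>. The index ranges come from
  \<open>A\<close> alone, which is why rules about the second argument carry dimension
  hypotheses.\<close>

definition mip :: "real Matrix.mat \<Rightarrow> real Matrix.mat \<Rightarrow> real" where
  "mip A B = (\<Sum>i<dim_row A. \<Sum>j<dim_col A. A $$ (i,j) * B $$ (i,j))"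

lemma mip_carrier:
  "A \<in> carrier_mat n m \<Longrightarrow> mip A B = (\<Sum>i<n. \<Sum>j<m. A $$ (i,j) * B $$ (i,j))"
  by (auto simp: mip_def)

lemma mip_commute: "A \<in> carrier_mat n m \<Longrightarrow> B \<in> carrier_mat n m \<Longrightarrow> mip A B = mip B A"
  by (simp add: mip_carrier mult.commute)

lemma mip_add_left:
  "A \<in> carrier_mat n m \<Longrightarrow> B \<in> carrier_mat n m \<Longrightarrow> mip (A + B) C = mip A C + mip B C"
  by (simp add: mip_carrier[of _ n m] distrib_right sum.distrib)

lemma mip_minus_left:
  "A \<in> carrier_mat n m \<Longrightarrow> B \<in> carrier_mat n m \<Longrightarrow> mip (A - B) C = mip A C - mip B C"
  by (simp add: mip_carrier[of _ n m] left_diff_distrib sum_subtractf minus_carrier_mat)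

lemma mip_add_right:
  "A \<in> carrier_mat n m \<Longrightarrow> B \<in> carrier_mat n m \<Longrightarrow> C \<in> carrier_mat n m \<Longrightarrow> mip C (A + B) = mip C A + mip C B"
  by (simp add: mip_carrier[of _ n m] distrib_left sum.distrib)

lemma mip_minus_right:
  "A \<in> carrier_mat n m \<Longrightarrow> B \<in> carrier_mat n m \<Longrightarrow> C \<in> carrier_mat n m \<Longrightarrow> mip C (A - B) = mip C A - mip C B"
  by (simp add: mip_carrier[of _ n m] right_diff_distrib sum_subtractf minus_carrier_mat)

lemma mip_smult_left: "mip (c \<cdot>\<^sub>m A) B = c * mip A B"
  by (simp add: mip_def sum_distrib_left mult.assoc)

lemma mip_smult_right:
  "A \<in> carrier_mat n m \<Longrightarrow> B \<in> carrier_mat n m \<Longrightarrow> mip A (c \<cdot>\<^sub>m B) = c * mip A B"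
  by (simp add: mip_carrier[of _ n m] sum_distrib_left mult.left_commute)

lemma mip_zero_right [simp]: "A \<in> carrier_mat n m \<Longrightarrow> mip A (0\<^sub>m n m) = 0"
  by (simp add: mip_carrier)

lemma mip_transpose:
  "A \<in> carrier_mat n m \<Longrightarrow> B \<in> carrier_mat n m \<Longrightarrow> mip (A\<^sup>T) (B\<^sup>T) = mip A B"
  by (subst mip_carrier[of _ m n], simp, subst mip_carrier[of _ n m], simp, subst sum.swap) simp

lemma mult_mat_entry:
  assumes "A \<in> carrier_mat n m" "B \<in> carrier_mat m p" "i < n" "j < p"
  shows "(A * B) $$ (i,j) = (\<Sum>k<m. A $$ (i,k) * B $$ (k,j))"
  using assms by (auto simp: scalar_prod_def atLeast0LessThan)

text \<open>Adjointness of multiplication with respect to the trace form; together with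
  \<open>mip_mult_left\<close> it takes the place of cyclicity of the trace.\<close>

lemma mip_mult_right:
  assumes A: "A \<in> carrier_mat n m" and B: "B \<in> carrier_mat m p" and C: "C \<in> carrier_mat n p"
  shows "mip (A * B) C = mip A (C * B\<^sup>T)"
proof -
  have "mip (A * B) C = (\<Sum>i<n. \<Sum>j<p. \<Sum>k<m. A $$ (i,k) * B $$ (k,j) * C $$ (i,j))"
    using A B C by (subst mip_carrier[of _ n p])
      (auto simp: mult_mat_entry[OF A B] sum_distrib_right simp del: index_mult_mat(1))
  also have "\<dots> = (\<Sum>i<n. \<Sum>k<m. \<Sum>j<p. A $$ (i,k) * B $$ (k,j) * C $$ (i,j))"
    by (intro sum.cong refl sum.swap)
  also have "\<dots> = mip A (C * B\<^sup>T)"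
    using A B C by (subst mip_carrier[of _ n m])
      (auto intro!: sum.cong simp: mult_mat_entry[OF C, of "B\<^sup>T" m] sum_distrib_left ac_simps
            simp del: index_mult_mat(1))
  finally show ?thesis .
qed

lemma mip_mult_left:
  assumes A: "A \<in> carrier_mat n m" and B: "B \<in> carrier_mat m p" and C: "C \<in> carrier_mat n p"
  shows "mip (A * B) C = mip B (A\<^sup>T * C)"
proof -
  have "mip (A * B) C = mip (B\<^sup>T * A\<^sup>T) (C\<^sup>T)"
    using mip_transpose[of "A * B" n p C] A B C by (simp add: transpose_mult[OF A B])
  also have "\<dots> = mip (B\<^sup>T) (C\<^sup>T * A)"
    using mip_mult_right[of "B\<^sup>T" p m "A\<^sup>T" n "C\<^sup>T"] A B C by simp
  also have "\<dots> = mip B (A\<^sup>T * C)"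
    using mip_transpose[of B m p "A\<^sup>T * C"] A B C by (simp add: transpose_mult[of _ m n _ p])
  finally show ?thesis .
qed

lemma frob_norm_mip: "frob_norm A = sqrt (mip A A)"
  by (simp add: frob_norm_def mip_def power2_eq_square)

lemma mip_self_nonneg: "0 \<le> mip A A"
  by (simp add: mip_def sum_nonneg)

lemma frob_norm_nonneg [simp]: "0 \<le> frob_norm A"
  by (simp add: frob_norm_mip mip_self_nonneg)

lemma frob_norm_sq: "(frob_norm A)\<^sup>2 = mip A A"
  by (simp add: frob_norm_mip mip_self_nonneg)

lemma mip_sum_prod:
  assumes "A \<in> carrier_mat n m"
  shows "mip A B = (\<Sum>p\<in>{..<n}\<times>{..<m}. A $$ p * B $$ p)"
  using assms by (simp add: mip_carrier sum.cartesian_product)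

lemma mip_le_frob:
  assumes A: "A \<in> carrier_mat n m" and B: "B \<in> carrier_mat n m"
  shows "\<bar>mip A B\<bar> \<le> frob_norm A * frob_norm B"
proof -
  have "(mip A B)\<^sup>2 \<le> mip A A * mip B B"
    unfolding mip_sum_prod[OF A] mip_sum_prod[OF B]
    using Cauchy_Schwarz_ineq_sum[of "($$) A" "($$) B" "{..<n}\<times>{..<m}"]
    by (simp add: power2_eq_square)
  then have "sqrt ((mip A B)\<^sup>2) \<le> sqrt (mip A A * mip B B)"
    by (rule real_sqrt_le_mono)
  then show ?thesis by (simp add: frob_norm_mip real_sqrt_mult)
qed

lemma frob_norm_transpose [simp]: "frob_norm (A\<^sup>T) = frob_norm A"
  unfolding frob_norm_mip by (subst mip_transpose[of A "dim_row A" "dim_col A"]) auto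

lemma frob_norm_smult: "frob_norm (c \<cdot>\<^sub>m A) = \<bar>c\<bar> * frob_norm A"
proof -
  have "mip (c \<cdot>\<^sub>m A) (c \<cdot>\<^sub>m A) = c\<^sup>2 * mip A A"
    unfolding mip_smult_left by (subst mip_smult_right[of A "dim_row A" "dim_col A"]) (auto simp: power2_eq_square)
  then show ?thesis by (simp add: frob_norm_mip real_sqrt_mult)
qed

lemma frob_norm_add_le:
  assumes A: "A \<in> carrier_mat n m" and B: "B \<in> carrier_mat n m"
  shows "frob_norm (A + B) \<le> frob_norm A + frob_norm B"
proof -
  have "mip (A + B) (A + B) = mip A A + 2 * mip A B + mip B B"
    using A B by (simp add: mip_add_left[of _ n m] mip_add_right[of _ n m] mip_commute[of B n m A])
  also have "\<dots> \<le> (frob_norm A + frob_norm B)\<^sup>2"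
    using mip_le_frob[OF A B] by (simp add: power2_sum frob_norm_sq)
  finally show ?thesis
    by (metis add_nonneg_nonneg frob_norm_mip frob_norm_nonneg real_le_lsqrt mip_self_nonneg)
qed

lemma frob_norm_minus_le:
  assumes A: "A \<in> carrier_mat n m" and B: "B \<in> carrier_mat n m"
  shows "frob_norm (A - B) \<le> frob_norm A + frob_norm B"
proof -
  have "A - B = A + (-1) \<cdot>\<^sub>m B" using A B by (intro eq_matI) auto
  then show ?thesis using frob_norm_add_le[OF A, of "(-1) \<cdot>\<^sub>m B"] B
    by (simp add: frob_norm_smult)
qed

lemma frob_norm_mult_le:
  assumes A: "A \<in> carrier_mat n m" and B: "B \<in> carrier_mat m p"
  shows "frob_norm (A * B) \<le> frob_norm A * frob_norm B"
proof -
  have "mip (A * B) (A * B) = (\<Sum>i<n. \<Sum>j<p. (\<Sum>k<m. A $$ (i,k) * B $$ (k,j))\<^sup>2)"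
    using A B by (subst mip_carrier[of _ n p])
      (auto simp: mult_mat_entry[OF A B] power2_eq_square simp del: index_mult_mat(1))
  also have "\<dots> \<le> (\<Sum>i<n. \<Sum>j<p. (\<Sum>k<m. (A $$ (i,k))\<^sup>2) * (\<Sum>k<m. (B $$ (k,j))\<^sup>2))"
    by (intro sum_mono Cauchy_Schwarz_ineq_sum)
  also have "\<dots> = (\<Sum>i<n. \<Sum>k<m. (A $$ (i,k))\<^sup>2) * (\<Sum>j<p. \<Sum>k<m. (B $$ (k,j))\<^sup>2)"
    by (simp add: sum_product)
  also have "\<dots> = mip A A * mip B B"
    using A B by (simp add: mip_carrier[of _ n m] mip_carrier[of _ m p] power2_eq_square sum.swap[of _ "{..<p}"])
  finally have "sqrt (mip (A * B) (A * B)) \<le> sqrt (mip A A * mip B B)" by simp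
  then show ?thesis by (simp add: frob_norm_mip real_sqrt_mult)
qed

lemma frob_norm_zero [simp]: "frob_norm (0\<^sub>m n m) = 0"
  by (simp add: frob_norm_def)

lemma frob_norm_eq_0:
  assumes "A \<in> carrier_mat n m" "frob_norm A = 0"
  shows "A = 0\<^sub>m n m"
proof -
  have "(\<Sum>p\<in>{..<n}\<times>{..<m}. A $$ p * A $$ p) = 0"
    using assms(2) mip_sum_prod[OF assms(1), of A] by (simp add: frob_norm_mip mip_self_nonneg)
  then have "\<forall>p\<in>{..<n}\<times>{..<m}. A $$ p * A $$ p = 0"
    by (subst (asm) sum_nonneg_eq_0_iff) auto
  then show ?thesis using assms(1) by (intro eq_matI) auto
qed

lemma frob_norm_one: "frob_norm (1\<^sub>m n) = sqrt (real n)"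
proof -
  have "mip (1\<^sub>m n) (1\<^sub>m n) = (\<Sum>i<n. \<Sum>j<n. if j = i then 1 else 0)"
    unfolding mip_carrier[OF one_carrier_mat] by (intro sum.cong refl) auto
  then show ?thesis by (simp add: frob_norm_mip)
qed

section \<open>Euclidean norm of vectors and spectral norm\<close>

lemma vnorm_nonneg [simp]: "0 \<le> vnorm v"
  by (simp add: vnorm_def sum_nonneg)

lemma vnorm_sq: "(vnorm v)\<^sup>2 = (\<Sum>i<dim_vec v. (v $ i)\<^sup>2)"
  by (simp add: vnorm_def sum_nonneg)

lemma vnorm_sq_scalar: "(vnorm v)\<^sup>2 = v \<bullet> v"
  by (subst vnorm_sq) (simp add: scalar_prod_def power2_eq_square atLeast0LessThan)

lemma vnorm_smult: "vnorm (c \<cdot>\<^sub>v v) = \<bar>c\<bar> * vnorm v"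
  by (simp add: vnorm_def power_mult_distrib real_sqrt_mult flip: sum_distrib_left)

lemma vnorm_eq_0:
  assumes "v \<in> carrier_vec n" "vnorm v = 0"
  shows "v = 0\<^sub>v n"
proof -
  have "(\<Sum>i<n. (v $ i)\<^sup>2) = 0" using assms vnorm_sq[of v] by auto
  then have "\<forall>i<n. v $ i = 0" by (subst (asm) sum_nonneg_eq_0_iff) auto
  then show ?thesis using assms by (intro eq_vecI) auto
qed

lemma mult_mat_vec_entry:
  assumes "A \<in> carrier_mat n m" "v \<in> carrier_vec m" "i < n"
  shows "(A *\<^sub>v v) $ i = (\<Sum>k<m. A $$ (i,k) * v $ k)"
  using assms by (auto simp: scalar_prod_def atLeast0LessThan)

lemma vnorm_mult_le_frob:
  assumes A: "A \<in> carrier_mat n m" and v: "v \<in> carrier_vec m"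
  shows "vnorm (A *\<^sub>v v) \<le> frob_norm A * vnorm v"
proof -
  have "(vnorm (A *\<^sub>v v))\<^sup>2 = (\<Sum>i<n. (\<Sum>k<m. A $$ (i,k) * v $ k)\<^sup>2)"
    using A by (simp add: vnorm_sq mult_mat_vec_entry[OF A v] del: index_mult_mat_vec)
  also have "\<dots> \<le> (\<Sum>i<n. (\<Sum>k<m. (A $$ (i,k))\<^sup>2) * (\<Sum>k<m. (v $ k)\<^sup>2))"
    by (intro sum_mono Cauchy_Schwarz_ineq_sum)
  also have "\<dots> = (frob_norm A * vnorm v)\<^sup>2"
    using A v by (simp add: power_mult_distrib vnorm_sq frob_norm_sq mip_carrier sum_distrib_right flip: power2_eq_square)
  finally show ?thesis
    by (rule power2_le_imp_le) simp
qed

text \<open>\<open>Sup\<close> obeys its usual laws only on sets bounded above; the Frobenius norm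
  is such a bound. The inserted 0 covers matrices without columns, which have no unit vectors to act
  on.\<close>

lemma spec_norm_bdd:
  "bdd_above (insert 0 {vnorm (A *\<^sub>v v) | v. v \<in> carrier_vec (dim_col A) \<and> vnorm v = 1})"
proof (rule bdd_aboveI)
  fix x assume "x \<in> insert 0 {vnorm (A *\<^sub>v v) | v. v \<in> carrier_vec (dim_col A) \<and> vnorm v = 1}"
  then show "x \<le> frob_norm A"
    using vnorm_mult_le_frob[of A "dim_row A" "dim_col A"] by force
qed

lemma spec_norm_nonneg [simp]: "0 \<le> spec_norm A"
  unfolding spec_norm_def by (rule cSup_upper[OF _ spec_norm_bdd]) simp

lemma spec_norm_le_frob: "spec_norm A \<le> frob_norm A"
  unfolding spec_norm_def
proof (rule cSup_least)
  fix x assume "x \<in> insert 0 {vnorm (A *\<^sub>v v) | v. v \<in> carrier_vec (dim_col A) \<and> vnorm v = 1}"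
  then show "x \<le> frob_norm A"
    using vnorm_mult_le_frob[of A "dim_row A" "dim_col A"] by force
qed simp

lemma vnorm_mult_le_spec:
  assumes A: "A \<in> carrier_mat n m" and v: "v \<in> carrier_vec m"
  shows "vnorm (A *\<^sub>v v) \<le> spec_norm A * vnorm v"
proof (cases "vnorm v = 0")
  case True
  then show ?thesis using vnorm_mult_le_frob[OF A v] by simp
next
  case False
  then have pos: "0 < vnorm v" using vnorm_nonneg[of v] by linarith
  define w where "w = (1 / vnorm v) \<cdot>\<^sub>v v"
  have w: "w \<in> carrier_vec m" "vnorm w = 1" using v pos by (auto simp: w_def vnorm_smult)
  have "vnorm (A *\<^sub>v w) \<le> spec_norm A"
    unfolding spec_norm_def by (rule cSup_upper[OF _ spec_norm_bdd]) (use w A in auto)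
  moreover have "A *\<^sub>v w = (1 / vnorm v) \<cdot>\<^sub>v (A *\<^sub>v v)"
    unfolding w_def using A v by (simp add: mult_mat_vec)
  ultimately show ?thesis using pos by (simp add: vnorm_smult field_simps)
qed

lemma frob_norm_sq_cols:
  assumes "B \<in> carrier_mat m p"
  shows "(frob_norm B)\<^sup>2 = (\<Sum>j<p. (vnorm (col B j))\<^sup>2)"
  using assms unfolding frob_norm_sq mip_carrier[OF assms] vnorm_sq
  by (subst sum.swap) (simp add: power2_eq_square)

lemma col_mult_mat_vec:
  assumes "A \<in> carrier_mat n m" "B \<in> carrier_mat m p" "j < p"
  shows "col (A * B) j = A *\<^sub>v col B j"
  using assms by (intro eq_vecI) auto

text \<open>Columnwise application of the operator bound. It keeps the noise in the spectral norm,
  the one that (A3) controls.\<close>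

lemma frob_norm_mult_le_spec:
  assumes A: "A \<in> carrier_mat n m" and B: "B \<in> carrier_mat m p"
  shows "frob_norm (A * B) \<le> spec_norm A * frob_norm B"
proof -
  have "(frob_norm (A * B))\<^sup>2 = (\<Sum>j<p. (vnorm (A *\<^sub>v col B j))\<^sup>2)"
    unfolding frob_norm_sq_cols[OF mult_carrier_mat[OF A B]]
    by (intro sum.cong refl) (simp only: col_mult_mat_vec[OF A B] lessThan_iff)
  also have "\<dots> \<le> (\<Sum>j<p. (spec_norm A * vnorm (col B j))\<^sup>2)"
    using B by (intro sum_mono power_mono vnorm_mult_le_spec[OF A]) auto
  also have "\<dots> = (spec_norm A * frob_norm B)\<^sup>2"
    by (simp add: power_mult_distrib frob_norm_sq_cols[OF B] sum_distrib_left)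
  finally show ?thesis by (rule power2_le_imp_le) simp
qed

text \<open>The identity has Frobenius norm \<open>sqrt (real m)\<close>. With \<open>m\<close> a
  fixed number of factors, the spectral conditions of (A2) become Frobenius bounds.\<close>

lemma frob_norm_le_spec:
  assumes A: "A \<in> carrier_mat n m"
  shows "frob_norm A \<le> spec_norm A * sqrt (real m)"
  using frob_norm_mult_le_spec[OF A, of "1\<^sub>m m" m] A by (simp add: frob_norm_one)

lemma mip_vec:
  assumes S: "S \<in> carrier_mat n n" and Z: "Z \<in> carrier_mat n p"
  shows "mip (S * Z) Z = (\<Sum>j<p. col Z j \<bullet> (S *\<^sub>v col Z j))"
proof -
  have "mip (S * Z) Z = (\<Sum>j<p. \<Sum>i<n. (S * Z) $$ (i,j) * Z $$ (i,j))"
    using S Z by (subst mip_carrier[of _ n p]) (auto simp: sum.swap[of _ "{..<p}"])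
  also have "\<dots> = (\<Sum>j<p. col Z j \<bullet> col (S * Z) j)"
    using S Z by (intro sum.cong) (auto simp: scalar_prod_def atLeast0LessThan mult.commute)
  finally show ?thesis using col_mult_mat_vec[OF S Z] by simp
qed

section \<open>Quadratic forms on the complement of the leading eigenvectors\<close>

text \<open>Tychonoff's theorem. The maximisation below is carried out among functions on
  \<open>nat\<close> with the product topology, into which vectors are embedded.\<close>

lemma compact_box:
  fixes a b :: "nat \<Rightarrow> real"
  shows "compact (Pi\<^sub>E UNIV (\<lambda>i. {a i..b i}))"
proof -
  have "compactin (product_topology (\<lambda>i::nat. euclidean :: real topology) UNIV) (Pi\<^sub>E UNIV (\<lambda>i. {a i..b i}))"
    by (subst compactin_PiE) auto
  then show ?thesis by (simp add: euclidean_product_topology)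
qed

text \<open>The constrained unit sphere is compact and the form continuous, so a maximiser exists;
  arbitrary vectors follow by homogeneity. The vector \<open>u\<close> witnesses that the sphere is
  nonempty.\<close>

lemma quad_form_attains_max:
  fixes S Q :: "real Matrix.mat"
  assumes S: "S \<in> carrier_mat n n" and Q: "Q \<in> carrier_mat n r"
    and u: "u \<in> carrier_vec n" "u \<noteq> 0\<^sub>v n" "\<forall>j<r. col Q j \<bullet> u = 0"
  shows "\<exists>x\<in>carrier_vec n. x \<bullet> x = 1 \<and> (\<forall>j<r. col Q j \<bullet> x = 0) \<and>
    (\<forall>v\<in>carrier_vec n. (\<forall>j<r. col Q j \<bullet> v = 0) \<longrightarrow> v \<bullet> (S *\<^sub>v v) \<le> (x \<bullet> (S *\<^sub>v x)) * (v \<bullet> v))"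
proof -
  \<comment> \<open>The box confines the first \<open>n\<close> coordinates to
    \<open>[-1, 1]\<close> and pins all others to 0, so \<open>K\<close> is a copy of the
    finite-dimensional sphere inside the product space.\<close>
  define K where "K = {f :: nat \<Rightarrow> real. (\<Sum>i<n. f i * f i) = 1 \<and> (\<forall>j<r. (\<Sum>i<n. Q $$ (i,j) * f i) = 0)}
      \<inter> Pi\<^sub>E UNIV (\<lambda>i. {if i < n then -1 else 0 .. if i < n then 1 else (0::real)})"
  define g where "g = (\<lambda>f :: nat \<Rightarrow> real. \<Sum>i<n. f i * (\<Sum>k<n. S $$ (i,k) * f k))"
  have cont: "continuous_on UNIV (\<lambda>f :: nat \<Rightarrow> real. f i)" for i by simp
  have "closed {f :: nat \<Rightarrow> real. (\<Sum>i<n. f i * f i) = 1 \<and> (\<forall>j<r. (\<Sum>i<n. Q $$ (i,j) * f i) = 0)}"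
    by (intro closed_Collect_conj closed_Collect_all closed_Collect_imp closed_Collect_eq continuous_intros cont) auto
  then have K: "compact K" unfolding K_def by (intro closed_Int_compact compact_box)
  have g: "continuous_on K g" unfolding g_def
    by (intro continuous_intros continuous_on_subset[OF cont]) auto
  define fn where "fn = (\<lambda>(v :: real Matrix.vec) i. if i < n then v $ i else 0)"
  have ip: "v \<bullet> v = (\<Sum>i<n. v $ i * v $ i)" if "v \<in> carrier_vec n" for v :: "real Matrix.vec"
    using that by (auto simp: scalar_prod_def atLeast0LessThan)
  have orth: "col Q j \<bullet> v = (\<Sum>i<n. Q $$ (i,j) * v $ i)" if "v \<in> carrier_vec n" "j < r" for v :: "real Matrix.vec" and j
    using that Q by (auto simp: scalar_prod_def atLeast0LessThan)
  have quad: "v \<bullet> (S *\<^sub>v v) = (\<Sum>i<n. v $ i * (\<Sum>k<n. S $$ (i,k) * v $ k))" if "v \<in> carrier_vec n" for v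
    using that S by (auto simp: scalar_prod_def atLeast0LessThan)
  have gfn: "g (fn v) = v \<bullet> (S *\<^sub>v v)" if "v \<in> carrier_vec n" for v
    by (simp add: g_def fn_def quad[OF that])
  have fnK: "fn v \<in> K" if v: "v \<in> carrier_vec n" "v \<bullet> v = 1" "\<forall>j<r. col Q j \<bullet> v = 0" for v
  proof -
    have "\<bar>v $ i\<bar> \<le> 1" if "i < n" for i
    proof -
      have "v $ i * v $ i \<le> (\<Sum>i<n. v $ i * v $ i)" by (rule member_le_sum) (use that in auto)
      then show ?thesis using ip[OF v(1)] v(2) abs_le_square_iff[of "v $ i" 1] by (simp add: power2_eq_square)
    qed
    then show ?thesis using v orth ip[OF v(1)] unfolding K_def fn_def by (auto simp: abs_le_iff minus_le_iff)
  qed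
  have normalize: "(\<forall>j<r. col Q j \<bullet> ((1 / sqrt (v \<bullet> v)) \<cdot>\<^sub>v v) = 0) \<and>
      ((1 / sqrt (v \<bullet> v)) \<cdot>\<^sub>v v) \<bullet> ((1 / sqrt (v \<bullet> v)) \<cdot>\<^sub>v v) = 1 \<and> 0 < v \<bullet> v"
    if v: "v \<in> carrier_vec n" "\<forall>j<r. col Q j \<bullet> v = 0" "v \<noteq> 0\<^sub>v n" for v
  proof -
    have p: "0 < v \<bullet> v" using v vnorm_eq_0[OF v(1)] vnorm_sq_scalar[of v]
      by (metis less_eq_real_def power_zero_numeral vnorm_sq_scalar zero_le_power2 power2_eq_iff zero_eq_power2)
    then show ?thesis using v Q
      by (auto simp: scalar_prod_smult_distrib[of _ n] smult_scalar_prod_distrib[of _ n] power2_eq_square[symmetric] real_sqrt_pow2)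
  qed
  have "K \<noteq> {}" using fnK[of "(1 / sqrt (u \<bullet> u)) \<cdot>\<^sub>v u"] normalize[of u] u by auto
  then obtain h where h: "h \<in> K" "\<And>f. f \<in> K \<Longrightarrow> g f \<le> g h"
    using continuous_attains_sup[OF K _ g] by blast
  define x where "x = Matrix.vec n h"
  have x: "x \<in> carrier_vec n" by (simp add: x_def)
  have fx: "fn x = h" using h(1) by (auto simp: K_def fn_def x_def PiE_iff fun_eq_iff split: if_splits)
  show ?thesis
  proof (intro bexI[of _ x] conjI ballI impI allI)
    show "x \<bullet> x = 1" using h(1) ip[OF x] by (simp add: K_def x_def)
    show "col Q j \<bullet> x = 0" if "j < r" for j using h(1) orth[OF x that] that by (simp add: K_def x_def)
    fix v assume v: "v \<in> carrier_vec n" "\<forall>j<r. col Q j \<bullet> v = 0"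
    show "v \<bullet> (S *\<^sub>v v) \<le> (x \<bullet> (S *\<^sub>v x)) * (v \<bullet> v)"
    proof (cases "v = 0\<^sub>v n")
      case True
      then show ?thesis using S by auto
    next
      case False
      let ?w = "(1 / sqrt (v \<bullet> v)) \<cdot>\<^sub>v v"
      note nv = normalize[OF v False]
      have "g (fn ?w) \<le> g h" using fnK[of ?w] nv v h(2) by auto
      then have "?w \<bullet> (S *\<^sub>v ?w) \<le> x \<bullet> (S *\<^sub>v x)" using gfn[of ?w] gfn[OF x] v fx by simp
      moreover have "?w \<bullet> (S *\<^sub>v ?w) = (v \<bullet> (S *\<^sub>v v)) / (v \<bullet> v)"
        using v S nv by (simp add: mult_mat_vec[OF S] scalar_prod_smult_distrib[of _ n] smult_scalar_prod_distrib[of _ n])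
      ultimately show ?thesis using nv by (simp only: pos_divide_le_eq)
    qed
  qed (rule x)
qed

lemma mat_sym_scalar:
  assumes "S \<in> carrier_mat n n" "S\<^sup>T = S" "u \<in> carrier_vec n" "v \<in> carrier_vec n"
  shows "u \<bullet> (S *\<^sub>v v) = (S *\<^sub>v u) \<bullet> (v :: real Matrix.vec)"
  using transpose_vec_mult_scalar[of S n n v u] assms by (simp add: comm_scalar_prod[of _ n])

text \<open>The complement of the eigenvectors is invariant under the symmetric \<open>S\<close>, so
  a maximiser of the Rayleigh quotient on it is itself an eigenvector. Its eigenvalue is covered by
  \<open>top\<close> and dominates all quadratic forms on the complement.\<close>

lemma leading_quad_le:
  fixes S Q :: "real Matrix.mat"
  assumes S: "S \<in> carrier_mat n n" "S\<^sup>T = S" and Q: "Q \<in> carrier_mat n r"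
    and ev: "\<forall>j<r. eigenvector S (col Q j) (lam j)"
    and top: "\<forall>v mu. eigenvector S v mu \<and> (\<forall>j<r. col Q j \<bullet> v = 0) \<longrightarrow> (\<forall>j<r. mu \<le> lam j)"
    and v: "v \<in> carrier_vec n" "\<forall>j<r. col Q j \<bullet> v = 0" and j: "j < r"
  shows "v \<bullet> (S *\<^sub>v v) \<le> lam j * (v \<bullet> v)"
proof (cases "v = 0\<^sub>v n")
  case True
  then show ?thesis using S by auto
next
  case False
  obtain x where x: "x \<in> carrier_vec n" "x \<bullet> x = 1" "\<forall>j<r. col Q j \<bullet> x = 0"
    and mx: "\<And>w. w \<in> carrier_vec n \<Longrightarrow> \<forall>j<r. col Q j \<bullet> w = 0 \<Longrightarrow>
      w \<bullet> (S *\<^sub>v w) \<le> (x \<bullet> (S *\<^sub>v x)) * (w \<bullet> w)"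
    using quad_form_attains_max[OF S(1) Q v(1) False v(2)] by blast
  define m where "m = x \<bullet> (S *\<^sub>v x)"
  \<comment> \<open>The residual of the eigenvector equation. It lies in the complement, hence is an
    admissible direction for varying the maximiser.\<close>
  define w where "w = S *\<^sub>v x - m \<cdot>\<^sub>v x"
  have Sx: "S *\<^sub>v x \<in> carrier_vec n" and w: "w \<in> carrier_vec n" using S x by (auto simp: w_def)
  have qc: "col Q j \<in> carrier_vec n" if "j < r" for j using Q that by auto
  have "col Q j \<bullet> w = 0" if "j < r" for j
  proof -
    have "S *\<^sub>v col Q j = lam j \<cdot>\<^sub>v col Q j" using ev that by (simp add: eigenvector_def)
    then have "col Q j \<bullet> (S *\<^sub>v x) = 0"
      using mat_sym_scalar[OF S qc[OF that] x(1)] x(3) that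
      by (simp add: smult_scalar_prod_distrib[OF qc[OF that] x(1)])
    then show ?thesis using that qc[OF that] x Sx by (simp add: w_def scalar_prod_minus_distrib[of _ n])
  qed
  then have wW: "\<forall>j<r. col Q j \<bullet> w = 0" by simp
  have Sw: "S *\<^sub>v w \<in> carrier_vec n" using S w by auto
  \<comment> \<open>Maximality along \<open>x + t w\<close> leaves a term linear in \<open>t\<close>
    against a quadratic one; for small positive \<open>t\<close> this is impossible unless
    \<open>w\<close> vanishes.\<close>
  have quad: "2 * t * (w \<bullet> w) \<le> t^2 * (m * (w \<bullet> w) - w \<bullet> (S *\<^sub>v w))" for t
  proof -
    let ?y = "x + t \<cdot>\<^sub>v w"
    have y: "?y \<in> carrier_vec n" using x w by auto
    have "\<forall>j<r. col Q j \<bullet> ?y = 0"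
      using wW x(3) qc x(1) w by (simp add: scalar_prod_add_distrib[of _ n] scalar_prod_smult_distrib[of _ n])
    from mx[OF y this]
    have le: "?y \<bullet> (S *\<^sub>v ?y) \<le> m * (?y \<bullet> ?y)" by (simp add: m_def)
    have Sy: "S *\<^sub>v ?y = S *\<^sub>v x + t \<cdot>\<^sub>v (S *\<^sub>v w)"
      using S x w by (simp add: mult_add_distrib_mat_vec[of _ n n] mult_mat_vec)
    have sw: "w \<bullet> (S *\<^sub>v x) = x \<bullet> (S *\<^sub>v w)"
      using mat_sym_scalar[OF S x(1) w] comm_scalar_prod[OF w Sx] by simp
    have e1: "?y \<bullet> (S *\<^sub>v ?y) = m + 2 * t * (w \<bullet> (S *\<^sub>v x)) + t^2 * (w \<bullet> (S *\<^sub>v w))"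
      unfolding Sy using x w Sx Sw sw
      by (simp add: scalar_prod_add_distrib[of _ n] add_scalar_prod_distrib[of _ n] scalar_prod_smult_distrib[of _ n]
          smult_scalar_prod_distrib[of _ n] m_def power2_eq_square algebra_simps)
    have e2: "?y \<bullet> ?y = 1 + 2 * t * (w \<bullet> x) + t^2 * (w \<bullet> w)"
      using x w comm_scalar_prod[OF x(1) w]
      by (simp add: scalar_prod_add_distrib[of _ n] add_scalar_prod_distrib[of _ n] scalar_prod_smult_distrib[of _ n]
          smult_scalar_prod_distrib[of _ n] power2_eq_square algebra_simps)
    have "w \<bullet> w = w \<bullet> (S *\<^sub>v x) - m * (w \<bullet> x)"
      using x w Sx by (subst (2) w_def) (simp add: scalar_prod_minus_distrib[of _ n] scalar_prod_smult_distrib[of _ n])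
    then have e3: "w \<bullet> (S *\<^sub>v x) = w \<bullet> w + m * (w \<bullet> x)" by simp
    show ?thesis using le unfolding e1 e2 e3 by (simp add: algebra_simps)
  qed
  have "w \<bullet> w = 0"
  proof (rule ccontr)
    assume "w \<bullet> w \<noteq> 0"
    then have p: "0 < w \<bullet> w" using vnorm_sq_scalar[of w] by (metis zero_le_power2 less_eq_real_def)
    define c where "c = \<bar>m * (w \<bullet> w) - w \<bullet> (S *\<^sub>v w)\<bar> + 1"
    have c: "0 < c" "m * (w \<bullet> w) - w \<bullet> (S *\<^sub>v w) \<le> c" by (auto simp: c_def)
    \<comment> \<open>The trial value \<open>t = (w \<bullet> w) / c\<close> makes the right side
      half of the left one.\<close>
    have "2 * ((w \<bullet> w) / c) * (w \<bullet> w) \<le> ((w \<bullet> w) / c)^2 * c"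
      using quad[of "(w \<bullet> w) / c"] mult_left_mono[OF c(2), of "((w \<bullet> w) / c)^2"] by simp
    then show False using p c(1) by (simp add: power2_eq_square field_simps)
  qed
  then have "w = 0\<^sub>v n" using vnorm_eq_0[OF w] vnorm_sq_scalar[of w] by simp
  then have "S *\<^sub>v x = m \<cdot>\<^sub>v x"
    using S Sx x(1) unfolding w_def by (intro eq_vecI) (auto simp: vec_eq_iff)
  moreover have "x \<noteq> 0\<^sub>v n" using x(2) by auto
  ultimately have "eigenvector S x m" using x(1) S by (simp add: eigenvector_def)
  then have "m \<le> lam j" using top x(3) j by blast
  then show ?thesis
    using mx[OF v] mult_right_mono[of m "lam j" "v \<bullet> v"] vnorm_sq_scalar[of v] zero_le_power2[of "vnorm v"]
    unfolding m_def by linarith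
qed

text \<open>On the compact unit sphere the form attains a positive minimum, found as a maximum for
  \<open>- S\<close>. In dimension 0 any constant works.\<close>

lemma pos_def_coercive:
  assumes "pos_def S"
  shows "\<exists>c>0. \<forall>v\<in>carrier_vec (dim_row S). c * (v \<bullet> v) \<le> v \<bullet> (S *\<^sub>v v)"
proof -
  define n where "n = dim_row S"
  have S: "S \<in> carrier_mat n n" and pd: "\<And>v. v \<in> carrier_vec n \<Longrightarrow> v \<noteq> 0\<^sub>v n \<Longrightarrow> v \<bullet> (S *\<^sub>v v) > 0"
    using assms unfolding pos_def_def n_def by blast+
  have "\<exists>c>0. \<forall>v\<in>carrier_vec n. c * (v \<bullet> v) \<le> v \<bullet> (S *\<^sub>v v)"
  proof (cases "\<exists>u. u \<in> carrier_vec n \<and> u \<noteq> (0\<^sub>v n :: real Matrix.vec)")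
    case False
    have "1 * (v \<bullet> v) \<le> v \<bullet> (S *\<^sub>v v)" if "v \<in> carrier_vec n" for v
    proof -
      have "v = 0\<^sub>v n" using False that by blast
      moreover have "S *\<^sub>v v \<in> carrier_vec n" using S that by auto
      ultimately show ?thesis by simp
    qed
    then show ?thesis by (intro exI[of _ 1]) simp
  next
    case True
    then obtain u :: "real Matrix.vec" where u: "u \<in> carrier_vec n" "u \<noteq> 0\<^sub>v n" by blast
    have neg: "v \<bullet> ((- 1) \<cdot>\<^sub>m S *\<^sub>v v) = - (v \<bullet> (S *\<^sub>v v))" if "v \<in> carrier_vec n" for v
    proof -
      have "(- 1) \<cdot>\<^sub>m S *\<^sub>v v = (- 1) \<cdot>\<^sub>v (S *\<^sub>v v)" using S that by (intro eq_vecI) auto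
      then show ?thesis using S that by simp
    qed
    \<comment> \<open>A matrix \<open>Q\<close> without columns imposes no orthogonality
      constraint.\<close>
    obtain x where x: "x \<in> carrier_vec n" "x \<bullet> x = 1"
      and mx: "\<forall>v\<in>carrier_vec n. v \<bullet> ((- 1) \<cdot>\<^sub>m S *\<^sub>v v) \<le> (x \<bullet> ((- 1) \<cdot>\<^sub>m S *\<^sub>v x)) * (v \<bullet> v)"
      using quad_form_attains_max[of "(- 1) \<cdot>\<^sub>m S" n "0\<^sub>m n 0" 0, OF _ _ u] S by auto
    have "x \<noteq> 0\<^sub>v n" using x(2) by auto
    then have "0 < x \<bullet> (S *\<^sub>v x)" using pd[OF x(1)] by simp
    moreover have "(x \<bullet> (S *\<^sub>v x)) * (v \<bullet> v) \<le> v \<bullet> (S *\<^sub>v v)" if "v \<in> carrier_vec n" for v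
      using mx that neg[OF that] neg[OF x(1)] by fastforce
    ultimately show ?thesis by blast
  qed
  then show ?thesis by (simp add: n_def)
qed

section \<open>Ky Fan inequality and projection perturbation\<close>

definition is_proj :: "nat \<Rightarrow> real Matrix.mat \<Rightarrow> bool" where
  "is_proj n P \<longleftrightarrow> P \<in> carrier_mat n n \<and> P\<^sup>T = P \<and> P * P = P"

lemma is_proj_compl:
  assumes "is_proj n P"
  shows "is_proj n (1\<^sub>m n - P)"
proof -
  have P: "P \<in> carrier_mat n n" "P\<^sup>T = P" "P * P = P" using assms by (auto simp: is_proj_def)
  have "(1\<^sub>m n - P) * (1\<^sub>m n - P) = (1\<^sub>m n - P) - (P - P * P)"
    using P(1) minus_carrier_mat[OF P(1), of "1\<^sub>m n"]
    by (simp add: minus_mult_distrib_mat[of _ n n _ _ n] mult_minus_distrib_mat[of _ n n _ n])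
  also have "\<dots> = 1\<^sub>m n - P" using P by (intro eq_matI) auto
  finally show ?thesis using P by (simp add: is_proj_def transpose_minus[of _ n n])
qed

text \<open>The rank of a projection is carried along as \<open>mip P P\<close>, which for a
  symmetric idempotent is its trace.\<close>

lemma is_proj_orthonormal:
  assumes Q: "Q \<in> carrier_mat n r" and QQ: "Q\<^sup>T * Q = 1\<^sub>m r"
  shows "is_proj n (Q * Q\<^sup>T)" and "mip (Q * Q\<^sup>T) (Q * Q\<^sup>T) = real r" and "Q * Q\<^sup>T * Q = Q"
proof -
  show *: "Q * Q\<^sup>T * Q = Q" using Q QQ by (simp add: assoc_mult_mat[of _ n r _ n _ r])
  have "Q * Q\<^sup>T * (Q * Q\<^sup>T) = Q * Q\<^sup>T * Q * Q\<^sup>T"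
    using Q by (intro assoc_mult_mat[symmetric]) auto
  then have id: "Q * Q\<^sup>T * (Q * Q\<^sup>T) = Q * Q\<^sup>T" by (simp add: *)
  then show "is_proj n (Q * Q\<^sup>T)"
    using Q by (auto simp: is_proj_def transpose_mult[of _ n r _ n])
  have "mip (Q * Q\<^sup>T) (Q * Q\<^sup>T) = mip Q (Q * Q\<^sup>T * Q)"
    using Q mip_mult_right[of Q n r "Q\<^sup>T" n "Q * Q\<^sup>T"] by simp
  also have "\<dots> = mip (Q * 1\<^sub>m r) Q" using Q * by simp
  also have "\<dots> = mip (1\<^sub>m r) (1\<^sub>m r)"
    using Q QQ mip_mult_left[of Q n r "1\<^sub>m r" r Q] by simp
  also have "\<dots> = real r" using frob_norm_sq[of "1\<^sub>m r"] by (simp add: frob_norm_one)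
  finally show "mip (Q * Q\<^sup>T) (Q * Q\<^sup>T) = real r" .
qed

lemma is_proj_contract:
  assumes "is_proj n P" "v \<in> carrier_vec n"
  shows "(P *\<^sub>v v) \<bullet> (P *\<^sub>v v) \<le> v \<bullet> v"
proof -
  have P: "P \<in> carrier_mat n n" "P\<^sup>T = P" "P * P = P" using assms by (auto simp: is_proj_def)
  let ?w = "P *\<^sub>v v"
  have w: "?w \<in> carrier_vec n" using P assms by auto
  have "?w \<bullet> ?w = v \<bullet> (P *\<^sub>v ?w)" using mat_sym_scalar[OF P(1,2) assms(2) w] by simp
  also have "P *\<^sub>v ?w = ?w" using assoc_mult_mat_vec[OF P(1) P(1) assms(2)] P(3) by simp
  finally have ww: "v \<bullet> ?w = ?w \<bullet> ?w" by simp
  have "0 \<le> (v - ?w) \<bullet> (v - ?w)" using vnorm_sq_scalar[of "v - ?w"] by (metis zero_le_power2)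
  also have "\<dots> = v \<bullet> v - ?w \<bullet> ?w"
    using assms(2) w ww comm_scalar_prod[OF assms(2) w]
    by (simp add: scalar_prod_minus_distrib[of _ n] minus_scalar_prod_distrib[of _ n])
  finally show ?thesis by simp
qed

lemma frob_proj_le:
  assumes P: "is_proj n P" and A: "A \<in> carrier_mat n m"
  shows "frob_norm (P * A) \<le> frob_norm A"
proof -
  have Pc: "P \<in> carrier_mat n n" using P by (simp add: is_proj_def)
  have "(frob_norm (P * A))\<^sup>2 = (\<Sum>j<m. (vnorm (P *\<^sub>v col A j))\<^sup>2)"
    unfolding frob_norm_sq_cols[OF mult_carrier_mat[OF Pc A]]
    by (intro sum.cong refl) (simp only: col_mult_mat_vec[OF Pc A] lessThan_iff)
  also have "\<dots> \<le> (frob_norm A)\<^sup>2"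
    unfolding frob_norm_sq_cols[OF A] vnorm_sq_scalar
    using A by (intro sum_mono is_proj_contract[OF P]) auto
  finally show ?thesis by (rule power2_le_imp_le) simp
qed

text \<open>Ky Fan's trace inequality. \<open>P\<close> is split into a part \<open>Q * Z\<close> in
  the span of the leading eigenvectors and a remainder \<open>Y\<close>. The first part gives each
  \<open>lam j\<close> a weight \<open>z j \<le> 1\<close>; the remainder carries the missing mass
  \<open>r - (\<Sum>j<r. z j)\<close> at a level of at most \<open>lam (r - 1)\<close>. Filling
  every weight up to 1 can only increase the total.\<close>

lemma leading_eigvecs_ky_fan:
  assumes S: "S \<in> carrier_mat n n" "S\<^sup>T = S" and lead: "leading_eigvecs S r Q"
    and P: "is_proj n P" "mip P P = real r"
  shows "mip S P \<le> mip S (Q * Q\<^sup>T)"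
proof -
  have Pc: "P \<in> carrier_mat n n" and PT: "P\<^sup>T = P" and PP: "P * P = P"
    using P by (auto simp: is_proj_def)
  obtain lam where Q: "Q \<in> carrier_mat n r" and QQ: "Q\<^sup>T * Q = 1\<^sub>m r"
    and ev: "\<forall>j<r. eigenvector S (col Q j) (lam j)"
    and dec: "\<forall>i j. i \<le> j \<and> j < r \<longrightarrow> lam j \<le> lam i"
    and top: "\<forall>v mu. eigenvector S v mu \<and> (\<forall>j<r. col Q j \<bullet> v = 0) \<longrightarrow> (\<forall>j<r. mu \<le> lam j)"
    using lead S by (auto simp: leading_eigvecs_def)
  show ?thesis
  \<comment> \<open>Rank 0 is separate because the index \<open>r - 1\<close> of the smallest
    leading eigenvalue is used below.\<close>
  proof (cases "r = 0")
    case True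
    then have "frob_norm P = 0" using P(2) by (simp add: frob_norm_mip)
    then have "P = 0\<^sub>m n n" by (rule frob_norm_eq_0[OF Pc])
    moreover have "Q * Q\<^sup>T = 0\<^sub>m n n" using Q True by (intro eq_matI) (auto simp: scalar_prod_def)
    ultimately show ?thesis by simp
  next
    case False
    define L where "L = dmat r lam"
    define Z where "Z = Q\<^sup>T * P"
    define Y where "Y = P - Q * Z"
    have Qt: "Q\<^sup>T \<in> carrier_mat r n" using Q by simp
    have L: "L \<in> carrier_mat r r" by (simp add: L_def dmat_def)
    have Z: "Z \<in> carrier_mat r n" using Q Pc by (simp add: Z_def)
    have QZ: "Q * Z \<in> carrier_mat n n" using Q Z by simp
    have Y: "Y \<in> carrier_mat n n" using QZ by (simp add: Y_def minus_carrier_mat)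
    have LZ: "L * Z \<in> carrier_mat r n" using L Z by simp
    have QtQZ: "Q\<^sup>T * (Q * Z) = Z" using assoc_mult_mat[OF Qt Q Z] QQ Z by simp
    have QtY: "Q\<^sup>T * Y = 0\<^sub>m r n"
      unfolding Y_def using Z by (simp add: mult_minus_distrib_mat[OF Qt Pc QZ] QtQZ Z_def[symmetric])
    have SQ: "S * Q = Q * L"
    proof (rule eq_matI)
      fix i j assume "i < dim_row (Q * L)" "j < dim_col (Q * L)"
      then have ij: "i < n" "j < r" using Q L by auto
      have "(S * Q) $$ (i,j) = (S *\<^sub>v col Q j) $ i" using ij S Q by simp
      also have "\<dots> = lam j * Q $$ (i,j)" using ev ij Q by (simp add: eigenvector_def)
      also have "\<dots> = (\<Sum>k<r. if k = j then lam j * Q $$ (i,j) else 0)" using ij by simp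
      also have "\<dots> = (Q * L) $$ (i,j)"
        unfolding mult_mat_entry[OF Q L ij] using ij by (intro sum.cong) (auto simp: L_def dmat_def)
      finally show "(S * Q) $$ (i,j) = (Q * L) $$ (i,j)" .
    qed (use S Q L in auto)
    have SQZ: "S * (Q * Z) = Q * (L * Z)"
      using assoc_mult_mat[OF S(1) Q Z] assoc_mult_mat[OF Q L Z] SQ by simp
    have SY: "S * Y \<in> carrier_mat n n" and QLZ: "Q * (L * Z) \<in> carrier_mat n n" using S Y Q LZ by auto
    have Pdec: "P = Q * Z + Y" using Pc QZ unfolding Y_def by (intro eq_matI) auto
    have c1: "mip (Q * (L * Z)) Y = 0"
      using mip_mult_left[OF Q LZ Y] QtY mip_zero_right[OF LZ] by simp
    have c2: "mip (S * Y) (Q * Z) = 0"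
      using mip_mult_left[OF S(1) Y QZ] S(2) SQZ c1 mip_commute[OF Y QLZ] by simp
    have c3: "mip (Q * Z) Y = 0"
      using mip_mult_left[OF Q Z Y] QtY mip_zero_right[OF Z] by simp
    define z where "z = (\<lambda>j. \<Sum>i<n. Z $$ (j,i) * Z $$ (j,i))"
    have main: "mip (Q * (L * Z)) (Q * Z) = (\<Sum>j<r. lam j * z j)"
    proof -
      have "mip (Q * (L * Z)) (Q * Z) = mip (L * Z) Z" using mip_mult_left[OF Q LZ QZ] QtQZ by simp
      also have "\<dots> = (\<Sum>j<r. \<Sum>i<n. lam j * Z $$ (j,i) * Z $$ (j,i))"
      proof -
        have "(L * Z) $$ (j,i) = lam j * Z $$ (j,i)" if "j < r" "i < n" for i j
        proof -
          have "(L * Z) $$ (j,i) = (\<Sum>k<r. if k = j then lam j * Z $$ (j,i) else 0)"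
            unfolding mult_mat_entry[OF L Z that] using that by (intro sum.cong) (auto simp: L_def dmat_def)
          then show ?thesis using that by simp
        qed
        then show ?thesis unfolding mip_carrier[OF LZ] by (intro sum.cong refl) simp
      qed
      finally show ?thesis by (simp add: z_def sum_distrib_left mult.assoc)
    qed
    have "mip S P = mip (S * P) P"
      using mip_mult_right[OF S(1) Pc Pc] PT PP by simp
    also have "S * P = Q * (L * Z) + S * Y"
      unfolding SQZ[symmetric] by (subst Pdec) (rule mult_add_distrib_mat[OF S(1) QZ Y])
    also have "mip (Q * (L * Z) + S * Y) P = (\<Sum>j<r. lam j * z j) + mip (S * Y) Y"
      by (subst Pdec)
        (simp add: mip_add_left[OF QLZ SY] mip_add_right[OF QZ Y QLZ] mip_add_right[OF QZ Y SY] c1 c2 main)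
    finally have e1: "mip S P = (\<Sum>j<r. lam j * z j) + mip (S * Y) Y" .
    have zs: "(\<Sum>j<r. z j) = mip (Q * Z) (Q * Z)"
      using mip_mult_left[OF Q Z QZ] QtQZ mip_carrier[OF Z, of Z] by (simp add: z_def)
    have "mip P P = mip (Q * Z + Y) (Q * Z + Y)" using Pdec by simp
    also have "\<dots> = (\<Sum>j<r. z j) + mip Y Y"
      using c3 mip_commute[OF Y QZ]
      by (simp add: mip_add_left[OF QZ Y] mip_add_right[OF QZ Y QZ] mip_add_right[OF QZ Y Y] zs)
    finally have e2: "mip Y Y = real r - (\<Sum>j<r. z j)" using P(2) by simp
    have "col Q j \<bullet> col Y i = 0" if "j < r" "i < n" for i j
    proof -
      have "(Q\<^sup>T * Y) $$ (j,i) = 0" using QtY that by simp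
      then show ?thesis using that Q Y by simp
    qed
    \<comment> \<open>The columns of \<open>Y\<close> are orthogonal to all of \<open>Q\<close>, so
      the smallest leading eigenvalue bounds each of their quadratic forms.\<close>
    then have "mip (S * Y) Y \<le> (\<Sum>i<n. lam (r - 1) * (col Y i \<bullet> col Y i))"
      unfolding mip_vec[OF S(1) Y] using False Y
      by (intro sum_mono leading_quad_le[OF S Q ev top]) auto
    also have "\<dots> = lam (r - 1) * mip Y Y"
      using frob_norm_sq_cols[OF Y] by (simp add: sum_distrib_left frob_norm_sq vnorm_sq_scalar)
    finally have e3: "mip (S * Y) Y \<le> (\<Sum>j<r. lam (r - 1) * (1 - z j))"
      by (simp add: e2 sum_subtractf flip: sum_distrib_left)
    \<comment> \<open>\<open>z j\<close> is the squared length of the projected unit vector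
      \<open>P *\<^sub>v col Q j\<close>.\<close>
    have z1: "z j \<le> 1" if "j < r" for j
    proof -
      have q: "col Q j \<in> carrier_vec n" using Q by auto
      have "z j = (P *\<^sub>v col Q j) \<bullet> (P *\<^sub>v col Q j)"
      proof -
        have "Z $$ (j,i) = (P *\<^sub>v col Q j) $ i" if "i < n" for i
        proof -
          have "Z $$ (j,i) = (P * Q) $$ (i,j)"
            using that \<open>j < r\<close> Q Pc PT unfolding Z_def
            by (metis Z Z_def carrier_matD index_transpose_mat(1) transpose_mult[OF Qt Pc] transpose_transpose)
          then show ?thesis using that \<open>j < r\<close> Q Pc by simp
        qed
        then show ?thesis using Pc by (auto simp: z_def scalar_prod_def atLeast0LessThan)
      qed
      also have "\<dots> \<le> col Q j \<bullet> col Q j" by (rule is_proj_contract[OF P(1) q])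
      also have "\<dots> = (Q\<^sup>T * Q) $$ (j,j)" using Q that by simp
      also have "\<dots> = 1" using QQ that by simp
      finally show ?thesis .
    qed
    have "mip S P \<le> (\<Sum>j<r. lam j * z j + lam (r - 1) * (1 - z j))"
      using e1 e3 by (simp add: sum.distrib)
    also have "\<dots> \<le> (\<Sum>j<r. lam j)"
    proof (rule sum_mono)
      fix j assume "j \<in> {..<r}"
      then have "lam (r - 1) * (1 - z j) \<le> lam j * (1 - z j)"
        using z1[of j] dec by (intro mult_right_mono) auto
      then show "lam j * z j + lam (r - 1) * (1 - z j) \<le> lam j" by (simp add: algebra_simps)
    qed
    also have "\<dots> = mip S (Q * Q\<^sup>T)"
    proof -
      have "mip S (Q * Q\<^sup>T) = mip (S * Q) Q" using mip_mult_right[OF S(1) Q Q] by simp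
      also have "\<dots> = mip L (1\<^sub>m r)" using mip_mult_left[OF Q L Q] SQ QQ by simp
      also have "\<dots> = (\<Sum>j<r. \<Sum>i<r. if i = j then lam j else 0)"
        unfolding mip_carrier[OF L] by (intro sum.cong refl) (auto simp: L_def dmat_def)
      finally show ?thesis by simp
    qed
    finally show ?thesis .
  qed
qed

text \<open>For projections of equal trace the right-hand side is symmetric in \<open>P\<close> and
  \<open>R\<close>, so both one-sided errors agree and are governed by the overlap
  \<open>mip P R\<close>.\<close>

lemma proj_dist_sq:
  assumes P: "is_proj n P" and R: "is_proj n R"
  shows "(frob_norm ((1\<^sub>m n - R) * P))\<^sup>2 = mip P P - mip P R"
proof -
  have Pc: "P \<in> carrier_mat n n" "P\<^sup>T = P" "P * P = P" using P by (auto simp: is_proj_def)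
  have Rc: "R \<in> carrier_mat n n" using R by (auto simp: is_proj_def)
  let ?R = "1\<^sub>m n - R"
  have R': "?R \<in> carrier_mat n n" "?R\<^sup>T = ?R" "?R * ?R = ?R" using is_proj_compl[OF R] by (auto simp: is_proj_def)
  have "mip (?R * P) (?R * P) = mip P (?R * P)"
    using mip_mult_left[OF R'(1) Pc(1) mult_carrier_mat[OF R'(1) Pc(1)]]
    by (simp only: R'(2,3) assoc_mult_mat[OF R'(1) R'(1) Pc(1), symmetric])
  also have "\<dots> = mip (?R * P) P" using R'(1) Pc(1) by (intro mip_commute[of _ n n]) auto
  also have "\<dots> = mip ?R P" using mip_mult_right[OF R'(1) Pc(1) Pc(1)] Pc by simp
  also have "\<dots> = mip P ?R" using R'(1) Pc(1) by (intro mip_commute)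
  also have "\<dots> = mip P (1\<^sub>m n) - mip P R" using Pc(1) Rc by (simp add: mip_minus_right[of _ n n])
  also have "mip P (1\<^sub>m n) = mip P P" using mip_mult_right[OF Pc(1) Pc(1), of "1\<^sub>m n"] mip_mult_left[OF Pc(1) Pc(1), of "1\<^sub>m n"] Pc
    by simp
  finally show ?thesis by (simp add: frob_norm_sq)
qed

text \<open>The gap turns the squared distance into a loss of \<open>mip S\<close>; the extremal
  property of \<open>R\<close> for \<open>S'\<close> limits this loss by
  \<open>mip (S' - S) (R - P)\<close>, which is linear in the distance. The perturbation is measured
  after multiplication by \<open>P\<close> or \<open>R\<close>, where a spectral bound on it costs
  only the root of the rank.\<close>

lemma proj_gap:
  assumes P: "is_proj n P" "mip P P = r" and R: "is_proj n R" "mip R R = r"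
    and S: "S \<in> carrier_mat n n" "S\<^sup>T = S" and S': "S' \<in> carrier_mat n n" "S'\<^sup>T = S'"
    and ky_fan: "mip S' P \<le> mip S' R"
    and gap: "g * (frob_norm ((1\<^sub>m n - R) * P))\<^sup>2 \<le> mip S (P - R)"
    and b: "frob_norm ((S' - S) * P) \<le> b" "frob_norm ((S' - S) * R) \<le> b"
  shows "frob_norm ((1\<^sub>m n - P) * R) = frob_norm ((1\<^sub>m n - R) * P)"
    and "g * frob_norm ((1\<^sub>m n - R) * P) \<le> 2 * b"
proof -
  have Pc: "P \<in> carrier_mat n n" "P\<^sup>T = P" "P * P = P" using P by (auto simp: is_proj_def)
  have Rc: "R \<in> carrier_mat n n" "R\<^sup>T = R" "R * R = R" using R by (auto simp: is_proj_def)
  have "(frob_norm ((1\<^sub>m n - P) * R))\<^sup>2 = (frob_norm ((1\<^sub>m n - R) * P))\<^sup>2"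
    using proj_dist_sq[OF P(1) R(1)] proj_dist_sq[OF R(1) P(1)] mip_commute[OF Pc(1) Rc(1)] P R by simp
  then show x: "frob_norm ((1\<^sub>m n - P) * R) = frob_norm ((1\<^sub>m n - R) * P)" by simp
  let ?x = "frob_norm ((1\<^sub>m n - R) * P)"
  define D where "D = S' - S"
  have D: "D \<in> carrier_mat n n" "D\<^sup>T = D" using S S' by (auto simp: D_def transpose_minus[of _ n n] minus_carrier_mat)
  have split: "mip D ((1\<^sub>m n - U) * V) = mip D V - mip D (U * V)" if "U \<in> carrier_mat n n" "V \<in> carrier_mat n n" for U V
    using that D by (simp add: minus_mult_distrib_mat[of _ n n] mip_minus_right[of _ n n])
  have half: "\<bar>mip D ((1\<^sub>m n - U) * V)\<bar> \<le> frob_norm (D * V) * frob_norm ((1\<^sub>m n - U) * V)"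
    if "U \<in> carrier_mat n n" "V \<in> carrier_mat n n" "V\<^sup>T = V" "V * V = V" for U V
  proof -
    have c: "(1\<^sub>m n - U) * V \<in> carrier_mat n n" "1\<^sub>m n - U \<in> carrier_mat n n" using that by (auto simp: minus_carrier_mat)
    have "mip (D * V) ((1\<^sub>m n - U) * V) = mip D ((1\<^sub>m n - U) * V)"
      using mip_mult_right[OF D(1) that(2) c(1)] that c(2) by (simp add: assoc_mult_mat[of _ n n _ n _ n])
    then show ?thesis using mip_le_frob[of "D * V" n n "(1\<^sub>m n - U) * V"] D that c by simp
  qed
  \<comment> \<open>By symmetry of \<open>D\<close> both products have the same trace form, so
    \<open>R - P\<close> can be traded for two one-sided differences of norm \<open>?x\<close>
    each.\<close>
  have comm: "mip D (P * R) = mip D (R * P)"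
    using mip_transpose[of D n n "P * R"] D Pc Rc by (simp add: transpose_mult[of _ n n _ n])
  have "g * ?x\<^sup>2 \<le> mip S P - mip S R" using gap S Pc Rc by (simp add: mip_minus_right[of _ n n])
  also have "\<dots> \<le> mip D R - mip D P"
    using ky_fan S S' by (simp add: D_def mip_minus_left[of _ n n])
  also have "\<dots> = mip D ((1\<^sub>m n - P) * R) - mip D ((1\<^sub>m n - R) * P)"
    using split[OF Pc(1) Rc(1)] split[OF Rc(1) Pc(1)] comm by simp
  also have "\<dots> \<le> frob_norm (D * R) * ?x + frob_norm (D * P) * ?x"
    using half[OF Pc(1) Rc] half[OF Rc(1) Pc] unfolding x by linarith
  also have "\<dots> \<le> b * ?x + b * ?x"
    using b by (intro add_mono mult_right_mono) (auto simp: D_def)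
  finally have le: "g * ?x * ?x \<le> 2 * b * ?x" by (simp add: power2_eq_square)
  show "g * ?x \<le> 2 * b"
  \<comment> \<open>The quadratic inequality is divided by \<open>?x\<close>; if that is 0, only
    \<open>0 \<le> b\<close> remains to be seen.\<close>
  proof (cases "?x = 0")
    case True
    then show ?thesis using order_trans[OF frob_norm_nonneg b(1)] by simp
  next
    case False
    then have "0 < ?x" using frob_norm_nonneg[of "(1\<^sub>m n - R) * P"] by linarith
    then show ?thesis using le mult_le_cancel_right by blast
  qed
qed

section \<open>Loadings with nearly orthogonal columns\<close>

lemma dmat_carrier [simp]: "dmat r a \<in> carrier_mat r r"
  by (simp add: dmat_def)

lemma dmat_transpose [simp]: "(dmat r a)\<^sup>T = dmat r a"
  by (rule eq_matI) (auto simp: dmat_def)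

lemma mult_dmat_index:
  assumes "A \<in> carrier_mat n r" "i < n" "j < r"
  shows "(A * dmat r a) $$ (i,j) = A $$ (i,j) * a j"
proof -
  have "(A * dmat r a) $$ (i,j) = (\<Sum>k<r. if k = j then A $$ (i,j) * a j else 0)"
    unfolding mult_mat_entry[OF assms(1) dmat_carrier assms(2,3)]
    using assms by (intro sum.cong) (auto simp: dmat_def)
  then show ?thesis using assms by simp
qed

lemma dmat_mult: "dmat r a * dmat r b = dmat r (\<lambda>i. a i * b i)"
proof (rule eq_matI)
  fix i j assume "i < dim_row (dmat r (\<lambda>i. a i * b i))" "j < dim_col (dmat r (\<lambda>i. a i * b i))"
  then have "i < r" "j < r" by (auto simp: dmat_def)
  then show "(dmat r a * dmat r b) $$ (i,j) = dmat r (\<lambda>i. a i * b i) $$ (i,j)"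
    using mult_dmat_index[of "dmat r a" r r i j b] by (simp add: dmat_def)
qed (auto simp: dmat_def)

lemma dmat_one: "(\<And>i. i < r \<Longrightarrow> a i = 1) \<Longrightarrow> dmat r a = 1\<^sub>m r"
  by (rule eq_matI) (auto simp: dmat_def)

lemma frob_mult_dmat_le:
  assumes A: "A \<in> carrier_mat n r" and c: "0 \<le> c" "\<And>j. j < r \<Longrightarrow> \<bar>a j\<bar> \<le> c"
  shows "frob_norm (A * dmat r a) \<le> c * frob_norm A"
proof -
  have Ad: "A * dmat r a \<in> carrier_mat n r" using A by simp
  have "(frob_norm (A * dmat r a))\<^sup>2 = (\<Sum>i<n. \<Sum>j<r. (A $$ (i,j) * a j)\<^sup>2)"
    unfolding frob_norm_sq mip_carrier[OF Ad]
    by (intro sum.cong refl) (simp add: mult_dmat_index[OF A] power2_eq_square del: index_mult_mat)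
  also have "\<dots> \<le> (\<Sum>i<n. \<Sum>j<r. c\<^sup>2 * (A $$ (i,j))\<^sup>2)"
  proof (intro sum_mono)
    fix i j assume "j \<in> {..<r}"
    then have "(a j)\<^sup>2 \<le> c\<^sup>2" using c power_mono[of "\<bar>a j\<bar>" c 2] by simp
    then show "(A $$ (i,j) * a j)\<^sup>2 \<le> c\<^sup>2 * (A $$ (i,j))\<^sup>2"
      using mult_right_mono[of "(a j)\<^sup>2" "c\<^sup>2" "(A $$ (i,j))\<^sup>2"] by (simp add: power_mult_distrib mult.commute)
  qed
  also have "\<dots> = (c * frob_norm A)\<^sup>2"
    unfolding power_mult_distrib frob_norm_sq mip_carrier[OF A]
    by (simp add: sum_distrib_left power2_eq_square)
  finally show ?thesis by (rule power2_le_imp_le) (simp add: c)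
qed

section \<open>Inverses of square matrices\<close>

lemma inv_mat_eqI:
  assumes A: "A \<in> carrier_mat n n" and B: "B \<in> carrier_mat n n" "A * B = 1\<^sub>m n"
  shows "inv_mat A = B"
proof -
  have BA: "B * A = 1\<^sub>m n" using mat_mult_left_right_inverse[OF A B] .
  have "inv_mat A \<in> carrier_mat n n \<and> A * inv_mat A = 1\<^sub>m n \<and> inv_mat A * A = 1\<^sub>m n"
    unfolding inv_mat_def using someI_ex[of "\<lambda>B. B \<in> carrier_mat n n \<and> A * B = 1\<^sub>m n \<and> B * A = 1\<^sub>m n"] A B BA
    by auto
  then have i: "inv_mat A \<in> carrier_mat n n" "inv_mat A * A = 1\<^sub>m n" by auto
  have "inv_mat A = inv_mat A * (A * B)" using i B by simp
  also have "\<dots> = inv_mat A * A * B" using assoc_mult_mat[OF i(1) A B(1)] by simp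
  finally show ?thesis using i B by simp
qed

text \<open>A kernel vector would be sent by \<open>G - 1\<^sub>m r\<close> to its negative,
  contradicting contraction by 1/2. The norm bound comes from
  \<open>B = 1\<^sub>m r - (G - 1\<^sub>m r) * B\<close> by absorbing half of
  \<open>frob_norm B\<close>.\<close>

lemma near_one_inverse:
  assumes G: "G \<in> carrier_mat r r" and near: "frob_norm (G - 1\<^sub>m r) \<le> 1/2"
  obtains B where "B \<in> carrier_mat r r" "G * B = 1\<^sub>m r" "B * G = 1\<^sub>m r" "frob_norm B \<le> 2 * sqrt (real r)"
proof -
  have "det G \<noteq> 0"
  proof
    assume "det G = 0"
    then obtain v where v: "v \<in> carrier_vec r" "v \<noteq> 0\<^sub>v r" "G *\<^sub>v v = 0\<^sub>v r"
      using det_0_iff_vec_prod_zero_field[OF G] by blast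
    have "(G - 1\<^sub>m r) *\<^sub>v v = (- 1) \<cdot>\<^sub>v v"
      using minus_mult_distrib_mat_vec[OF G one_carrier_mat v(1)] v by auto
    then have "vnorm v = vnorm ((G - 1\<^sub>m r) *\<^sub>v v)" by (simp add: vnorm_smult)
    also have "\<dots> \<le> 1/2 * vnorm v"
      using vnorm_mult_le_frob[of "G - 1\<^sub>m r" r r v] v G mult_right_mono[OF near vnorm_nonneg[of v]] by auto
    finally have "vnorm v = 0" using vnorm_nonneg[of v] by linarith
    then show False using vnorm_eq_0[OF v(1)] v(2) by simp
  qed
  then have "G \<in> Units (ring_mat TYPE(real) r ())" by (rule det_non_zero_imp_unit[OF G])
  then obtain B where B: "B \<in> carrier_mat r r" "G * B = 1\<^sub>m r" "B * G = 1\<^sub>m r"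
    by (auto simp: Units_def ring_mat_def)
  have "B = 1\<^sub>m r - (G - 1\<^sub>m r) * B"
    using minus_mult_distrib_mat[OF G one_carrier_mat B(1)] B by (intro eq_matI) auto
  then have "frob_norm B \<le> frob_norm (1\<^sub>m r) + frob_norm ((G - 1\<^sub>m r) * B)"
    using frob_norm_minus_le[of "1\<^sub>m r" r r "(G - 1\<^sub>m r) * B"] G B by fastforce
  also have "frob_norm ((G - 1\<^sub>m r) * B) \<le> 1/2 * frob_norm B"
    using frob_norm_mult_le[of "G - 1\<^sub>m r" r r B r] G B mult_right_mono[OF near frob_norm_nonneg[of B]] by auto
  finally have "frob_norm B \<le> 2 * sqrt (real r)" by (simp add: frob_norm_one)
  then show ?thesis using that B by blast
qed

text \<open>The matrix \<open>L D^(-1/2)\<close> of (A2): each column is divided by the root of its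
  factor's strength, so that under (A2) strong and weak columns alike have length close to
  1.\<close>

definition scaled :: "nat \<Rightarrow> real Matrix.mat \<Rightarrow> (nat \<Rightarrow> real) \<Rightarrow> real Matrix.mat" where
  "scaled r L d = L * dmat r (\<lambda>i. 1 / sqrt (d i))"

text \<open>The absolute distance 1/2 replaces the limit in (A2): \<open>near_one_inverse\<close>
  accepts it and it holds eventually, so the bounds below become deterministic statements about one
  fixed panel.\<close>

definition near_on :: "nat \<Rightarrow> nat \<Rightarrow> real Matrix.mat \<Rightarrow> (nat \<Rightarrow> real) \<Rightarrow> bool" where
  "near_on n r L d \<longleftrightarrow> L \<in> carrier_mat n r \<and> (\<forall>i<r. 0 < d i) \<and>
     frob_norm ((scaled r L d)\<^sup>T * scaled r L d - 1\<^sub>m r) \<le> 1/2"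

lemma scaled_carrier [simp]: "L \<in> carrier_mat n r \<Longrightarrow> scaled r L d \<in> carrier_mat n r"
  by (simp add: scaled_def)

lemma scaled_unscale:
  assumes "L \<in> carrier_mat n r" "\<forall>i<r. 0 < d i"
  shows "scaled r L d * dmat r (\<lambda>i. sqrt (d i)) = L"
proof -
  have "scaled r L d * dmat r (\<lambda>i. sqrt (d i)) = L * (dmat r (\<lambda>i. 1 / sqrt (d i)) * dmat r (\<lambda>i. sqrt (d i)))"
    unfolding scaled_def by (rule assoc_mult_mat[OF assms(1) dmat_carrier dmat_carrier])
  also have "dmat r (\<lambda>i. 1 / sqrt (d i)) * dmat r (\<lambda>i. sqrt (d i)) = 1\<^sub>m r"
    unfolding dmat_mult by (rule dmat_one) (use assms(2) in \<open>auto dest!: spec\<close>)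
  finally show ?thesis using assms(1) by simp
qed

lemma scaled_gram:
  assumes L: "L \<in> carrier_mat n r"
  shows "(scaled r L d)\<^sup>T * scaled r L d
    = dmat r (\<lambda>i. 1 / sqrt (d i)) * (L\<^sup>T * L) * dmat r (\<lambda>i. 1 / sqrt (d i))"
proof -
  let ?D = "dmat r (\<lambda>i. 1 / sqrt (d i))"
  have LT: "L\<^sup>T \<in> carrier_mat r n" using L by simp
  have "(scaled r L d)\<^sup>T * scaled r L d = (?D * L\<^sup>T) * (L * ?D)"
    unfolding scaled_def by (simp add: transpose_mult[OF L dmat_carrier])
  also have "\<dots> = ?D * (L\<^sup>T * (L * ?D))"
    by (rule assoc_mult_mat[OF dmat_carrier LT]) (use L in auto)
  also have "L\<^sup>T * (L * ?D) = (L\<^sup>T * L) * ?D"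
    by (rule assoc_mult_mat[OF LT L dmat_carrier, symmetric])
  also have "?D * ((L\<^sup>T * L) * ?D) = ?D * (L\<^sup>T * L) * ?D"
    by (rule assoc_mult_mat[symmetric, OF dmat_carrier _ dmat_carrier]) (use L in auto)
  finally show ?thesis .
qed

text \<open>The squared norm is the trace of the Gram matrix, that is \<open>r\<close> plus the
  trace of the defect, and the latter is at most \<open>sqrt (real r) / 2\<close>.\<close>

lemma near_on_scaled_bound:
  assumes "near_on n r L d"
  shows "frob_norm (scaled r L d) \<le> sqrt (2 * real r)"
proof -
  let ?V = "scaled r L d" and ?I = "1\<^sub>m r"
  have V: "?V \<in> carrier_mat n r" and near: "frob_norm (?V\<^sup>T * ?V - ?I) \<le> 1/2"
    using assms by (auto simp: near_on_def)
  have G: "?V\<^sup>T * ?V \<in> carrier_mat r r" using V by simp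
  have "mip ?V ?V = mip (?V * ?I) ?V" using V by simp
  also have "\<dots> = mip ?I (?V\<^sup>T * ?V)" by (rule mip_mult_left[OF V one_carrier_mat V])
  also have "\<dots> = mip ?I ?I + mip ?I (?V\<^sup>T * ?V - ?I)"
    by (simp add: mip_minus_right[OF G one_carrier_mat one_carrier_mat])
  also have "\<dots> \<le> real r + sqrt (real r) * (1/2)"
  proof -
    have "mip ?I (?V\<^sup>T * ?V - ?I) \<le> frob_norm ?I * frob_norm (?V\<^sup>T * ?V - ?I)"
      using mip_le_frob[of ?I r r "?V\<^sup>T * ?V - ?I"] by simp
    also have "\<dots> \<le> sqrt (real r) * (1/2)" using mult_left_mono[OF near, of "sqrt (real r)"] by (simp only: frob_norm_one) simp
    finally show ?thesis using frob_norm_sq[of ?I] by (simp add: frob_norm_one)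
  qed
  also have "\<dots> \<le> 2 * real r"
  proof -
    have "sqrt (real r) \<le> real r"
      by (cases "r = 0") (auto intro!: real_le_lsqrt simp: power2_eq_square)
    then show ?thesis by simp
  qed
  finally show ?thesis by (simp add: frob_norm_mip)
qed

text \<open>Rescaling columns does not change their span. The diverging scales
  \<open>sqrt (d i)\<close> cancel from the projection and leave the inverse \<open>B\<close> of a
  Gram matrix close to the identity.\<close>

lemma near_on_proj:
  assumes "near_on n r L d"
  obtains B where "B \<in> carrier_mat r r" "frob_norm B \<le> 2 * sqrt (real r)"
    "B * ((scaled r L d)\<^sup>T * scaled r L d) = 1\<^sub>m r" "(scaled r L d)\<^sup>T * scaled r L d * B = 1\<^sub>m r"
    "B\<^sup>T = B" "proj L = scaled r L d * B * (scaled r L d)\<^sup>T"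
proof -
  define V where "V = scaled r L d"
  define D where "D = dmat r (\<lambda>i. sqrt (d i))"
  define D' where "D' = dmat r (\<lambda>i. 1 / sqrt (d i))"
  have L: "L \<in> carrier_mat n r" and dp: "\<forall>i<r. 0 < d i" and near: "frob_norm (V\<^sup>T * V - 1\<^sub>m r) \<le> 1/2"
    using assms by (auto simp: near_on_def V_def)
  have V: "V \<in> carrier_mat n r" and VT: "V\<^sup>T \<in> carrier_mat r n" using L by (auto simp: V_def)
  have D: "D \<in> carrier_mat r r" "D' \<in> carrier_mat r r" "D\<^sup>T = D" "D'\<^sup>T = D'" by (auto simp: D_def D'_def)
  have DD: "D' * D = 1\<^sub>m r" "D * D' = 1\<^sub>m r"
    unfolding D_def D'_def dmat_mult using dp by (auto intro!: dmat_one)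
  have VD: "L = V * D" using scaled_unscale[OF L dp] by (simp add: V_def D_def)
  define G where "G = V\<^sup>T * V"
  have G: "G \<in> carrier_mat r r" using V by (simp add: G_def)
  have GT: "G\<^sup>T = G" using transpose_mult[OF VT V] by (simp add: G_def)
  obtain B where B: "B \<in> carrier_mat r r" "G * B = 1\<^sub>m r" "B * G = 1\<^sub>m r" "frob_norm B \<le> 2 * sqrt (real r)"
    using near_one_inverse[OF G] near unfolding G_def by blast
  have BT: "B\<^sup>T = B"
  proof -
    have BTc: "B\<^sup>T \<in> carrier_mat r r" using B by simp
    have "B\<^sup>T * G = 1\<^sub>m r" using transpose_mult[OF G B(1)] B(2) GT by simp
    then have "B\<^sup>T * G * B = B" using B by simp
    then show ?thesis using assoc_mult_mat[OF BTc G B(1)] B BTc by simp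
  qed
  have "L\<^sup>T * L = D * V\<^sup>T * (V * D)" using VD transpose_mult[OF V D(1)] D(3) by simp
  also have "\<dots> = D * (V\<^sup>T * (V * D))" by (rule assoc_mult_mat[OF D(1) VT]) (use V D in auto)
  also have "V\<^sup>T * (V * D) = G * D" unfolding G_def by (rule assoc_mult_mat[OF VT V D(1), symmetric])
  finally have LL: "L\<^sup>T * L = D * (G * D)" .
  \<comment> \<open>From \<open>L = V * D\<close> the inverse of
    \<open>L\<^sup>T * L = D * (G * D)\<close> can be read off.\<close>
  define J where "J = D' * (B * D')"
  have J: "J \<in> carrier_mat r r" using D B by (simp add: J_def)
  have BD: "B * D' \<in> carrier_mat r r" and GD: "G * D \<in> carrier_mat r r" using B D G by auto
  have DJ: "D * J = B * D'"
    unfolding J_def by (simp only: assoc_mult_mat[OF D(1,2) BD, symmetric] DD left_mult_one_mat[OF BD])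
  have "L\<^sup>T * L * J = D * (G * D * J)" unfolding LL by (rule assoc_mult_mat[OF D(1) GD J])
  also have "G * D * J = G * (B * D')" using assoc_mult_mat[OF G D(1) J] DJ by simp
  also have "\<dots> = D'" using assoc_mult_mat[OF G B(1) D(2)] B D by simp
  finally have "L\<^sup>T * L * J = 1\<^sub>m r" using DD by simp
  then have "inv_mat (L\<^sup>T * L) = J" using L J by (intro inv_mat_eqI) auto
  then have "proj L = L * J * L\<^sup>T" by (simp add: proj_def)
  also have "L * J = V * (D * J)" unfolding VD by (rule assoc_mult_mat[OF V D(1) J])
  also have "V * (D * J) * L\<^sup>T = V * (B * D') * (D * V\<^sup>T)" using VD transpose_mult[OF V D(1)] D(3) DJ by simp
  also have "\<dots> = V * ((B * D') * (D * V\<^sup>T))" by (rule assoc_mult_mat[OF V BD]) (use V D in auto)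
  also have "(B * D') * (D * V\<^sup>T) = B * (D' * (D * V\<^sup>T))" by (rule assoc_mult_mat[OF B(1) D(2)]) (use V D in auto)
  also have "D' * (D * V\<^sup>T) = V\<^sup>T" using assoc_mult_mat[OF D(2,1) VT] DD VT by simp
  also have "V * (B * V\<^sup>T) = V * B * V\<^sup>T" by (rule assoc_mult_mat[OF V B(1) VT, symmetric])
  finally show ?thesis using that[OF B(1,4) _ _ BT] B(2,3) by (simp add: V_def G_def)
qed

text \<open>The last clause trades the projection for the scaled loadings: in
  \<open>V * (B * V\<^sup>T)\<close> with \<open>V = scaled r L d\<close> the bounds
  \<open>2 * sqrt r\<close> for \<open>B\<close> and \<open>sqrt (2 * r)\<close> for
  \<open>V\<close> multiply to \<open>2 * sqrt 2 * r\<close>, rounded up to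
  \<open>3 * r\<close>.\<close>

lemma near_on_is_proj:
  assumes "near_on n r L d"
  shows "is_proj n (proj L)" and "mip (proj L) (proj L) = real r" and "proj L * scaled r L d = scaled r L d"
    and "proj L * L = L"
    and "\<And>Z m. Z \<in> carrier_mat m n \<Longrightarrow> frob_norm (Z * proj L) \<le> 3 * real r * frob_norm (Z * scaled r L d)"
proof -
  obtain B where B: "B \<in> carrier_mat r r" "frob_norm B \<le> 2 * sqrt (real r)"
    "B * ((scaled r L d)\<^sup>T * scaled r L d) = 1\<^sub>m r" "(scaled r L d)\<^sup>T * scaled r L d * B = 1\<^sub>m r"
    "B\<^sup>T = B" "proj L = scaled r L d * B * (scaled r L d)\<^sup>T"
    using near_on_proj[OF assms] .
  define V where "V = scaled r L d"
  have L: "L \<in> carrier_mat n r" and dp: "\<forall>i<r. 0 < d i" using assms by (auto simp: near_on_def)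
  have V: "V \<in> carrier_mat n r" and VT: "V\<^sup>T \<in> carrier_mat r n" using L by (auto simp: V_def)
  note B = B[folded V_def]
  have VB: "V * B \<in> carrier_mat n r" and BV: "B * V\<^sup>T \<in> carrier_mat r n" using V B by auto
  have P: "proj L \<in> carrier_mat n n" using VB VT B(6) by simp
  have P2: "proj L = V * (B * V\<^sup>T)" using assoc_mult_mat[OF V B(1) VT] B(6) by simp
  have PV: "proj L * V = V"
  proof -
    have "proj L * V = V * B * (V\<^sup>T * V)" unfolding B(6) by (rule assoc_mult_mat[OF VB VT V])
    also have "\<dots> = V * (B * (V\<^sup>T * V))" by (rule assoc_mult_mat[OF V B(1)]) (use V in auto)
    finally show ?thesis using B(3) V by simp
  qed
  then show "proj L * scaled r L d = scaled r L d" by (simp add: V_def)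
  have "proj L * proj L = proj L * V * (B * V\<^sup>T)"
    by (subst (2) P2) (rule assoc_mult_mat[OF P V BV, symmetric])
  then have PP: "proj L * proj L = proj L" using PV P2 by simp
  have PT: "(proj L)\<^sup>T = proj L"
  proof -
    have "(proj L)\<^sup>T = V * (V * B)\<^sup>T" unfolding B(6) by (subst transpose_mult[OF VB VT]) simp
    also have "(V * B)\<^sup>T = B * V\<^sup>T" using transpose_mult[OF V B(1)] B(5) by simp
    finally show ?thesis using P2 by simp
  qed
  show "is_proj n (proj L)" using P PP PT by (simp add: is_proj_def)
  have "proj L * L = proj L * (V * dmat r (\<lambda>i. sqrt (d i)))"
    using scaled_unscale[OF L dp] by (simp add: V_def)
  also have "\<dots> = proj L * V * dmat r (\<lambda>i. sqrt (d i))" by (rule assoc_mult_mat[OF P V dmat_carrier, symmetric])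
  finally show "proj L * L = L" using PV scaled_unscale[OF L dp] by (simp add: V_def)
  have "mip (proj L) (proj L) = mip (proj L * V) (V * B)"
  proof -
    have "mip (proj L) (proj L) = mip (V * B) (proj L * V)"
      using mip_mult_right[OF VB VT P] B(6) by simp
    also have "\<dots> = mip (proj L * V) (V * B)" by (rule mip_commute[OF VB]) (use P V in auto)
    finally show ?thesis .
  qed
  also have "\<dots> = mip (V * B) V" using PV mip_commute[OF VB V] by simp
  also have "\<dots> = mip B (V\<^sup>T * V)" by (rule mip_mult_left[OF V B(1) V])
  also have "\<dots> = mip (1\<^sub>m r) (1\<^sub>m r)"
    using mip_mult_right[OF B(1), of "V\<^sup>T * V" r "1\<^sub>m r"] B V transpose_mult[OF VT V] by simp
  also have "\<dots> = real r" using frob_norm_sq[of "1\<^sub>m r"] by (simp add: frob_norm_one)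
  finally show "mip (proj L) (proj L) = real r" .
  fix Z :: "real Matrix.mat" and m assume Z: "Z \<in> carrier_mat m n"
  have ZV: "Z * V \<in> carrier_mat m r" using Z V by simp
  have "Z * proj L = Z * V * (B * V\<^sup>T)" unfolding P2 by (rule assoc_mult_mat[OF Z V BV, symmetric])
  then have "frob_norm (Z * proj L) \<le> frob_norm (Z * V) * frob_norm (B * V\<^sup>T)"
    using frob_norm_mult_le[OF ZV BV] by simp
  also have "\<dots> \<le> frob_norm (Z * V) * (3 * real r)"
  proof (rule mult_left_mono)
    have "frob_norm (B * V\<^sup>T) \<le> frob_norm B * frob_norm V" using frob_norm_mult_le[OF B(1) VT] by simp
    also have "\<dots> \<le> (2 * sqrt (real r)) * sqrt (2 * real r)"
      using B(2) near_on_scaled_bound[OF assms] by (intro mult_mono) (auto simp: V_def)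
    also have "\<dots> = 2 * sqrt 2 * real r" by (simp add: real_sqrt_mult)
    also have "\<dots> \<le> 3 * real r"
    proof (rule mult_right_mono)
      have "sqrt 2 \<le> 3/2" by (rule real_le_lsqrt) (auto simp: power2_eq_square)
      then show "2 * sqrt 2 \<le> (3::real)" by simp
    qed simp
    finally show "frob_norm (B * V\<^sup>T) \<le> 3 * real r" .
  qed simp
  finally show "frob_norm (Z * proj L) \<le> 3 * real r * frob_norm (Z * scaled r L d)"
    by (simp add: V_def mult.commute)
qed

section \<open>Column blocks of loadings\<close>

lemma cols_carrier: "A \<in> carrier_mat n r \<Longrightarrow> Defs.cols A a b \<in> carrier_mat n (b - a)"
  by (simp add: Defs.cols_def)

lemma frob_cols_le:
  assumes A: "A \<in> carrier_mat n r" and ab: "a \<le> b" "b \<le> r"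
  shows "frob_norm (Defs.cols A a b) \<le> frob_norm A"
proof -
  let ?g = "\<lambda>p. A $$ p * A $$ p"
  have "mip (Defs.cols A a b) (Defs.cols A a b) = (\<Sum>p\<in>{..<n}\<times>{..<b-a}. ?g (fst p, a + snd p))"
    unfolding mip_sum_prod[OF cols_carrier[OF A]] using A by (intro sum.cong refl) (auto simp: Defs.cols_def)
  also have "\<dots> = sum ?g ((\<lambda>p. (fst p, a + snd p)) ` ({..<n}\<times>{..<b-a}))"
    by (subst sum.reindex) (auto simp: inj_on_def)
  also have "\<dots> \<le> sum ?g ({..<n}\<times>{..<r})"
    using ab by (intro sum_mono2) auto
  finally show ?thesis unfolding mip_sum_prod[OF A, symmetric] by (simp add: frob_norm_mip)
qed

lemma mult_cols:
  assumes "E \<in> carrier_mat t n" "A \<in> carrier_mat n r" "b \<le> r"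
  shows "E * Defs.cols A a b = Defs.cols (E * A) a b"
  using assms by (intro eq_matI) (auto simp: Defs.cols_def scalar_prod_def)

lemma scaled_cols:
  assumes "L \<in> carrier_mat n r" "a \<le> b" "b \<le> r"
  shows "scaled (b - a) (Defs.cols L a b) (\<lambda>i. d (a + i)) = Defs.cols (scaled r L d) a b"
proof (rule eq_matI)
  fix i j assume "i < dim_row (Defs.cols (scaled r L d) a b)" "j < dim_col (Defs.cols (scaled r L d) a b)"
  then have ij: "i < n" "j < b - a" using assms by (auto simp: Defs.cols_def scaled_def)
  then have "scaled (b - a) (Defs.cols L a b) (\<lambda>i. d (a + i)) $$ (i,j) = L $$ (i, a + j) * (1 / sqrt (d (a + j)))"
    unfolding scaled_def mult_dmat_index[OF cols_carrier[OF assms(1)] ij] using assms by (simp add: Defs.cols_def)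
  also have "\<dots> = scaled r L d $$ (i, a + j)"
    unfolding scaled_def using mult_dmat_index[OF assms(1), of i "a + j"] ij assms by simp
  also have "\<dots> = Defs.cols (scaled r L d) a b $$ (i,j)"
    using ij carrier_matD[OF scaled_carrier[OF assms(1), of d]] by (simp add: Defs.cols_def)
  finally show "scaled (b - a) (Defs.cols L a b) (\<lambda>i. d (a + i)) $$ (i,j) = Defs.cols (scaled r L d) a b $$ (i,j)" .
qed (use assms in \<open>auto simp: Defs.cols_def scaled_def dmat_def\<close>)

text \<open>The Gram defect of a column block is a diagonal block of the full Gram defect, so every
  block of loadings inherits near orthonormality without loss.\<close>

lemma near_on_cols:
  assumes no: "near_on n r L d" and ab: "a \<le> b" "b \<le> r"
  shows "near_on n (b - a) (Defs.cols L a b) (\<lambda>i. d (a + i))"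
    and "frob_norm ((scaled (b - a) (Defs.cols L a b) (\<lambda>i. d (a + i)))\<^sup>T * scaled (b - a) (Defs.cols L a b) (\<lambda>i. d (a + i)) - 1\<^sub>m (b - a))
      \<le> frob_norm ((scaled r L d)\<^sup>T * scaled r L d - 1\<^sub>m r)"
proof -
  let ?V = "scaled r L d" and ?W = "Defs.cols (scaled r L d) a b"
  have L: "L \<in> carrier_mat n r" and dp: "\<forall>i<r. 0 < d i" and near: "frob_norm (?V\<^sup>T * ?V - 1\<^sub>m r) \<le> 1/2"
    using no by (auto simp: near_on_def)
  have V: "?V \<in> carrier_mat n r" using L by simp
  let ?G = "?V\<^sup>T * ?V - 1\<^sub>m r"
  have G: "?G \<in> carrier_mat r r" and GT: "(Defs.cols ?G a b)\<^sup>T \<in> carrier_mat (b - a) r"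
    using cols_carrier[of ?G r r a b] by auto
  have "?W\<^sup>T * ?W - 1\<^sub>m (b - a) = Defs.cols ((Defs.cols ?G a b)\<^sup>T) a b"
    using V ab by (intro eq_matI) (auto simp: Defs.cols_def scalar_prod_def mult.commute)
  then have "frob_norm (?W\<^sup>T * ?W - 1\<^sub>m (b - a)) \<le> frob_norm ?G"
    using frob_cols_le[OF GT ab] frob_cols_le[OF G ab] by simp
  then show le: "frob_norm ((scaled (b - a) (Defs.cols L a b) (\<lambda>i. d (a + i)))\<^sup>T * scaled (b - a) (Defs.cols L a b) (\<lambda>i. d (a + i)) - 1\<^sub>m (b - a))
      \<le> frob_norm ?G"
    unfolding scaled_cols[OF L ab] .
  then show "near_on n (b - a) (Defs.cols L a b) (\<lambda>i. d (a + i))"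
    using near cols_carrier[OF L] dp ab by (auto simp: near_on_def)
qed

section \<open>Perturbation of a single panel\<close>

text \<open>Duality: with \<open>x\<close> the left-hand norm,
  \<open>x * x = mip W (E * (E\<^sup>T * W))\<close>, and one factor \<open>x\<close> cancels. Thus
  the transpose obeys the spectral bound of \<open>E\<close>.\<close>

lemma frob_transpose_mult_le_spec:
  assumes E: "E \<in> carrier_mat t n" and W: "W \<in> carrier_mat t m"
  shows "frob_norm (E\<^sup>T * W) \<le> spec_norm E * frob_norm W"
proof -
  let ?x = "frob_norm (E\<^sup>T * W)"
  have ET: "E\<^sup>T \<in> carrier_mat n t" and EW: "E\<^sup>T * W \<in> carrier_mat n m" using E W by auto
  have EEW: "E * (E\<^sup>T * W) \<in> carrier_mat t m" using E EW by auto
  have "?x * ?x = mip W (E * (E\<^sup>T * W))"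
    using mip_mult_left[OF ET W EW] frob_norm_sq[of "E\<^sup>T * W"] by (simp add: power2_eq_square)
  also have "\<dots> \<le> frob_norm W * frob_norm (E * (E\<^sup>T * W))"
    using mip_le_frob[OF W EEW] by linarith
  also have "\<dots> \<le> frob_norm W * (spec_norm E * ?x)"
    by (intro mult_left_mono frob_norm_mult_le_spec[OF E EW]) simp
  finally have le: "?x * ?x \<le> (spec_norm E * frob_norm W) * ?x" by (simp add: mult_ac)
  show ?thesis
  proof (cases "?x = 0")
    case False
    then have "0 < ?x" using frob_norm_nonneg[of "E\<^sup>T * W"] by linarith
    then show ?thesis using le mult_le_cancel_right by blast
  qed simp
qed

lemma gram_symmetric:
  assumes "X \<in> carrier_mat t n"
  shows "c \<cdot>\<^sub>m (X\<^sup>T * X) \<in> carrier_mat n n" "(c \<cdot>\<^sub>m (X\<^sup>T * X))\<^sup>T = c \<cdot>\<^sub>m (X\<^sup>T * (X :: real Matrix.mat))"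
proof -
  have "(X\<^sup>T * X)\<^sup>T = X\<^sup>T * X" using transpose_mult[of "X\<^sup>T" n t X n] assms by simp
  moreover have "(c \<cdot>\<^sub>m (X\<^sup>T * X))\<^sup>T = c \<cdot>\<^sub>m (X\<^sup>T * X)\<^sup>T" by (intro eq_matI) auto
  ultimately show "(c \<cdot>\<^sub>m (X\<^sup>T * X))\<^sup>T = c \<cdot>\<^sub>m (X\<^sup>T * X)" by simp
qed (use assms in auto)

text \<open>The cross terms are grouped around \<open>F\<^sup>T * E\<close>, the product whose size
  (A4) controls.\<close>

lemma gram_panel:
  assumes F: "F \<in> carrier_mat t r" and L: "L \<in> carrier_mat n r" and E: "E \<in> carrier_mat t n"
  shows "(panel F L E)\<^sup>T * panel F L E - (F * L\<^sup>T)\<^sup>T * (F * L\<^sup>T)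
    = L * (F\<^sup>T * E) + (F\<^sup>T * E)\<^sup>T * L\<^sup>T + E\<^sup>T * E"
proof -
  let ?C = "F * L\<^sup>T"
  have C: "?C \<in> carrier_mat t n" and CT: "?C\<^sup>T \<in> carrier_mat n t" and ET: "E\<^sup>T \<in> carrier_mat n t"
    and LT: "L\<^sup>T \<in> carrier_mat r n" and FT: "F\<^sup>T \<in> carrier_mat r t" using F L E by auto
  have CE: "?C + E \<in> carrier_mat t n" using C E by simp
  have "(?C + E)\<^sup>T * (?C + E) = ?C\<^sup>T * ?C + ?C\<^sup>T * E + (E\<^sup>T * ?C + E\<^sup>T * E)"
    by (simp only: transpose_add[OF C E] add_mult_distrib_mat[OF CT ET CE]
        mult_add_distrib_mat[OF CT C E] mult_add_distrib_mat[OF ET C E])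
  moreover have "?C\<^sup>T * E = L * (F\<^sup>T * E)"
    using transpose_mult[OF F LT] assoc_mult_mat[OF L FT E] by simp
  moreover have "E\<^sup>T * ?C = (F\<^sup>T * E)\<^sup>T * L\<^sup>T"
    using transpose_mult[OF FT E] assoc_mult_mat[OF ET F LT] by simp
  ultimately have e: "(panel F L E)\<^sup>T * panel F L E
      = ?C\<^sup>T * ?C + L * (F\<^sup>T * E) + ((F\<^sup>T * E)\<^sup>T * L\<^sup>T + E\<^sup>T * E)"
    by (simp add: panel_def)
  show ?thesis unfolding e using C L F E by (intro eq_matI) (auto simp del: index_mult_mat(1))
qed

text \<open>The Gram matrix of the signal is a quadratic form of the loadings, so that its gap to the
  orthogonal complement of the loading space is governed by the weakest factor.\<close>
lemma panel_projection_error: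
  assumes no: "near_on n r L d" and dmin: "0 < dmin" "\<And>i. i < r \<Longrightarrow> dmin \<le> d i"
    and t: "0 < t" and n: "0 < n"
    and F: "F \<in> carrier_mat t r" and E: "E \<in> carrier_mat t n"
    and c0: "0 < c0" and sig: "\<And>Z m. Z \<in> carrier_mat r m \<Longrightarrow> c0 * real t * (frob_norm Z)\<^sup>2 \<le> (frob_norm (F * Z))\<^sup>2"
    and lead: "leading_eigvecs ((1 / (real n * real t)) \<cdot>\<^sub>m ((panel F L E)\<^sup>T * panel F L E)) r Q"
  shows "c0 * dmin * real t * frob_norm ((1\<^sub>m n - Q * Q\<^sup>T) * proj L)
      \<le> 18 * (real r)\<^sup>2 * sqrt (real r) * (2 * frob_norm L * frob_norm (F\<^sup>T * E) + (spec_norm E)\<^sup>2)"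
    and "frob_norm ((1\<^sub>m n - proj L) * (Q * Q\<^sup>T)) = frob_norm ((1\<^sub>m n - Q * Q\<^sup>T) * proj L)"
proof -
  define X where "X = panel F L E"
  define C where "C = F * L\<^sup>T"
  define P where "P = proj L"
  define R where "R = Q * Q\<^sup>T"
  define a where "a = 1 / (real n * real t)"
  define S where "S = a \<cdot>\<^sub>m (C\<^sup>T * C)"
  define S' where "S' = a \<cdot>\<^sub>m (X\<^sup>T * X)"
  have L: "L \<in> carrier_mat n r" and dp: "\<forall>i<r. 0 < d i" using no by (auto simp: near_on_def)
  have a: "0 < a" using t n by (simp add: a_def)
  have C: "C \<in> carrier_mat t n" and CT: "C\<^sup>T \<in> carrier_mat n t" using F L by (auto simp: C_def)
  have X: "X \<in> carrier_mat t n" using C E by (simp add: X_def panel_def C_def)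
  note S = gram_symmetric[OF C, of a, folded S_def]
  note S' = gram_symmetric[OF X, of a, folded S'_def]
  have lead': "leading_eigvecs S' r Q" using lead by (simp add: S'_def X_def a_def)
  then have Q: "Q \<in> carrier_mat n r" "Q\<^sup>T * Q = 1\<^sub>m r" using S' by (auto simp: leading_eigvecs_def)
  note P = near_on_is_proj(1,2)[OF no, folded P_def]
  note R = is_proj_orthonormal(1,2)[OF Q, folded R_def]
  have Pc: "P \<in> carrier_mat n n" "P\<^sup>T = P" "P * P = P" using P by (auto simp: is_proj_def)
  have Rc: "R \<in> carrier_mat n n" "R\<^sup>T = R" "R * R = R" using R by (auto simp: is_proj_def)
  define R' where "R' = 1\<^sub>m n - R"
  have R': "R' \<in> carrier_mat n n" "R'\<^sup>T = R'" "R' * R' = R'" using is_proj_compl[OF R(1)] by (auto simp: is_proj_def R'_def)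
  let ?x = "frob_norm (R' * P)"
  define w where "w = 2 * frob_norm L * frob_norm (F\<^sup>T * E) + (spec_norm E)\<^sup>2"
  have ky_fan: "mip S' P \<le> mip S' R" unfolding R_def by (rule leading_eigvecs_ky_fan[OF S' lead' P])
  define D where "D = S' - S"
  have FE: "F\<^sup>T * E \<in> carrier_mat r n" and LT: "L\<^sup>T \<in> carrier_mat r n" and FET: "(F\<^sup>T * E)\<^sup>T \<in> carrier_mat n r"
    and ET: "E\<^sup>T \<in> carrier_mat n t" using F E L by auto
  have D: "D = a \<cdot>\<^sub>m (L * (F\<^sup>T * E) + (F\<^sup>T * E)\<^sup>T * L\<^sup>T + E\<^sup>T * E)"
    unfolding gram_panel[OF F L E, symmetric] D_def S_def S'_def X_def C_def
    using X C F L E by (intro eq_matI) (auto simp: panel_def right_diff_distrib simp del: index_mult_mat(1))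
  \<comment> \<open>\<open>U\<close> has norm \<open>sqrt r\<close>. The cross terms are bounded
    through Frobenius norms, while the Gram matrix of the noise is applied to \<open>U\<close> in
    two spectral steps.\<close>
  have noise: "frob_norm (D * U) \<le> a * sqrt (real r) * w" if U: "U \<in> carrier_mat n n" "mip U U = real r" for U
  proof -
    have fU: "frob_norm U = sqrt (real r)" using U by (simp add: frob_norm_mip)
    have c1: "L * (F\<^sup>T * E) \<in> carrier_mat n n" and c2: "(F\<^sup>T * E)\<^sup>T * L\<^sup>T \<in> carrier_mat n n"
      and c3: "E\<^sup>T * E \<in> carrier_mat n n" using L FE LT FET E ET by auto
    have c12: "L * (F\<^sup>T * E) + (F\<^sup>T * E)\<^sup>T * L\<^sup>T \<in> carrier_mat n n" using c1 c2 by simp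
    have "frob_norm (D * U) = a * frob_norm ((L * (F\<^sup>T * E) + (F\<^sup>T * E)\<^sup>T * L\<^sup>T + E\<^sup>T * E) * U)"
    proof -
      have "D * U = a \<cdot>\<^sub>m ((L * (F\<^sup>T * E) + (F\<^sup>T * E)\<^sup>T * L\<^sup>T + E\<^sup>T * E) * U)"
        unfolding D by (rule mult_smult_assoc_mat[OF add_carrier_mat[OF c3] U(1)])
      then show ?thesis using a by (simp add: frob_norm_smult)
    qed
    also have "(L * (F\<^sup>T * E) + (F\<^sup>T * E)\<^sup>T * L\<^sup>T + E\<^sup>T * E) * U
        = L * (F\<^sup>T * E) * U + (F\<^sup>T * E)\<^sup>T * L\<^sup>T * U + E\<^sup>T * E * U"
      by (simp only: add_mult_distrib_mat[OF c12 c3 U(1)] add_mult_distrib_mat[OF c1 c2 U(1)])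
    also have "frob_norm \<dots> \<le> frob_norm (L * (F\<^sup>T * E) * U) + frob_norm ((F\<^sup>T * E)\<^sup>T * L\<^sup>T * U) + frob_norm (E\<^sup>T * E * U)"
    proof -
      have "frob_norm (L * (F\<^sup>T * E) * U + (F\<^sup>T * E)\<^sup>T * L\<^sup>T * U + E\<^sup>T * E * U)
          \<le> frob_norm (L * (F\<^sup>T * E) * U + (F\<^sup>T * E)\<^sup>T * L\<^sup>T * U) + frob_norm (E\<^sup>T * E * U)"
        by (rule frob_norm_add_le[of _ n n]) (use c1 c2 c3 U in auto)
      moreover have "frob_norm (L * (F\<^sup>T * E) * U + (F\<^sup>T * E)\<^sup>T * L\<^sup>T * U)
          \<le> frob_norm (L * (F\<^sup>T * E) * U) + frob_norm ((F\<^sup>T * E)\<^sup>T * L\<^sup>T * U)"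
        by (rule frob_norm_add_le[of _ n n]) (use c1 c2 c3 U in auto)
      ultimately show ?thesis by linarith
    qed
    also have "\<dots> \<le> sqrt (real r) * w"
    proof -
      have "frob_norm (L * (F\<^sup>T * E) * U) \<le> frob_norm L * frob_norm (F\<^sup>T * E) * sqrt (real r)"
        using frob_norm_mult_le[OF c1 U(1)] mult_right_mono[OF frob_norm_mult_le[OF L FE] frob_norm_nonneg[of U]] fU by simp
      moreover have "frob_norm ((F\<^sup>T * E)\<^sup>T * L\<^sup>T * U) \<le> frob_norm (F\<^sup>T * E) * frob_norm L * sqrt (real r)"
        using frob_norm_mult_le[OF c2 U(1)] mult_right_mono[OF frob_norm_mult_le[OF FET LT] frob_norm_nonneg[of U]] fU
        by (simp only: frob_norm_transpose)
      moreover have "frob_norm (E\<^sup>T * E * U) \<le> (spec_norm E)\<^sup>2 * sqrt (real r)"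
      proof -
        have "E\<^sup>T * E * U = E\<^sup>T * (E * U)" by (rule assoc_mult_mat[OF ET E U(1)])
        then have "frob_norm (E\<^sup>T * E * U) \<le> spec_norm E * frob_norm (E * U)"
          using frob_transpose_mult_le_spec[OF E, of "E * U" n] E U by simp
        also have "\<dots> \<le> spec_norm E * (spec_norm E * frob_norm U)"
          by (intro mult_left_mono frob_norm_mult_le_spec[OF E U(1)]) simp
        finally show ?thesis by (simp add: fU power2_eq_square)
      qed
      ultimately show ?thesis by (simp add: w_def algebra_simps)
    qed
    finally show ?thesis using a by (simp add: mult.assoc)
  qed
  \<comment> \<open>\<open>P\<close> fixes the loadings, so \<open>mip S P\<close> is the whole
    trace of \<open>S\<close> and the loss equals \<open>a * (frob_norm (C * R'))\<^sup>2\<close>.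
    The factor condition \<open>sig\<close> passes from \<open>C\<close> to \<open>L\<close>, the
    least strength \<open>dmin\<close> from \<open>L\<close> to the scaled loadings; 9 is the square
    of the 3 in \<open>near_on_is_proj\<close>.\<close>
  have lower: "c0 * dmin / (9 * (real r)\<^sup>2 * real n) * ?x\<^sup>2 \<le> mip S (P - R)" if r: "r \<noteq> 0"
  proof -
    let ?V = "scaled r L d"
    have V: "?V \<in> carrier_mat n r" using L by simp
    have LP: "L\<^sup>T * P = L\<^sup>T"
      using near_on_is_proj(4)[OF no] transpose_mult[OF Pc(1) L] Pc(2) by (simp add: P_def)
    have CP: "C * P = C" unfolding C_def using assoc_mult_mat[OF F LT Pc(1)] LP by simp
    have "mip S (P - R) = mip S P - mip S R" by (rule mip_minus_right[OF Pc(1) Rc(1) S(1)])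
    also have "mip S P = mip S (1\<^sub>m n)"
    proof -
      have SP: "S * P = S"
        unfolding S_def using mult_smult_assoc_mat[of "C\<^sup>T * C" n n P n a] assoc_mult_mat[OF CT C Pc(1)] C Pc(1) CP by simp
      have "mip S P = mip (S * P) (1\<^sub>m n)" using mip_mult_right[OF S(1) Pc(1), of "1\<^sub>m n"] Pc by simp
      then show ?thesis using SP by simp
    qed
    also have "mip S (1\<^sub>m n) - mip S R = mip S R'"
      unfolding R'_def by (rule mip_minus_right[OF one_carrier_mat Rc(1) S(1), symmetric])
    also have "\<dots> = a * (frob_norm (C * R'))\<^sup>2"
    proof -
      have CR: "C * R' \<in> carrier_mat t n" using C R' by simp
      have "mip (C * R') (C * R') = mip C (C * R' * R')"
        using mip_mult_right[OF C R'(1) CR] R'(2) by simp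
      also have "\<dots> = mip C (C * R')" using assoc_mult_mat[OF C R'(1) R'(1)] R'(3) by simp
      also have "\<dots> = mip (C * R') C" by (rule mip_commute[OF C CR])
      also have "\<dots> = mip R' (C\<^sup>T * C)" by (rule mip_mult_left[OF C R'(1) C])
      also have "\<dots> = mip (C\<^sup>T * C) R'" by (rule mip_commute[OF R'(1)]) (use C in auto)
      finally show ?thesis by (simp add: S_def mip_smult_left frob_norm_sq)
    qed
    finally have e: "mip S (P - R) = a * (frob_norm (C * R'))\<^sup>2" .
    have "c0 * real t * (frob_norm (L\<^sup>T * R'))\<^sup>2 \<le> (frob_norm (F * (L\<^sup>T * R')))\<^sup>2"
      by (rule sig) (use LT R' in auto)
    also have "F * (L\<^sup>T * R') = C * R'" unfolding C_def by (rule assoc_mult_mat[OF F LT R'(1), symmetric])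
    also have "frob_norm (L\<^sup>T * R') = frob_norm (R' * L)"
      using frob_norm_transpose[of "R' * L"] transpose_mult[OF R'(1) L] R'(2) by simp
    finally have s1: "c0 * real t * (frob_norm (R' * L))\<^sup>2 \<le> (frob_norm (C * R'))\<^sup>2" .
    have s2: "frob_norm (R' * ?V) \<le> 1 / sqrt dmin * frob_norm (R' * L)"
    proof -
      have "R' * ?V = R' * L * dmat r (\<lambda>i. 1 / sqrt (d i))"
        unfolding scaled_def by (rule assoc_mult_mat[OF R'(1) L dmat_carrier, symmetric])
      moreover have "frob_norm (R' * L * dmat r (\<lambda>i. 1 / sqrt (d i))) \<le> 1 / sqrt dmin * frob_norm (R' * L)"
      proof (rule frob_mult_dmat_le)
        show "R' * L \<in> carrier_mat n r" using R' L by simp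
        fix j assume j: "j < r"
        then show "\<bar>1 / sqrt (d j)\<bar> \<le> 1 / sqrt dmin" using dmin(2)[OF j] dmin(1) by (simp add: frac_le)
      qed (use dmin in simp)
      ultimately show ?thesis by simp
    qed
    have "?x \<le> 3 * real r * frob_norm (R' * ?V)"
      unfolding P_def by (rule near_on_is_proj(5)[OF no R'(1)])
    also have "\<dots> \<le> 3 * real r * (1 / sqrt dmin * frob_norm (R' * L))"
      by (intro mult_left_mono s2) simp
    finally have "?x\<^sup>2 \<le> (3 * real r * (1 / sqrt dmin * frob_norm (R' * L)))\<^sup>2"
      by (rule power_mono) simp
    also have "\<dots> = 9 * (real r)\<^sup>2 / dmin * (frob_norm (R' * L))\<^sup>2"
      using dmin(1) by (simp add: power_mult_distrib power_divide)
    finally have s3: "dmin / (9 * (real r)\<^sup>2) * ?x\<^sup>2 \<le> (frob_norm (R' * L))\<^sup>2"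
      using r dmin(1) by (simp add: field_simps)
    have "c0 * dmin / (9 * (real r)\<^sup>2 * real n) * ?x\<^sup>2 = a * (c0 * real t * (dmin / (9 * (real r)\<^sup>2) * ?x\<^sup>2))"
      using t n by (simp add: a_def mult_ac)
    also have "\<dots> \<le> a * (c0 * real t * (frob_norm (R' * L))\<^sup>2)"
      using a c0 s3 by (intro mult_left_mono) auto
    also have "\<dots> \<le> a * (frob_norm (C * R'))\<^sup>2" using a s1 by (intro mult_left_mono) auto
    finally show ?thesis using e by simp
  qed
  have w0: "0 \<le> w" unfolding w_def by (intro add_nonneg_nonneg mult_nonneg_nonneg) auto
  have bP: "frob_norm ((S' - S) * P) \<le> a * sqrt (real r) * w" and bR: "frob_norm ((S' - S) * R) \<le> a * sqrt (real r) * w"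
    using noise[OF Pc(1) P(2)] noise[OF Rc(1) R(2)] by (simp_all add: D_def)
  \<comment> \<open>For \<open>r = 0\<close> both projections vanish, and the gap is set to
    0.\<close>
  define g where "g = (if r = 0 then 0 else c0 * dmin / (9 * (real r)\<^sup>2 * real n))"
  have x0: "?x = 0" if "r = 0"
  proof -
    have "frob_norm P = 0" using P(2) that by (simp add: frob_norm_mip)
    then show ?thesis using frob_norm_mult_le[OF R'(1) Pc(1)] frob_norm_nonneg[of "R' * P"] by simp
  qed
  have gap: "g * (frob_norm ((1\<^sub>m n - R) * P))\<^sup>2 \<le> mip S (P - R)"
  proof (cases "r = 0")
    case True
    then have "P = 0\<^sub>m n n" "R = 0\<^sub>m n n"
      using P(2) R(2) by (auto intro!: frob_norm_eq_0[OF Pc(1)] frob_norm_eq_0[OF Rc(1)] simp: frob_norm_mip)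
    then have "P - R = 0\<^sub>m n n" by (intro eq_matI) auto
    then show ?thesis using True S by (simp add: g_def)
  next
    case False
    then show ?thesis using lower by (simp add: g_def R'_def)
  qed
  note pg = proj_gap[OF P R S S' ky_fan gap bP bR]
  show "frob_norm ((1\<^sub>m n - proj L) * (Q * Q\<^sup>T)) = frob_norm ((1\<^sub>m n - Q * Q\<^sup>T) * proj L)"
    using pg(1) by (simp only: P_def R_def)
  show "c0 * dmin * real t * frob_norm ((1\<^sub>m n - Q * Q\<^sup>T) * proj L)
      \<le> 18 * (real r)\<^sup>2 * sqrt (real r) * (2 * frob_norm L * frob_norm (F\<^sup>T * E) + (spec_norm E)\<^sup>2)"
  proof (cases "r = 0")
    case True
    then show ?thesis using x0 by (simp add: R'_def R_def P_def)
  next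
    case False
    have "c0 * dmin / (9 * (real r)\<^sup>2 * real n) * ?x \<le> 2 * (1 / (real n * real t) * sqrt (real r) * w)"
      using pg(2) False by (simp add: g_def a_def R'_def)
    \<comment> \<open>Clearing denominators cancels the dimension \<open>n\<close> from both sides;
      18 is 2 times 9.\<close>
    then have "c0 * dmin * ?x * real t \<le> 18 * (real r)\<^sup>2 * sqrt (real r) * w"
      using False t n by (simp add: field_simps)
    then show ?thesis by (simp add: R'_def R_def P_def w_def mult_ac)
  qed
qed

section \<open>Aggregation of the panels\<close>

lemma mip_proj_one:
  assumes "is_proj n P"
  shows "mip P (1\<^sub>m n) = mip P P"
proof -
  have P: "P \<in> carrier_mat n n" "P\<^sup>T = P" "P * P = P" using assms by (auto simp: is_proj_def)
  show ?thesis using mip_mult_right[OF P(1) P(1), of "1\<^sub>m n"] P mip_mult_left[OF P(1) P(1), of "1\<^sub>m n"] by simp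
qed

text \<open>Comparing the traces of \<open>P1 + P2\<close> and of its square gives
  \<open>mip P2 P1 = 0\<close>, and this number is the squared norm of \<open>P2 * P1\<close>. In
  this way the additivity of the block projections yields orthogonality of the blocks.\<close>

lemma is_proj_orthogonal:
  assumes P1: "is_proj n P1" and P2: "is_proj n P2" and sum: "is_proj n (P1 + P2)"
  shows "P2 * P1 = 0\<^sub>m n n"
proof -
  have c1: "P1 \<in> carrier_mat n n" "P1\<^sup>T = P1" "P1 * P1 = P1" using P1 by (auto simp: is_proj_def)
  have c2: "P2 \<in> carrier_mat n n" "P2\<^sup>T = P2" "P2 * P2 = P2" using P2 by (auto simp: is_proj_def)
  have I: "1\<^sub>m n \<in> carrier_mat n n" by simp
  have s: "P1 + P2 \<in> carrier_mat n n" using c1 c2 by simp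
  have "mip P1 (1\<^sub>m n) + mip P2 (1\<^sub>m n) = mip (P1 + P2) (P1 + P2)"
    using mip_proj_one[OF sum] mip_add_left[OF c1(1) c2(1)] by simp
  also have "\<dots> = mip P1 P1 + 2 * mip P2 P1 + mip P2 P2"
    using mip_commute[OF c1(1) c2(1)]
    by (simp add: mip_add_left[OF c1(1) c2(1)] mip_add_right[OF c1(1) c2(1) c1(1)] mip_add_right[OF c1(1) c2(1) c2(1)])
  finally have z: "mip P2 P1 = 0" using mip_proj_one[OF P1] mip_proj_one[OF P2] by simp
  have PP: "P2 * P1 \<in> carrier_mat n n" using c1 c2 by simp
  have "mip (P2 * P1) (P2 * P1) = mip P1 (P2 * (P2 * P1))"
    using mip_mult_left[OF c2(1) c1(1) PP] c2(2) by simp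
  also have "P2 * (P2 * P1) = P2 * P1" using assoc_mult_mat[OF c2(1) c2(1) c1(1)] c2(3) by simp
  also have "mip P1 (P2 * P1) = mip (P2 * P1) P1" by (rule mip_commute[OF c1(1) PP])
  also have "\<dots> = mip P2 P1" using mip_mult_right[OF c2(1) c1(1) c1(1)] c1 by simp
  finally show ?thesis using z by (intro frob_norm_eq_0[OF PP]) (simp add: frob_norm_mip)
qed

section \<open>Finite sums of square matrices\<close>

lemma msum_carrier [simp]: "msum n I f \<in> carrier_mat n n"
  by (simp add: msum_def)

lemma msum_empty [simp]: "msum n {} f = 0\<^sub>m n n"
  by (rule eq_matI) (auto simp: msum_def)

lemma msum_insert:
  assumes "finite I" "k \<notin> I" "f k \<in> carrier_mat n n"
  shows "msum n (insert k I) f = f k + msum n I f"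
  using assms by (intro eq_matI) (auto simp: msum_def)

lemma frob_msum_le:
  assumes "finite I" "\<And>k. k \<in> I \<Longrightarrow> f k \<in> carrier_mat n n"
  shows "frob_norm (msum n I f) \<le> (\<Sum>k\<in>I. frob_norm (f k))"
  using assms
proof (induction I rule: finite_induct)
  case (insert k I)
  have "frob_norm (msum n (insert k I) f) \<le> frob_norm (f k) + frob_norm (msum n I f)"
    using insert frob_norm_add_le[of "f k" n n "msum n I f"] by (simp add: msum_insert)
  then show ?case using insert by (simp add: insert.IH order_trans)
qed simp

lemma msum_mult:
  assumes "finite I" "\<And>k. k \<in> I \<Longrightarrow> f k \<in> carrier_mat n n" "P \<in> carrier_mat n n"
  shows "msum n I f * P = msum n I (\<lambda>k. f k * P)"
  using assms
proof (induction I rule: finite_induct)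
  case (insert k I)
  have fk: "f k \<in> carrier_mat n n" using insert by simp
  then have "f k * P \<in> carrier_mat n n" using mult_carrier_mat insert.prems(2) by blast
  moreover have "msum n I f * P = msum n I (\<lambda>k. f k * P)" using insert by simp
  ultimately show ?case using insert.hyps fk add_mult_distrib_mat[OF fk msum_carrier[of n I f] insert.prems(2)]
    by (simp add: msum_insert[of I k f] msum_insert[of I k "\<lambda>k. f k * P"])
qed simp

lemma msum_transpose:
  assumes "\<And>k. k \<in> I \<Longrightarrow> f k \<in> carrier_mat n n" "\<And>k. k \<in> I \<Longrightarrow> (f k)\<^sup>T = f k"
  shows "(msum n I f)\<^sup>T = msum n I f"
proof (rule eq_matI)
  fix i j assume ij: "i < dim_row (msum n I f)" "j < dim_col (msum n I f)"
  have "f k $$ (j, i) = f k $$ (i, j)" if "k \<in> I" for k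
    using index_transpose_mat(1)[of i "f k" j] assms(1)[OF that] assms(2)[OF that] ij by (simp add: msum_def)
  then show "(msum n I f)\<^sup>T $$ (i, j) = msum n I f $$ (i, j)" using ij by (simp add: msum_def)
qed (auto simp: msum_def)

lemma smult_transpose: "(c \<cdot>\<^sub>m M)\<^sup>T = c \<cdot>\<^sub>m (M :: real Matrix.mat)\<^sup>T"
  by (intro eq_matI) auto

lemma frob_mult_proj_le:
  assumes P: "is_proj n P" and A: "A \<in> carrier_mat m n"
  shows "frob_norm (A * P) \<le> frob_norm A"
proof -
  have Pc: "P \<in> carrier_mat n n" "P\<^sup>T = P" using P by (auto simp: is_proj_def)
  have "frob_norm (P * A\<^sup>T) \<le> frob_norm (A\<^sup>T)" by (rule frob_proj_le[OF P]) (use A in simp)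
  moreover have "P * A\<^sup>T = (A * P)\<^sup>T" using transpose_mult[OF A Pc(1)] Pc(2) by simp
  ultimately show ?thesis by simp
qed

text \<open>The comparison matrix is \<open>P\<close> plus the compression \<open>Z\<close> of
  \<open>B\<close> to the complement of \<open>P\<close>: it has eigenvalue 1 on the weak space,
  while its quadratic form on the complement is at most \<open>1 - kappa\<close>. Since the weights
  sum to 1, the population average is \<open>P + B\<close> up to the mismatch \<open>eps\<close>,
  and passing from \<open>B\<close> to \<open>Z\<close> costs another multiple of it.\<close>

lemma aggregate_projection_error:
  fixes tau rho :: "nat \<Rightarrow> real"
  assumes A: "finite A" "0 \<notin> A"
    and tau: "\<And>k. k \<in> insert 0 A \<Longrightarrow> 0 \<le> tau k" "(\<Sum>k\<in>insert 0 A. tau k) = 1"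
    and P: "is_proj n P" "mip P P = real s" and Ps: "is_proj n Ps" and P0: "is_proj n (P + Ps)"
    and PT: "\<And>k. k \<in> A \<Longrightarrow> is_proj n (PT k)" and PTc: "\<And>k. k \<in> A \<Longrightarrow> is_proj n (PTc k)"
    and Pk: "\<And>k. k \<in> A \<Longrightarrow> is_proj n (PT k + PTc k)"
    and Rk: "\<And>k. k \<in> insert 0 A \<Longrightarrow> is_proj n (R k)"
    and rho0: "frob_norm (R 0 - (P + Ps)) \<le> rho 0"
    and rho: "\<And>k. k \<in> A \<Longrightarrow> frob_norm (R k - (PT k + PTc k)) \<le> rho k"
    and eps: "\<And>k. k \<in> A \<Longrightarrow> frob_norm (PT k - P) \<le> eps"
    and B: "B = tau 0 \<cdot>\<^sub>m Ps + msum n A (\<lambda>k. tau k \<cdot>\<^sub>m PTc k)" and specB: "spec_norm B \<le> 1 - kappa"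
    and lead: "leading_eigvecs (msum n (insert 0 A) (\<lambda>k. tau k \<cdot>\<^sub>m R k)) s Q"
  shows "kappa * frob_norm ((1\<^sub>m n - Q * Q\<^sup>T) * P)
      \<le> 2 * ((\<Sum>k\<in>insert 0 A. tau k * rho k) + 4 * (\<Sum>k\<in>A. tau k * eps))"
    and "frob_norm ((1\<^sub>m n - P) * (Q * Q\<^sup>T)) = frob_norm ((1\<^sub>m n - Q * Q\<^sup>T) * P)"
proof -
  define S' where "S' = msum n (insert 0 A) (\<lambda>k. tau k \<cdot>\<^sub>m R k)"
  define C where "C = 1\<^sub>m n - P"
  define U where "U = Q * Q\<^sup>T"
  have Pc: "P \<in> carrier_mat n n" "P\<^sup>T = P" "P * P = P" using P by (auto simp: is_proj_def)
  have C: "C \<in> carrier_mat n n" "C\<^sup>T = C" "C * C = C" using is_proj_compl[OF P(1)] by (auto simp: is_proj_def C_def)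
  have Psc: "Ps \<in> carrier_mat n n" "Ps\<^sup>T = Ps" using Ps by (auto simp: is_proj_def)
  have PTk: "PT k \<in> carrier_mat n n" "PTc k \<in> carrier_mat n n" "(PTc k)\<^sup>T = PTc k" if "k \<in> A" for k
    using PT[OF that] PTc[OF that] by (auto simp: is_proj_def)
  have Rkc: "R k \<in> carrier_mat n n" "(R k)\<^sup>T = R k" if "k \<in> insert 0 A" for k
    using Rk[OF that] by (auto simp: is_proj_def)
  have S': "S' \<in> carrier_mat n n" "S'\<^sup>T = S'"
    unfolding S'_def using Rkc by (auto intro!: msum_transpose simp: smult_transpose)
  have Q: "Q \<in> carrier_mat n s" "Q\<^sup>T * Q = 1\<^sub>m s" using lead by (auto simp: leading_eigvecs_def msum_def)
  note U = is_proj_orthonormal(1,2)[OF Q, folded U_def]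
  have Uc: "U \<in> carrier_mat n n" "U\<^sup>T = U" "U * U = U" using U by (auto simp: is_proj_def)
  define Bs where "Bs = msum n A (\<lambda>k. tau k \<cdot>\<^sub>m PTc k)"
  have Bs: "Bs \<in> carrier_mat n n" "Bs\<^sup>T = Bs"
    unfolding Bs_def using PTk by (auto intro!: msum_transpose simp: smult_transpose)
  have B': "B = tau 0 \<cdot>\<^sub>m Ps + Bs" using B by (simp add: Bs_def)
  have Bc: "B \<in> carrier_mat n n" using Psc Bs by (simp add: B')
  have BT: "B\<^sup>T = B" unfolding B' using transpose_add[of "tau 0 \<cdot>\<^sub>m Ps" n n Bs] Psc Bs by (simp add: smult_transpose)
  define e where "e = (\<Sum>k\<in>A. tau k * eps)"
  \<comment> \<open>\<open>B\<close> almost annihilates the weak space: \<open>Ps\<close> is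
    orthogonal to \<open>P\<close>, and each \<open>PTc k\<close> is orthogonal to
    \<open>PT k\<close>, which is within \<open>eps\<close> of \<open>P\<close>.\<close>
  have BP: "frob_norm (B * P) \<le> e"
  proof -
    have PsP: "Ps * P = 0\<^sub>m n n" by (rule is_proj_orthogonal[OF P(1) Ps P0])
    have "B * P = (tau 0 \<cdot>\<^sub>m Ps) * P + Bs * P"
      unfolding B' by (rule add_mult_distrib_mat[of _ n n]) (use Psc Bs Pc in auto)
    also have "(tau 0 \<cdot>\<^sub>m Ps) * P = 0\<^sub>m n n"
      using mult_smult_assoc_mat[OF Psc(1) Pc(1)] PsP by simp
    also have "Bs * P = msum n A (\<lambda>k. (tau k \<cdot>\<^sub>m PTc k) * P)"
      unfolding Bs_def by (rule msum_mult[OF A(1) _ Pc(1)]) (use PTk in simp)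
    finally have "frob_norm (B * P) = frob_norm (msum n A (\<lambda>k. (tau k \<cdot>\<^sub>m PTc k) * P))"
      by (simp add: left_add_zero_mat[of _ n n])
    also have "\<dots> \<le> (\<Sum>k\<in>A. frob_norm ((tau k \<cdot>\<^sub>m PTc k) * P))"
      by (rule frob_msum_le[OF A(1) mult_carrier_mat[OF _ Pc(1)]]) (use PTk in auto)
    also have "\<dots> \<le> e"
      unfolding e_def
    proof (rule sum_mono)
      fix k assume k: "k \<in> A"
      note c = PTk[OF k]
      have "(tau k \<cdot>\<^sub>m PTc k) * P = tau k \<cdot>\<^sub>m (PTc k * P)" by (rule mult_smult_assoc_mat[OF c(2) Pc(1)])
      also have "PTc k * P = PTc k * (P - PT k)"
      proof -
        have "PTc k * PT k = 0\<^sub>m n n" by (rule is_proj_orthogonal[OF PT[OF k] PTc[OF k] Pk[OF k]])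
        then have "PTc k * (P - PT k) = PTc k * P - 0\<^sub>m n n"
          by (simp add: mult_minus_distrib_mat[OF c(2) Pc(1) c(1)])
        then show ?thesis using c Pc by auto
      qed
      finally have "frob_norm ((tau k \<cdot>\<^sub>m PTc k) * P) = tau k * frob_norm (PTc k * (P - PT k))"
        using tau(1)[of k] k by (simp add: frob_norm_smult)
      also have "\<dots> \<le> tau k * frob_norm (P - PT k)"
        using tau(1)[of k] k c Pc by (intro mult_left_mono frob_proj_le[OF PTc[OF k]]) auto
      also have "P - PT k = (- 1) \<cdot>\<^sub>m (PT k - P)" using c Pc by (intro eq_matI) auto
      also have "tau k * frob_norm \<dots> \<le> tau k * eps"
        using tau(1)[of k] k eps[OF k] by (intro mult_left_mono) (auto simp: frob_norm_smult)
      finally show "frob_norm ((tau k \<cdot>\<^sub>m PTc k) * P) \<le> tau k * eps" .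
    qed
    finally show ?thesis .
  qed
  define Z where "Z = C * (B * C)"
  have BC: "B * C \<in> carrier_mat n n" using Bc C by simp
  have Zc: "Z \<in> carrier_mat n n" using C BC by (simp add: Z_def)
  have ZT: "Z\<^sup>T = Z"
  proof -
    have "Z\<^sup>T = (B * C)\<^sup>T * C" unfolding Z_def using transpose_mult[OF C(1) BC] C by simp
    also have "(B * C)\<^sup>T = C * B" using transpose_mult[OF Bc C(1)] C BT by simp
    finally show ?thesis unfolding Z_def using assoc_mult_mat[OF C(1) Bc C(1)] by simp
  qed
  define S where "S = P + Z"
  have S: "S \<in> carrier_mat n n" "S\<^sup>T = S" using Pc Zc ZT by (auto simp: S_def transpose_add[OF Pc(1) Zc])
  have ky_fan: "mip S' P \<le> mip S' U"
    unfolding U_def by (rule leading_eigvecs_ky_fan[OF S' _ P]) (use lead in \<open>simp add: S'_def\<close>)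
  let ?x = "frob_norm ((1\<^sub>m n - U) * P)"
  have x2: "?x\<^sup>2 = real s - mip P U" using proj_dist_sq[OF P(1) U(1)] P(2) by simp
  have y2: "(frob_norm (C * U))\<^sup>2 = ?x\<^sup>2"
    using proj_dist_sq[OF U(1) P(1)] x2 U(2) mip_commute[OF Pc(1) Uc(1)] by (simp add: C_def)
  have gap: "kappa * ?x\<^sup>2 \<le> mip S (P - U)"
  proof -
    have CP: "C * P = 0\<^sub>m n n"
      using minus_mult_distrib_mat[OF one_carrier_mat Pc(1) Pc(1)] Pc by (auto simp: C_def)
    have "mip Z P = mip (B * C) (C * P)" unfolding Z_def using mip_mult_left[OF C(1) BC Pc(1)] C(2) by simp
    then have ZP: "mip Z P = 0" using CP mip_zero_right[OF BC] by simp
    \<comment> \<open>The part of the estimated space outside the weak one; its squared norm is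
      again \<open>?x\<^sup>2\<close> by symmetry of the projection distance.\<close>
    define Y where "Y = C * U"
    have Y: "Y \<in> carrier_mat n n" using C Uc by (simp add: Y_def)
    have BY: "B * Y \<in> carrier_mat n n" using Bc Y by simp
    have YU: "Y * U = Y" unfolding Y_def using assoc_mult_mat[OF C(1) Uc(1) Uc(1)] Uc(3) by simp
    have "mip Z U = mip (B * C) Y" unfolding Z_def Y_def using mip_mult_left[OF C(1) BC Uc(1)] C(2) by simp
    also have "\<dots> = mip (B * C) (Y * U\<^sup>T)" using YU Uc(2) by simp
    also have "\<dots> = mip (B * C * U) Y" by (rule mip_mult_right[OF BC Uc(1) Y, symmetric])
    also have "B * C * U = B * Y" unfolding Y_def by (rule assoc_mult_mat[OF Bc C(1) Uc(1)])
    also have "mip (B * Y) Y \<le> frob_norm (B * Y) * frob_norm Y" using mip_le_frob[OF BY Y] by linarith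
    also have "\<dots> \<le> ((1 - kappa) * frob_norm Y) * frob_norm Y"
      using frob_norm_mult_le_spec[OF Bc Y] mult_right_mono[OF specB frob_norm_nonneg[of Y]]
      by (intro mult_right_mono) auto
    also have "\<dots> = (1 - kappa) * ?x\<^sup>2" using y2 by (simp add: Y_def power2_eq_square)
    finally have ZU: "mip Z U \<le> (1 - kappa) * ?x\<^sup>2" .
    have "mip S (P - U) = (mip P P - mip P U) + (mip Z P - mip Z U)"
      unfolding S_def using mip_add_left[OF Pc(1) Zc] mip_minus_right[OF Pc(1) Uc(1) Pc(1)] mip_minus_right[OF Pc(1) Uc(1) Zc] by simp
    also have "\<dots> = ?x\<^sup>2 - mip Z U" using x2 P(2) ZP by simp
    finally show ?thesis using ZU by (simp add: algebra_simps)
  qed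
  define b where "b = (\<Sum>k\<in>insert 0 A. tau k * rho k) + 4 * e"
  \<comment> \<open>Three sources of error: estimation of the panel projections (\<open>D1\<close>),
    mismatch of the weak blocks (\<open>D2\<close>), and the compression
    (\<open>B - Z\<close>).\<close>
  define D1 where "D1 = msum n (insert 0 A) (\<lambda>k. tau k \<cdot>\<^sub>m (R k - (if k = 0 then P + Ps else PT k + PTc k)))"
  define D2 where "D2 = msum n A (\<lambda>k. tau k \<cdot>\<^sub>m (PT k - P))"
  have D12: "D1 \<in> carrier_mat n n" "D2 \<in> carrier_mat n n" by (simp_all add: D1_def D2_def)
  have D: "S' - S = D1 + D2 + (B - Z)"
  proof (rule eq_matI)
    fix i j assume "i < dim_row (D1 + D2 + (B - Z))" "j < dim_col (D1 + D2 + (B - Z))"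
    then have ij: "i < n" "j < n" using Zc by auto
    \<comment> \<open>With weights summing to 1, the multiples of \<open>P\<close> from the target
      in \<open>D1\<close> and from \<open>D2\<close> add up to a single copy.\<close>
    have t0: "tau 0 = 1 - (\<Sum>k\<in>A. tau k)" using tau(2) A by simp
    have entA: "(\<Sum>k\<in>A. (tau k \<cdot>\<^sub>m (R k - (if k = 0 then P + Ps else PT k + PTc k))) $$ (i,j))
        = (\<Sum>k\<in>A. tau k * R k $$ (i,j) - tau k * PT k $$ (i,j) - tau k * PTc k $$ (i,j))"
    proof (rule sum.cong[OF refl])
      fix k assume k: "k \<in> A"
      then have "k \<noteq> 0" using A(2) by metis
      then show "(tau k \<cdot>\<^sub>m (R k - (if k = 0 then P + Ps else PT k + PTc k))) $$ (i,j)
          = tau k * R k $$ (i,j) - tau k * PT k $$ (i,j) - tau k * PTc k $$ (i,j)"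
        using ij PTk[OF k] Rkc(1)[of k] k by (simp add: algebra_simps)
    qed
    have ent2: "(\<Sum>k\<in>A. (tau k \<cdot>\<^sub>m (PT k - P)) $$ (i,j)) = (\<Sum>k\<in>A. tau k * PT k $$ (i,j) - tau k * P $$ (i,j))"
      using ij Pc by (intro sum.cong refl) (simp add: carrier_matD[OF PTk(1)] right_diff_distrib)
    have ent3: "(\<Sum>k\<in>A. (tau k \<cdot>\<^sub>m PTc k) $$ (i,j)) = (\<Sum>k\<in>A. tau k * PTc k $$ (i,j))"
      using ij by (intro sum.cong refl) (simp add: carrier_matD[OF PTk(2)])
    have ent4: "(\<Sum>k\<in>A. (tau k \<cdot>\<^sub>m R k) $$ (i,j)) = (\<Sum>k\<in>A. tau k * R k $$ (i,j))"
      using ij by (intro sum.cong refl) (simp add: carrier_matD[OF Rkc(1)])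
    show "(S' - S) $$ (i,j) = (D1 + D2 + (B - Z)) $$ (i,j)"
      using ij A Pc Zc Psc Rkc[of 0] ent4
      by (simp add: S'_def S_def D1_def D2_def B msum_def entA ent2 ent3 sum_subtractf sum.distrib t0 algebra_simps sum_distrib_right)
  qed (use Zc Pc in \<open>auto simp: S'_def S_def D1_def D2_def\<close>)
  have bD: "frob_norm (S' - S) \<le> b"
  proof -
    have "frob_norm D1 \<le> (\<Sum>k\<in>insert 0 A. tau k * rho k)"
    proof -
      have "frob_norm D1 \<le> (\<Sum>k\<in>insert 0 A. frob_norm (tau k \<cdot>\<^sub>m (R k - (if k = 0 then P + Ps else PT k + PTc k))))"
        unfolding D1_def by (rule frob_msum_le) (use A Rkc PTk Pc Psc in auto)
      also have "\<dots> \<le> (\<Sum>k\<in>insert 0 A. tau k * rho k)"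
      proof (rule sum_mono)
        fix k assume k: "k \<in> insert 0 A"
        have "frob_norm (R k - (if k = 0 then P + Ps else PT k + PTc k)) \<le> rho k"
          using k rho0 rho A(2) by (cases "k = 0") auto
        then show "frob_norm (tau k \<cdot>\<^sub>m (R k - (if k = 0 then P + Ps else PT k + PTc k))) \<le> tau k * rho k"
          using tau(1)[OF k] by (simp add: frob_norm_smult mult_left_mono)
      qed
      finally show ?thesis .
    qed
    moreover have "frob_norm D2 \<le> e"
    proof -
      have "frob_norm D2 \<le> (\<Sum>k\<in>A. frob_norm (tau k \<cdot>\<^sub>m (PT k - P)))"
        unfolding D2_def by (rule frob_msum_le) (use A PTk Pc in auto)
      also have "\<dots> \<le> e" unfolding e_def
        using tau(1) eps by (intro sum_mono) (auto simp: frob_norm_smult intro!: mult_left_mono)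
      finally show ?thesis .
    qed
    \<comment> \<open>Expanding the compression leaves \<open>B * P + P * B - P * (B * P)\<close>,
      three terms of norm at most \<open>e\<close>.\<close>
    moreover have "frob_norm (B - Z) \<le> 3 * e"
    proof -
      have PBP: "P * (B * P) \<in> carrier_mat n n" "B * P \<in> carrier_mat n n" "P * B \<in> carrier_mat n n" using Pc Bc by auto
      have "B * C = B - B * P" unfolding C_def using mult_minus_distrib_mat[OF Bc one_carrier_mat Pc(1)] Bc by simp
      then have "Z = (B - B * P) - P * (B - B * P)"
        unfolding Z_def C_def using minus_mult_distrib_mat[OF one_carrier_mat Pc(1), of "B - B * P" n] Bc PBP by simp
      also have "P * (B - B * P) = P * B - P * (B * P)" by (rule mult_minus_distrib_mat[OF Pc(1) Bc PBP(2)])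
      finally have BZ: "B - Z = B * P + P * B - P * (B * P)"
        using Bc PBP Pc by (intro eq_matI) (auto simp del: index_mult_mat(1))
      have "frob_norm (B * P + P * B - P * (B * P)) \<le> frob_norm (B * P) + frob_norm (P * B) + frob_norm (P * (B * P))"
        using frob_norm_minus_le[of "B * P + P * B" n n "P * (B * P)"] frob_norm_add_le[OF PBP(2,3)] PBP by simp
      moreover have "frob_norm (P * B) = frob_norm (B * P)"
        using frob_norm_transpose[of "P * B"] transpose_mult[OF Pc(1) Bc] Pc BT by simp
      moreover have "frob_norm (P * (B * P)) \<le> frob_norm (B * P)" by (rule frob_proj_le[OF P(1) PBP(2)])
      ultimately show ?thesis unfolding BZ using BP by linarith
    qed
    moreover have "frob_norm (S' - S) \<le> frob_norm D1 + frob_norm D2 + frob_norm (B - Z)"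
      unfolding D using frob_norm_add_le[of "D1 + D2" n n "B - Z"] frob_norm_add_le[OF D12] D12 Bc Zc by simp
    ultimately show ?thesis unfolding b_def by linarith
  qed
  have Dc: "S' - S \<in> carrier_mat n n" using S by simp
  have bb: "frob_norm ((S' - S) * P) \<le> b" "frob_norm ((S' - S) * U) \<le> b"
    using frob_mult_proj_le[OF P(1) Dc] frob_mult_proj_le[OF U(1) Dc] bD by linarith+
  note pg = proj_gap[OF P U S S' ky_fan gap bb]
  show "frob_norm ((1\<^sub>m n - P) * (Q * Q\<^sup>T)) = frob_norm ((1\<^sub>m n - Q * Q\<^sup>T) * P)"
    using pg(1) by (simp only: U_def)
  show "kappa * frob_norm ((1\<^sub>m n - Q * Q\<^sup>T) * P)
      \<le> 2 * ((\<Sum>k\<in>insert 0 A. tau k * rho k) + 4 * (\<Sum>k\<in>A. tau k * eps))"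
    using pg(2) by (simp only: U_def b_def e_def)
qed

section \<open>Errors of loadings and factors\<close>

lemma mult_transpose_cols_split:
  assumes F: "F \<in> carrier_mat t r" and L: "L \<in> carrier_mat n r" and a: "a \<le> r"
  shows "F * L\<^sup>T = Defs.cols F 0 a * (Defs.cols L 0 a)\<^sup>T + Defs.cols F a r * (Defs.cols L a r)\<^sup>T"
proof (rule eq_matI)
  fix i j assume "i < dim_row (Defs.cols F 0 a * (Defs.cols L 0 a)\<^sup>T + Defs.cols F a r * (Defs.cols L a r)\<^sup>T)"
    "j < dim_col (Defs.cols F 0 a * (Defs.cols L 0 a)\<^sup>T + Defs.cols F a r * (Defs.cols L a r)\<^sup>T)"
  then have ij: "i < t" "j < n" using F L by (auto simp: Defs.cols_def)
  have LT: "L\<^sup>T \<in> carrier_mat r n" using L by simp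
  have c: "Defs.cols F 0 a \<in> carrier_mat t a" "(Defs.cols L 0 a)\<^sup>T \<in> carrier_mat a n"
    "Defs.cols F a r \<in> carrier_mat t (r - a)" "(Defs.cols L a r)\<^sup>T \<in> carrier_mat (r - a) n"
    using F L by (auto simp: Defs.cols_def)
  have "(F * L\<^sup>T) $$ (i,j) = (\<Sum>k<r. F $$ (i,k) * L $$ (j,k))"
    unfolding mult_mat_entry[OF F LT ij] using ij L by (intro sum.cong) auto
  also have "{..<r} = {..<a} \<union> {a..<r}" using a by auto
  also have "(\<Sum>k\<in>{..<a} \<union> {a..<r}. F $$ (i,k) * L $$ (j,k))
      = (\<Sum>k<a. F $$ (i,k) * L $$ (j,k)) + (\<Sum>k\<in>{a..<r}. F $$ (i,k) * L $$ (j,k))"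
    by (rule sum.union_disjoint) auto
  also have "(\<Sum>k\<in>{a..<r}. F $$ (i,k) * L $$ (j,k)) = (\<Sum>k<r - a. F $$ (i,a + k) * L $$ (j,a + k))"
    using a by (intro sum.reindex_bij_witness[of _ "\<lambda>k. a + k" "\<lambda>k. k - a"]) auto
  also have "(\<Sum>k<a. F $$ (i,k) * L $$ (j,k)) = (Defs.cols F 0 a * (Defs.cols L 0 a)\<^sup>T) $$ (i,j)"
    unfolding mult_mat_entry[OF c(1,2) ij] using ij F L by (intro sum.cong) (auto simp: Defs.cols_def)
  also have "(\<Sum>k<r - a. F $$ (i,a + k) * L $$ (j,a + k)) = (Defs.cols F a r * (Defs.cols L a r)\<^sup>T) $$ (i,j)"
    unfolding mult_mat_entry[OF c(3,4) ij] using ij F L by (intro sum.cong) (auto simp: Defs.cols_def)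
  finally show "(F * L\<^sup>T) $$ (i,j) = (Defs.cols F 0 a * (Defs.cols L 0 a)\<^sup>T + Defs.cols F a r * (Defs.cols L a r)\<^sup>T) $$ (i,j)"
    using ij c by simp
qed (use F L in \<open>auto simp: Defs.cols_def\<close>)

lemma frob_orthonormal:
  assumes "Q \<in> carrier_mat n s" "Q\<^sup>T * Q = 1\<^sub>m s"
  shows "frob_norm Q = sqrt (real s)"
proof -
  have "mip (Q * 1\<^sub>m s) Q = mip (1\<^sub>m s) (Q\<^sup>T * Q)" by (rule mip_mult_left[OF assms(1) _ assms(1)]) simp
  then have "mip Q Q = mip (1\<^sub>m s) (1\<^sub>m s)" using assms by simp
  also have "\<dots> = real s" using frob_norm_sq[of "1\<^sub>m s"] by (simp add: frob_norm_one)
  finally show ?thesis by (simp add: frob_norm_mip)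
qed

text \<open>Right multiplication by \<open>Q\<^sup>T\<close> preserves the Frobenius norm, so one
  error measures both the eigenvectors and their projection.\<close>

lemma frob_compl_orthonormal:
  assumes C: "C \<in> carrier_mat n n" and Q: "Q \<in> carrier_mat n s" "Q\<^sup>T * Q = 1\<^sub>m s"
  shows "frob_norm (C * Q) = frob_norm (C * (Q * Q\<^sup>T))"
proof -
  let ?Y = "C * Q"
  have Y: "?Y \<in> carrier_mat n s" and QT: "Q\<^sup>T \<in> carrier_mat s n" using C Q by auto
  have YQ: "?Y * Q\<^sup>T \<in> carrier_mat n n" using Y QT by simp
  have "mip (?Y * Q\<^sup>T) (?Y * Q\<^sup>T) = mip ?Y (?Y * Q\<^sup>T * Q)" using mip_mult_right[OF Y QT YQ] by simp
  also have "?Y * Q\<^sup>T * Q = ?Y" unfolding assoc_mult_mat[OF Y QT Q(1)] Q(2) by (rule right_mult_one_mat[OF Y])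
  finally have "frob_norm (?Y * Q\<^sup>T) = frob_norm ?Y" by (simp add: frob_norm_mip)
  then show ?thesis using assoc_mult_mat[OF C Q(1) QT] by simp
qed

text \<open>The constants in \<open>bigOp\<close> may depend on the exceptional probability, but the rotation may not;
  hence a case distinction on the observed matrix instead of a choice for each event.\<close>
definition rotation :: "nat \<Rightarrow> real Matrix.mat \<Rightarrow> (nat \<Rightarrow> real) \<Rightarrow> real Matrix.mat \<Rightarrow> real Matrix.mat" where
  "rotation s Lw d Q = (let W = Q\<^sup>T * scaled s Lw d in
     if W \<in> carrier_mat s s \<and> (\<forall>i<s. 0 < d i) \<and> frob_norm (W\<^sup>T * W - 1\<^sub>m s) \<le> 1/2
     then dmat s (\<lambda>i. 1 / sqrt (d i)) * inv_mat W * dmat s (\<lambda>i. sqrt (d i)) else 1\<^sub>m s)"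

lemma invertible_matI:
  assumes "A \<in> carrier_mat n n" "B \<in> carrier_mat n n" "A * B = 1\<^sub>m n"
  shows "invertible_mat (A :: real Matrix.mat)"
  using assms mat_mult_left_right_inverse[OF assms]
  by (auto simp: invertible_mat_def inverts_mat_def intro!: exI[of _ B])

text \<open>\<open>W\<close> may be close to any rotation, as eigenvectors can be rotated within a
  multiple eigenvalue or change sign; its Gram matrix is insensitive to this, and
  \<open>B * W\<^sup>T\<close> inverts \<open>W\<close>.\<close>

lemma gram_near_one_inverse:
  assumes W: "W \<in> carrier_mat s s" and near: "frob_norm (W\<^sup>T * W - 1\<^sub>m s) \<le> 1/2"
  shows "inv_mat W \<in> carrier_mat s s" "W * inv_mat W = 1\<^sub>m s" "inv_mat W * W = 1\<^sub>m s"
    "frob_norm (inv_mat W) \<le> 2 * sqrt (real s) * frob_norm W"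
proof -
  have WT: "W\<^sup>T \<in> carrier_mat s s" using W by simp
  have G: "W\<^sup>T * W \<in> carrier_mat s s" using W by simp
  obtain B where B: "B \<in> carrier_mat s s" "B * (W\<^sup>T * W) = 1\<^sub>m s" "frob_norm B \<le> 2 * sqrt (real s)"
    using near_one_inverse[OF G near] by metis
  have J: "B * W\<^sup>T \<in> carrier_mat s s" using B WT by simp
  have JW: "B * W\<^sup>T * W = 1\<^sub>m s" using assoc_mult_mat[OF B(1) WT W] B(2) by simp
  then have WJ: "W * (B * W\<^sup>T) = 1\<^sub>m s" by (rule mat_mult_left_right_inverse[OF J W])
  have i: "inv_mat W = B * W\<^sup>T" by (rule inv_mat_eqI[OF W J WJ])
  show "inv_mat W \<in> carrier_mat s s" "W * inv_mat W = 1\<^sub>m s" "inv_mat W * W = 1\<^sub>m s"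
    using J JW WJ by (simp_all only: i)
  have "frob_norm (B * W\<^sup>T) \<le> frob_norm B * frob_norm W" using frob_norm_mult_le[OF B(1) WT] by simp
  also have "\<dots> \<le> 2 * sqrt (real s) * frob_norm W" by (rule mult_right_mono[OF B(3)]) simp
  finally show "frob_norm (inv_mat W) \<le> 2 * sqrt (real s) * frob_norm W" by (simp add: i)
qed

text \<open>With \<open>V = scaled s Lw d\<close> and \<open>D\<close> the diagonal of the roots of
  \<open>d\<close>, \<open>Lw = V * D\<close>. Hence \<open>Lw\<close> times the rotation is
  \<open>V * inv_mat W * D\<close>, directly comparable with \<open>Q * D\<close>, and conjugation
  by the scales makes the inverse explicit.\<close>

lemma rotation_good:
  assumes W: "W = Q\<^sup>T * scaled s Lw d" "W \<in> carrier_mat s s" and d: "\<forall>i<s. 0 < d i"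
    and near: "frob_norm (W\<^sup>T * W - 1\<^sub>m s) \<le> 1/2"
  shows "rotation s Lw d Q = dmat s (\<lambda>i. 1 / sqrt (d i)) * inv_mat W * dmat s (\<lambda>i. sqrt (d i))" (is "_ = ?H")
    and "rotation s Lw d Q \<in> carrier_mat s s"
    and "rotation s Lw d Q * (dmat s (\<lambda>i. 1 / sqrt (d i)) * W * dmat s (\<lambda>i. sqrt (d i))) = 1\<^sub>m s"
proof -
  define D where "D = dmat s (\<lambda>i. sqrt (d i))"
  define D' where "D' = dmat s (\<lambda>i. 1 / sqrt (d i))"
  have D: "D \<in> carrier_mat s s" "D' \<in> carrier_mat s s" by (auto simp: D_def D'_def)
  have DD: "D' * D = 1\<^sub>m s" "D * D' = 1\<^sub>m s"
    unfolding D_def D'_def dmat_mult using d by (auto intro!: dmat_one)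
  note i = gram_near_one_inverse[OF W(2) near]
  show H: "rotation s Lw d Q = ?H" using W d near by (simp add: rotation_def Let_def)
  have H': "rotation s Lw d Q = D' * inv_mat W * D" using H by (simp add: D_def D'_def)
  have a: "D' * inv_mat W \<in> carrier_mat s s" "D' * W \<in> carrier_mat s s" using D i W by auto
  show "rotation s Lw d Q \<in> carrier_mat s s" unfolding H' by (rule mult_carrier_mat[OF a(1) D(1)])
  have "D' * inv_mat W * D * (D' * W * D) = D' * inv_mat W * (D * (D' * W * D))"
    by (rule assoc_mult_mat[OF a(1) D(1) mult_carrier_mat[OF a(2) D(1)]])
  also have "D * (D' * W * D) = D * (D' * W) * D" by (rule assoc_mult_mat[OF D(1) a(2) D(1), symmetric])
  also have "D * (D' * W) = W" using assoc_mult_mat[OF D(1,2) W(2)] DD W(2) by (metis left_mult_one_mat)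
  also have "D' * inv_mat W * (W * D) = D' * (inv_mat W * (W * D))"
    by (rule assoc_mult_mat[OF D(2) i(1) mult_carrier_mat[OF W(2) D(1)]])
  also have "inv_mat W * (W * D) = inv_mat W * W * D" by (rule assoc_mult_mat[OF i(1) W(2) D(1), symmetric])
  also have "\<dots> = D" using i(3) D by simp
  finally show "rotation s Lw d Q * (dmat s (\<lambda>i. 1 / sqrt (d i)) * W * dmat s (\<lambda>i. sqrt (d i))) = 1\<^sub>m s"
    using DD unfolding H' by (simp add: D_def D'_def)
qed

text \<open>Holds for every \<open>Q\<close>, also where the estimator is useless, because the
  fallback is the identity. The theorem asks for invertibility at every outcome.\<close>

lemma rotation_invertible: "rotation s Lw d Q \<in> carrier_mat s s \<and> invertible_mat (rotation s Lw d Q)"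
proof (cases "Q\<^sup>T * scaled s Lw d \<in> carrier_mat s s \<and> (\<forall>i<s. 0 < d i)
    \<and> frob_norm ((Q\<^sup>T * scaled s Lw d)\<^sup>T * (Q\<^sup>T * scaled s Lw d) - 1\<^sub>m s) \<le> 1/2")
  case True
  let ?W = "Q\<^sup>T * scaled s Lw d"
  have t: "?W \<in> carrier_mat s s" "\<forall>i<s. 0 < d i" "frob_norm (?W\<^sup>T * ?W - 1\<^sub>m s) \<le> 1/2" using True by auto
  note g = rotation_good[OF refl t]
  have "dmat s (\<lambda>i. 1 / sqrt (d i)) * ?W * dmat s (\<lambda>i. sqrt (d i)) \<in> carrier_mat s s"
    by (intro mult_carrier_mat[of _ s s] dmat_carrier t(1))
  then show ?thesis using g(2,3) invertible_matI by blast
next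
  case False
  then have "rotation s Lw d Q = 1\<^sub>m s" unfolding rotation_def Let_def by (rule if_not_P)
  then show ?thesis using invertible_matI[of "1\<^sub>m s" s "1\<^sub>m s"] by simp
qed

text \<open>If \<open>x\<close> is too large for the first case of \<open>rotation\<close>, the trivial bound is already of order \<open>x\<close>.\<close>
lemma weak_loading_error:
  assumes no: "near_on n s Lw d" and near4: "frob_norm ((scaled s Lw d)\<^sup>T * scaled s Lw d - 1\<^sub>m s) \<le> 1/4"
    and dmax: "\<And>i. i < s \<Longrightarrow> d i \<le> dmax" and s: "0 < s"
    and Q: "Q \<in> carrier_mat n s" "Q\<^sup>T * Q = 1\<^sub>m s"
    and x: "x = frob_norm ((1\<^sub>m n - Q * Q\<^sup>T) * proj Lw)"
  shows "frob_norm (Q * dmat s (\<lambda>i. sqrt (d i)) - Lw * rotation s Lw d Q) \<le> 12 * (real s)\<^sup>2 * sqrt dmax * x"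
    and "frob_norm ((Q\<^sup>T * scaled s Lw d)\<^sup>T * (Q\<^sup>T * scaled s Lw d) - 1\<^sub>m s) \<le> 1/2 \<or> 1 \<le> 3 * real s * x"
proof -
  define V where "V = scaled s Lw d"
  define W where "W = Q\<^sup>T * V"
  define R where "R = Q * Q\<^sup>T"
  define C where "C = 1\<^sub>m n - R"
  define D where "D = dmat s (\<lambda>i. sqrt (d i))"
  have L: "Lw \<in> carrier_mat n s" and dp: "\<forall>i<s. 0 < d i" using no by (auto simp: near_on_def)
  have V: "V \<in> carrier_mat n s" "V\<^sup>T \<in> carrier_mat s n" using L by (auto simp: V_def)
  have QT: "Q\<^sup>T \<in> carrier_mat s n" using Q by simp
  have W: "W \<in> carrier_mat s s" and WT: "W\<^sup>T \<in> carrier_mat s s" using V QT by (auto simp: W_def)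
  have D: "D \<in> carrier_mat s s" by (simp add: D_def)
  have dm: "0 \<le> sqrt dmax" "\<And>j. j < s \<Longrightarrow> \<bar>sqrt (d j)\<bar> \<le> sqrt dmax"
    using dmax dp s by (auto intro: less_imp_le order_trans[OF less_imp_le])
  note P = near_on_is_proj[OF no, folded V_def]
  have Pc: "proj Lw \<in> carrier_mat n n" using P(1) by (simp add: is_proj_def)
  note R = is_proj_orthonormal[OF Q, folded R_def]
  have R': "is_proj n C" unfolding C_def by (rule is_proj_compl[OF R(1)])
  have Rc: "R \<in> carrier_mat n n" "C \<in> carrier_mat n n" "C\<^sup>T = C" "C * C = C"
    using R(1) R' by (auto simp: is_proj_def)
  have x0: "0 \<le> x" unfolding x by simp
  have Vn: "frob_norm V \<le> sqrt (2 * real s)" using near_on_scaled_bound[OF no] by (simp add: V_def)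
  have RV: "C * V \<in> carrier_mat n s" using Rc V by simp
  have RVx: "frob_norm (C * V) \<le> x * sqrt (2 * real s)"
  proof -
    have "C * V = C * proj Lw * V"
      using assoc_mult_mat[OF Rc(2) Pc V(1)] P(3) by simp
    then have "frob_norm (C * V) \<le> frob_norm (C * proj Lw) * frob_norm V"
      using frob_norm_mult_le[of "C * proj Lw" n n V s] Rc Pc V by simp
    then show ?thesis using mult_left_mono[OF Vn x0] by (simp add: x R_def C_def)
  qed
  have QW: "Q * W = R * V" unfolding W_def R_def by (rule assoc_mult_mat[OF Q(1) QT V(1), symmetric])
  have RVe: "C * V = V - R * V"
    using minus_mult_distrib_mat[OF one_carrier_mat Rc(1) V(1)] V by (simp add: C_def)
  \<comment> \<open>Pythagoras: the part \<open>C * V\<close> of the scaled loadings missed by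
    \<open>Q\<close> accounts exactly for the difference of the two Gram matrices.\<close>
  have gram: "W\<^sup>T * W = V\<^sup>T * V - (C * V)\<^sup>T * (C * V)"
  proof -
    have "(C * V)\<^sup>T * (C * V) = V\<^sup>T * C * (C * V)"
      using transpose_mult[OF Rc(2) V(1)] Rc(3) by simp
    also have "\<dots> = V\<^sup>T * (C * (C * V))" by (rule assoc_mult_mat[OF V(2) Rc(2) RV])
    also have "C * (C * V) = C * V"
      using assoc_mult_mat[OF Rc(2) Rc(2) V(1)] Rc(4) by simp
    also have "V\<^sup>T * \<dots> = V\<^sup>T * V - V\<^sup>T * (R * V)"
      unfolding RVe by (rule mult_minus_distrib_mat[OF V(2,1)]) (use Rc V in simp)
    also have "V\<^sup>T * (R * V) = W\<^sup>T * W"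
    proof -
      have "W\<^sup>T * W = V\<^sup>T * Q * W" unfolding W_def using transpose_mult[OF QT V(1)] by simp
      also have "\<dots> = V\<^sup>T * (Q * W)" by (rule assoc_mult_mat[OF V(2) Q(1) W])
      finally show ?thesis using QW by simp
    qed
    finally show ?thesis using V W by (intro eq_matI) (auto simp del: index_mult_mat(1))
  qed
  have near_bound: "frob_norm (W\<^sup>T * W - 1\<^sub>m s) \<le> 1/4 + x\<^sup>2 * (2 * real s)"
  proof -
    let ?K = "(C * V)\<^sup>T * (C * V)"
    have K: "?K \<in> carrier_mat s s" and G: "V\<^sup>T * V - 1\<^sub>m s \<in> carrier_mat s s" using RV V by auto
    have "W\<^sup>T * W - 1\<^sub>m s = (V\<^sup>T * V - 1\<^sub>m s) - ?K" unfolding gram using V K by (intro eq_matI) (auto simp del: index_mult_mat(1))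
    then have "frob_norm (W\<^sup>T * W - 1\<^sub>m s) \<le> frob_norm (V\<^sup>T * V - 1\<^sub>m s) + frob_norm ?K"
      using frob_norm_minus_le[OF G K] by simp
    also have "frob_norm ?K \<le> frob_norm (C * V) * frob_norm (C * V)"
      using frob_norm_mult_le[of "(C * V)\<^sup>T" s n "C * V" s] RV by simp
    also have "\<dots> \<le> (x * sqrt (2 * real s)) * (x * sqrt (2 * real s))" by (intro mult_mono RVx) (auto simp: x0)
    also have "\<dots> = x\<^sup>2 * (2 * real s)" by (simp add: power2_eq_square)
    finally show ?thesis using near4 by (simp add: V_def)
  qed
  \<comment> \<open>The population defect takes 1/4 of the allowed 1/2. If
    \<open>3 * s * x < 1\<close>, then \<open>2 * s * x\<^sup>2 \<le> 1/4\<close>, and the sampling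
    error fits into the rest.\<close>
  show dich: "frob_norm ((Q\<^sup>T * scaled s Lw d)\<^sup>T * (Q\<^sup>T * scaled s Lw d) - 1\<^sub>m s) \<le> 1/2 \<or> 1 \<le> 3 * real s * x"
  proof (rule disjCI)
    assume "\<not> 1 \<le> 3 * real s * x"
    then have "3 * real s * x \<le> 1" by simp
    then have "(3 * real s * x)\<^sup>2 \<le> 1" using x0 by (simp add: power_le_one)
    then have "9 * (real s * (real s * x\<^sup>2)) \<le> 1" by (simp add: power2_eq_square mult_ac)
    moreover have "real s * x\<^sup>2 \<le> real s * (real s * x\<^sup>2)"
      using s mult_right_mono[of 1 "real s" "real s * x\<^sup>2"] by simp
    ultimately have "real s * x\<^sup>2 \<le> 1/8" by linarith
    then have "x\<^sup>2 * (2 * real s) \<le> 1/4" by (simp add: mult_ac)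
    then show "frob_norm ((Q\<^sup>T * scaled s Lw d)\<^sup>T * (Q\<^sup>T * scaled s Lw d) - 1\<^sub>m s) \<le> 1/2"
      using near_bound by (simp add: W_def V_def)
  qed
  have VD: "V * D = Lw" unfolding V_def D_def by (rule scaled_unscale[OF L dp])
  show "frob_norm (Q * dmat s (\<lambda>i. sqrt (d i)) - Lw * rotation s Lw d Q) \<le> 12 * (real s)\<^sup>2 * sqrt dmax * x"
  proof (cases "frob_norm (W\<^sup>T * W - 1\<^sub>m s) \<le> 1/2")
    case True
    note i = gram_near_one_inverse[OF W True]
    define D' where "D' = dmat s (\<lambda>i. 1 / sqrt (d i))"
    have D': "D' \<in> carrier_mat s s" by (simp add: D'_def)
    have DD: "D * D' = 1\<^sub>m s"
      unfolding D_def D'_def dmat_mult using dp by (auto intro!: dmat_one)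
    have H: "rotation s Lw d Q = D' * inv_mat W * D"
      unfolding D_def D'_def by (rule rotation_good(1)[OF _ W dp True]) (simp add: W_def V_def)
    have a: "D' * inv_mat W \<in> carrier_mat s s" using D' i by auto
    have VWi: "V * inv_mat W \<in> carrier_mat n s" using V i by auto
    have "Lw * rotation s Lw d Q = Lw * (D' * inv_mat W) * D"
      unfolding H by (rule assoc_mult_mat[OF L a D, symmetric])
    also have "Lw * (D' * inv_mat W) = V * (D * (D' * inv_mat W))"
      unfolding VD[symmetric] by (rule assoc_mult_mat[OF V(1) D a])
    also have "D * (D' * inv_mat W) = inv_mat W"
      using assoc_mult_mat[OF D D' i(1)] DD i(1) by (metis left_mult_one_mat)
    finally have LH: "Lw * rotation s Lw d Q = V * inv_mat W * D" .
    have "Q * D - Lw * rotation s Lw d Q = (Q - V * inv_mat W) * D"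
      unfolding LH by (rule minus_mult_distrib_mat[OF Q(1) VWi D, symmetric])
    \<comment> \<open>Since \<open>Q = R * V * inv_mat W\<close>, the error is the missed part
      \<open>C * V\<close> times a bounded inverse.\<close>
    also have "Q - V * inv_mat W = (R * V - V) * inv_mat W"
    proof -
      have RVc: "R * V \<in> carrier_mat n s" using Rc V by simp
      have "R * V * inv_mat W = Q * (W * inv_mat W)" unfolding QW[symmetric] by (rule assoc_mult_mat[OF Q(1) W i(1)])
      then have "R * V * inv_mat W = Q" using i(2) Q by simp
      then show ?thesis using minus_mult_distrib_mat[OF RVc V(1) i(1)] by simp
    qed
    also have "R * V - V = (- 1) \<cdot>\<^sub>m (C * V)"
      unfolding RVe using Rc V by (intro eq_matI) (auto simp del: index_mult_mat(1))
    finally have "frob_norm (Q * D - Lw * rotation s Lw d Q) = frob_norm (((- 1) \<cdot>\<^sub>m (C * V)) * inv_mat W * D)" by simp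
    also have "\<dots> \<le> sqrt dmax * frob_norm (((- 1) \<cdot>\<^sub>m (C * V)) * inv_mat W)"
      unfolding D_def by (rule frob_mult_dmat_le[OF _ dm]) (use RV i in auto)
    also have "\<dots> \<le> sqrt dmax * (x * sqrt (2 * real s) * (2 * sqrt (real s) * (sqrt (real s) * sqrt (2 * real s))))"
    proof (rule mult_left_mono[OF _ dm(1)])
      have "frob_norm (((- 1) \<cdot>\<^sub>m (C * V)) * inv_mat W) \<le> frob_norm ((- 1) \<cdot>\<^sub>m (C * V)) * frob_norm (inv_mat W)"
        by (rule frob_norm_mult_le[OF smult_carrier_mat[OF RV] i(1)])
      also have "\<dots> = frob_norm (C * V) * frob_norm (inv_mat W)" by (simp add: frob_norm_smult)
      also have "\<dots> \<le> (x * sqrt (2 * real s)) * (2 * sqrt (real s) * (sqrt (real s) * sqrt (2 * real s)))"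
      proof (rule mult_mono[OF RVx])
        have "frob_norm W \<le> frob_norm Q * frob_norm V" unfolding W_def using frob_norm_mult_le[OF QT V(1)] by simp
        also have "\<dots> \<le> sqrt (real s) * sqrt (2 * real s)"
          using Vn frob_orthonormal[OF Q] by (simp add: mult_left_mono)
        finally have "2 * sqrt (real s) * frob_norm W \<le> 2 * sqrt (real s) * (sqrt (real s) * sqrt (2 * real s))"
          by (intro mult_left_mono) auto
        then show "frob_norm (inv_mat W) \<le> 2 * sqrt (real s) * (sqrt (real s) * sqrt (2 * real s))" using i(4) by linarith
      qed (auto simp: x0)
      finally show "frob_norm (((- 1) \<cdot>\<^sub>m (C * V)) * inv_mat W)
          \<le> x * sqrt (2 * real s) * (2 * sqrt (real s) * (sqrt (real s) * sqrt (2 * real s)))" .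
    qed
    also have "\<dots> = 4 * (real s)\<^sup>2 * sqrt dmax * x"
    proof -
      have "sqrt (2 * real s) * (2 * sqrt (real s) * (sqrt (real s) * sqrt (2 * real s)))
          = 2 * (sqrt (2 * real s) * sqrt (2 * real s)) * (sqrt (real s) * sqrt (real s))" by (simp only: mult_ac)
      also have "\<dots> = 4 * (real s)\<^sup>2" by (simp add: power2_eq_square)
      finally have e: "sqrt (2 * real s) * (2 * sqrt (real s) * (sqrt (real s) * sqrt (2 * real s))) = 4 * (real s)\<^sup>2" .
      have "sqrt dmax * (x * sqrt (2 * real s) * (2 * sqrt (real s) * (sqrt (real s) * sqrt (2 * real s))))
          = sqrt dmax * (x * (sqrt (2 * real s) * (2 * sqrt (real s) * (sqrt (real s) * sqrt (2 * real s)))))"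
        by (simp only: mult_ac)
      then show ?thesis unfolding e by simp
    qed
    also have "\<dots> \<le> 12 * (real s)\<^sup>2 * sqrt dmax * x" using x0 dm(1) by (intro mult_right_mono) auto
    finally show ?thesis by (simp add: D_def)
  next
    case False
    \<comment> \<open>Fallback: bounding the two matrices separately gives
      \<open>4 * s * sqrt dmax\<close>, and the factor \<open>3 * s * x\<close>, which is at least 1
      here, raises it to the stated constant.\<close>
    then have H: "rotation s Lw d Q = 1\<^sub>m s" by (simp add: rotation_def Let_def W_def V_def)
    have x1: "1 \<le> 3 * real s * x" using dich False by (simp add: W_def V_def)
    have QD: "Q * D \<in> carrier_mat n s" using Q D by simp
    have "frob_norm (Q * D - Lw * rotation s Lw d Q) \<le> frob_norm (Q * D) + frob_norm (V * D)"
      using frob_norm_minus_le[OF QD L] H L VD by simp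
    also have "\<dots> \<le> sqrt dmax * frob_norm Q + sqrt dmax * frob_norm V"
      unfolding D_def by (intro add_mono frob_mult_dmat_le[OF Q(1) dm] frob_mult_dmat_le[OF V(1) dm])
    also have "\<dots> \<le> sqrt dmax * (4 * real s)"
    proof -
      have "sqrt (real s) \<le> real s" using s by (intro real_le_lsqrt) (auto simp: power2_eq_square)
      moreover have "sqrt (2 * real s) \<le> 2 * real s" using s by (intro real_le_lsqrt) (auto simp: power2_eq_square)
      ultimately have "frob_norm Q + frob_norm V \<le> 4 * real s" using Vn frob_orthonormal[OF Q] by linarith
      then show ?thesis using mult_left_mono[OF _ dm(1)] by (simp add: distrib_left[symmetric])
    qed
    also have "\<dots> \<le> sqrt dmax * (4 * real s) * (3 * real s * x)"
      using mult_left_mono[OF x1, of "sqrt dmax * (4 * real s)"] dm(1) by simp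
    also have "\<dots> = 12 * (real s)\<^sup>2 * sqrt dmax * x" unfolding power2_eq_square by simp
    finally show ?thesis by (simp add: D_def)
  qed
qed

text \<open>With the good rotation the error is \<open>(Fs * Ls\<^sup>T + E) * Q * D'\<close>.
  Splitting \<open>Q\<close> along \<open>proj Lw\<close>, to which \<open>Ls\<close> is orthogonal,
  leaves the strong component only the misplaced part of norm \<open>x\<close>; the noise on
  \<open>proj Lw\<close> is traded for \<open>E * scaled r L d0\<close>, which (A4) controls. The
  summand \<open>3 * s * frob_norm F * x\<close> pays for the fallback rotation.\<close>

lemma weak_factor_error:
  assumes no0: "near_on n r L d0" and s: "0 < s" "s \<le> r"
    and Lw: "Lw = Defs.cols L (r - s) r" and Ls: "Ls = Defs.cols L 0 (r - s)"
    and d: "d = (\<lambda>i. d0 (r - s + i))"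
    and near4: "frob_norm ((scaled s Lw d)\<^sup>T * scaled s Lw d - 1\<^sub>m s) \<le> 1/4"
    and orth: "proj Ls * proj Lw = 0\<^sub>m n n"
    and dmin: "0 < dmin" "\<And>i. i < s \<Longrightarrow> dmin \<le> d i"
    and Q: "Q \<in> carrier_mat n s" "Q\<^sup>T * Q = 1\<^sub>m s"
    and x: "x = frob_norm ((1\<^sub>m n - Q * Q\<^sup>T) * proj Lw)" "x = frob_norm ((1\<^sub>m n - proj Lw) * (Q * Q\<^sup>T))"
    and F: "F \<in> carrier_mat t r" and E: "E \<in> carrier_mat t n"
  shows "frob_norm (panel F L E * (Q * dmat s (\<lambda>i. sqrt (d i))) * dmat s (\<lambda>i. 1 / d i)
        - Defs.cols F (r - s) r * (inv_mat (rotation s Lw d Q))\<^sup>T)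
      \<le> 1 / sqrt dmin * (3 * real s * sqrt (real s) * (frob_norm F * frob_norm L + spec_norm E) * x
          + 3 * real s * sqrt (real s) * frob_norm (E * scaled r L d0))
        + 3 * real s * frob_norm F * x"
proof -
  define V where "V = scaled s Lw d"
  define W where "W = Q\<^sup>T * V"
  define P where "P = proj Lw"
  define C where "C = 1\<^sub>m n - P"
  define D where "D = dmat s (\<lambda>i. sqrt (d i))"
  define D' where "D' = dmat s (\<lambda>i. 1 / sqrt (d i))"
  define Fw where "Fw = Defs.cols F (r - s) r"
  define Fs where "Fs = Defs.cols F 0 (r - s)"
  define X where "X = panel F L E"
  have L: "L \<in> carrier_mat n r" using no0 by (auto simp: near_on_def)
  have no: "near_on n s Lw d" using near_on_cols(1)[OF no0, of "r - s" r] s by (simp add: Lw d)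
  have nos: "near_on n (r - s) Ls d0" using near_on_cols(1)[OF no0, of 0 "r - s"] by (simp add: Ls)
  have Lwc: "Lw \<in> carrier_mat n s" "Lw\<^sup>T \<in> carrier_mat s n" and dp: "\<forall>i<s. 0 < d i" using no by (auto simp: near_on_def)
  have Lsc: "Ls \<in> carrier_mat n (r - s)" "Ls\<^sup>T \<in> carrier_mat (r - s) n" using nos by (auto simp: near_on_def)
  have V: "V \<in> carrier_mat n s" "V\<^sup>T \<in> carrier_mat s n" using Lwc by (auto simp: V_def)
  have QT: "Q\<^sup>T \<in> carrier_mat s n" using Q by simp
  have W: "W \<in> carrier_mat s s" "W\<^sup>T \<in> carrier_mat s s" using V QT by (auto simp: W_def)
  have D: "D \<in> carrier_mat s s" "D' \<in> carrier_mat s s" by (simp_all add: D_def D'_def)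
  have Fc: "Fw \<in> carrier_mat t s" "Fs \<in> carrier_mat t (r - s)"
    using cols_carrier[OF F, of "r - s" r] cols_carrier[OF F, of 0 "r - s"] s by (simp_all add: Fw_def Fs_def)
  have FL: "F * L\<^sup>T \<in> carrier_mat t n" using F L by simp
  have X: "X \<in> carrier_mat t n" using FL E by (simp add: X_def panel_def)
  have Fwn: "frob_norm Fw \<le> frob_norm F" and Fsn: "frob_norm Fs \<le> frob_norm F"
    unfolding Fw_def Fs_def by (rule frob_cols_le[OF F]; simp)+
  have Lsn: "frob_norm Ls \<le> frob_norm L" unfolding Ls by (rule frob_cols_le[OF L]) auto
  note P = near_on_is_proj[OF no, folded P_def]
  have Pc: "P \<in> carrier_mat n n" "P\<^sup>T = P" using P(1) by (auto simp: is_proj_def)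
  have C: "C \<in> carrier_mat n n" using Pc by (simp add: C_def)
  have x0: "0 \<le> x" using x(1) by simp
  have Qn: "frob_norm Q = sqrt (real s)" by (rule frob_orthonormal[OF Q])
  have CQ: "C * Q \<in> carrier_mat n s" and CQx: "frob_norm (C * Q) = x"
    using C Q frob_compl_orthonormal[OF C Q] x(2) by (simp_all add: C_def P_def)
  have PQ: "P * Q \<in> carrier_mat n s" using Pc Q by simp
  have Qdec: "Q = P * Q + C * Q"
    unfolding C_def using minus_mult_distrib_mat[OF one_carrier_mat Pc(1) Q(1)] Q Pc
    by (intro eq_matI) (auto simp del: index_mult_mat(1))
  have sc: "\<bar>1 / sqrt (d j)\<bar> \<le> 1 / sqrt dmin" if "j < s" for j
    using dmin(2)[OF that] dmin(1) by (simp add: frac_le)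
  have sc0: "0 \<le> 1 / sqrt dmin" using dmin by simp
  \<comment> \<open>The estimator multiplies by \<open>sqrt (d i)\<close> and divides by
    \<open>d i\<close>, so only \<open>1 / sqrt (d i)\<close> survives.\<close>
  have est: "X * (Q * dmat s (\<lambda>i. sqrt (d i))) * dmat s (\<lambda>i. 1 / d i) = X * Q * D'"
  proof -
    have "Q * D \<in> carrier_mat n s" "X * Q \<in> carrier_mat t s" using Q D X by auto
    have "X * (Q * D) = X * Q * D" by (rule assoc_mult_mat[OF X Q(1) D(1), symmetric])
    moreover have "X * Q * D * dmat s (\<lambda>i. 1 / d i) = X * Q * (D * dmat s (\<lambda>i. 1 / d i))"
      by (rule assoc_mult_mat[OF \<open>X * Q \<in> carrier_mat t s\<close> D(1) dmat_carrier])
    moreover have "D * dmat s (\<lambda>i. 1 / d i) = D'"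
    proof -
      have "sqrt (d i) * (1 / d i) = 1 / sqrt (d i)" if "i < s" for i
      proof -
        have "0 < d i" using dp that by simp
        then have "d i = sqrt (d i) * sqrt (d i)" "0 < sqrt (d i)" by simp_all
        then show ?thesis by (metis divide_divide_eq_left' mult.right_neutral nonzero_divide_mult_cancel_left order_less_irrefl times_divide_eq_right)
      qed
      then show ?thesis unfolding D_def D'_def dmat_mult by (intro eq_matI) (auto simp: dmat_def)
    qed
    ultimately show ?thesis by (simp add: D_def)
  qed
  let ?err = "frob_norm (X * Q * D' - Fw * (inv_mat (rotation s Lw d Q))\<^sup>T)"
  define q where "q = frob_norm F * frob_norm L + spec_norm E"
  define y where "y = frob_norm (E * scaled r L d0)"
  have q0: "0 \<le> q" and y0: "0 \<le> y" by (simp_all add: q_def y_def)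
  have s1: "1 \<le> 3 * real s * sqrt (real s)"
    using s mult_mono[of 1 "3 * real s" 1 "sqrt (real s)"] by simp
  have goal: "?err \<le> 1 / sqrt dmin * (3 * real s * sqrt (real s) * q * x + 3 * real s * sqrt (real s) * y)
        + 3 * real s * frob_norm F * x"
  proof (cases "frob_norm (W\<^sup>T * W - 1\<^sub>m s) \<le> 1/2")
    case True
    note H = rotation_good[OF W_def[unfolded V_def] W(1) dp True, folded D_def D'_def]
    have D'W: "D' * W \<in> carrier_mat s s" using D W by simp
    have J: "D' * W * D \<in> carrier_mat s s" by (rule mult_carrier_mat[OF D'W D(1)])
    have "inv_mat (rotation s Lw d Q) = D' * W * D" by (rule inv_mat_eqI[OF H(2) J H(3)])
    then have "(inv_mat (rotation s Lw d Q))\<^sup>T = D * (W\<^sup>T * D')"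
      using transpose_mult[OF D'W D(1)] transpose_mult[OF D(2) W(1)] by (simp add: D_def D'_def)
    also have "\<dots> = D * W\<^sup>T * D'" by (rule assoc_mult_mat[OF D(1) W(2) D(2), symmetric])
    also have "D * W\<^sup>T = Lw\<^sup>T * Q"
    proof -
      have "Lw = V * D" unfolding V_def D_def by (rule scaled_unscale[OF Lwc(1) dp, symmetric])
      then have "Lw\<^sup>T = D * V\<^sup>T" using transpose_mult[OF V(1) D(1)] by (simp add: D_def)
      moreover have "W\<^sup>T = V\<^sup>T * Q" unfolding W_def using transpose_mult[OF QT V(1)] by simp
      ultimately show ?thesis using assoc_mult_mat[OF D(1) V(2) Q(1)] by simp
    qed
    finally have Hi: "(inv_mat (rotation s Lw d Q))\<^sup>T = Lw\<^sup>T * Q * D'" .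
    have LQ: "Lw\<^sup>T * Q \<in> carrier_mat s s" and FwL: "Fw * Lw\<^sup>T \<in> carrier_mat t n" and XQ: "X * Q \<in> carrier_mat t s"
      using Lwc Q Fc X by auto
    have "Fw * (Lw\<^sup>T * Q * D') = Fw * Lw\<^sup>T * Q * D'"
      using assoc_mult_mat[OF Fc(1) LQ D(2)] assoc_mult_mat[OF Fc(1) Lwc(2) Q(1)] by simp
    then have "X * Q * D' - Fw * (inv_mat (rotation s Lw d Q))\<^sup>T = (X - Fw * Lw\<^sup>T) * Q * D'"
      using Hi minus_mult_distrib_mat[OF XQ mult_carrier_mat[OF FwL Q(1)] D(2)] minus_mult_distrib_mat[OF X FwL Q(1)] by simp
    also have "X - Fw * Lw\<^sup>T = Fs * Ls\<^sup>T + E"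
      unfolding X_def panel_def mult_transpose_cols_split[OF F L, of "r - s", simplified] Fw_def[symmetric] Fs_def[symmetric] Lw[symmetric] Ls[symmetric]
      using Fc Lsc Lwc E by (intro eq_matI) (auto simp del: index_mult_mat(1))
    finally have e: "X * Q * D' - Fw * (inv_mat (rotation s Lw d Q))\<^sup>T = (Fs * Ls\<^sup>T + E) * Q * D'" .
    have FsL: "Fs * Ls\<^sup>T \<in> carrier_mat t n" using Fc Lsc by simp
    have EQ: "E * Q \<in> carrier_mat t s" using E Q by simp
    have a1: "?err \<le> 1 / sqrt dmin * frob_norm ((Fs * Ls\<^sup>T + E) * Q)"
      unfolding e unfolding D'_def by (rule frob_mult_dmat_le[OF mult_carrier_mat[OF add_carrier_mat[OF E] Q(1)] sc0 sc])
    have "(Fs * Ls\<^sup>T + E) * Q = Fs * Ls\<^sup>T * Q + E * Q" by (rule add_mult_distrib_mat[OF FsL E Q(1)])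
    then have a2: "frob_norm ((Fs * Ls\<^sup>T + E) * Q) \<le> frob_norm (Fs * Ls\<^sup>T * Q) + frob_norm (E * Q)"
      by (simp only:) (rule frob_norm_add_le[OF mult_carrier_mat[OF FsL Q(1)] EQ])
    have a3: "frob_norm (Fs * Ls\<^sup>T * Q) \<le> frob_norm F * frob_norm L * x"
    proof -
      \<comment> \<open>\<open>Ls\<close> is fixed by its own projection, which is orthogonal to
        \<open>P\<close>.\<close>
      have LsP: "Ls\<^sup>T * P = 0\<^sub>m (r - s) n"
      proof -
        note S = near_on_is_proj[OF nos]
        have Sc: "proj Ls \<in> carrier_mat n n" "(proj Ls)\<^sup>T = proj Ls" using S(1) by (auto simp: is_proj_def)
        have "Ls\<^sup>T = Ls\<^sup>T * proj Ls" using S(4) transpose_mult[OF Sc(1) Lsc(1)] Sc(2) by simp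
        then have "Ls\<^sup>T * P = Ls\<^sup>T * (proj Ls * P)" using assoc_mult_mat[OF Lsc(2) Sc(1) Pc(1)] by simp
        then show ?thesis using orth Lsc by (simp add: P_def)
      qed
      have LsQ: "Ls\<^sup>T * Q = Ls\<^sup>T * (C * Q)"
      proof -
        have "Ls\<^sup>T * (P * Q) = 0\<^sub>m (r - s) s" using assoc_mult_mat[OF Lsc(2) Pc(1) Q(1)] LsP Q by simp
        moreover have "Ls\<^sup>T * Q = Ls\<^sup>T * (P * Q) + Ls\<^sup>T * (C * Q)"
          by (subst Qdec) (rule mult_add_distrib_mat[OF Lsc(2) PQ CQ])
        moreover have "Ls\<^sup>T * (C * Q) \<in> carrier_mat (r - s) s" by (rule mult_carrier_mat[OF Lsc(2) CQ])
        ultimately show ?thesis using left_add_zero_mat by metis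
      qed
      have "Fs * Ls\<^sup>T * Q = Fs * Ls\<^sup>T * (C * Q)"
        using assoc_mult_mat[OF Fc(2) Lsc(2) Q(1)] assoc_mult_mat[OF Fc(2) Lsc(2) CQ] LsQ by simp
      then have "frob_norm (Fs * Ls\<^sup>T * Q) \<le> frob_norm (Fs * Ls\<^sup>T) * x"
        using frob_norm_mult_le[OF FsL CQ] CQx by simp
      also have "\<dots> \<le> (frob_norm F * frob_norm L) * x"
      proof (rule mult_right_mono[OF _ x0])
        have "frob_norm (Fs * Ls\<^sup>T) \<le> frob_norm Fs * frob_norm Ls" using frob_norm_mult_le[OF Fc(2) Lsc(2)] by simp
        also have "\<dots> \<le> frob_norm F * frob_norm L" by (intro mult_mono Fsn Lsn) auto
        finally show "frob_norm (Fs * Ls\<^sup>T) \<le> frob_norm F * frob_norm L" .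
      qed
      finally show ?thesis .
    qed
    have a4: "frob_norm (E * Q) \<le> 3 * real s * sqrt (real s) * y + spec_norm E * x"
    proof -
      have EP: "E * P \<in> carrier_mat t n" using E Pc by simp
      have "E * Q = E * (P * Q) + E * (C * Q)" by (subst Qdec) (rule mult_add_distrib_mat[OF E PQ CQ])
      then have "frob_norm (E * Q) \<le> frob_norm (E * (P * Q)) + frob_norm (E * (C * Q))"
        using frob_norm_add_le[OF mult_carrier_mat[OF E PQ] mult_carrier_mat[OF E CQ]] by simp
      moreover have "frob_norm (E * (C * Q)) \<le> spec_norm E * x" using frob_norm_mult_le_spec[OF E CQ] CQx by simp
      moreover have "frob_norm (E * (P * Q)) \<le> 3 * real s * sqrt (real s) * y"
      proof -
        have "frob_norm (E * (P * Q)) \<le> frob_norm (E * P) * sqrt (real s)"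
          using frob_norm_mult_le[OF EP Q(1)] assoc_mult_mat[OF E Pc(1) Q(1)] Qn by simp
        also have "\<dots> \<le> (3 * real s * frob_norm (E * V)) * sqrt (real s)"
          using P(5)[OF E] by (intro mult_right_mono) (auto simp: V_def)
        also have "\<dots> \<le> (3 * real s * y) * sqrt (real s)"
        proof (intro mult_right_mono mult_left_mono)
          \<comment> \<open>The scaled weak loadings are the last columns of all scaled loadings, so
            their noise is part of the noise in (A4).\<close>
          have "V = Defs.cols (scaled r L d0) (r - s) r"
            unfolding V_def Lw d using scaled_cols[OF L, of "r - s" r d0] s by simp
          then have "E * V = Defs.cols (E * scaled r L d0) (r - s) r"
            using mult_cols[OF E scaled_carrier[OF L], of r d0 "r - s"] by simp
          then show "frob_norm (E * V) \<le> y"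
            unfolding y_def using frob_cols_le[OF mult_carrier_mat[OF E scaled_carrier[OF L]], of "r - s" r d0] by simp
        qed auto
        finally show ?thesis by (simp add: mult_ac)
      qed
      ultimately show ?thesis by linarith
    qed
    have "frob_norm ((Fs * Ls\<^sup>T + E) * Q) \<le> q * x + 3 * real s * sqrt (real s) * y"
      using a2 a3 a4 by (simp add: q_def distrib_right)
    then have "?err \<le> 1 / sqrt dmin * (q * x + 3 * real s * sqrt (real s) * y)"
      by (rule order_trans[OF a1 mult_left_mono[OF _ sc0]])
    also have "\<dots> \<le> 1 / sqrt dmin * (3 * real s * sqrt (real s) * q * x + 3 * real s * sqrt (real s) * y)"
    proof (intro mult_left_mono[OF _ sc0] add_mono)
      show "q * x \<le> 3 * real s * sqrt (real s) * q * x"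
        using mult_right_mono[OF s1, of "q * x"] q0 x0 by (simp add: mult_ac)
    qed simp
    finally show ?thesis using x0 by (simp add: add_increasing2)
  next
    case False
    \<comment> \<open>With the identity as rotation, estimator and factors are bounded separately
      and \<open>1 \<le> 3 * s * x\<close> is multiplied in.\<close>
    then have H: "rotation s Lw d Q = 1\<^sub>m s" by (simp add: rotation_def Let_def W_def V_def)
    have x1: "1 \<le> 3 * real s * x"
    proof -
      have "frob_norm ((Q\<^sup>T * scaled s Lw d)\<^sup>T * (Q\<^sup>T * scaled s Lw d) - 1\<^sub>m s) \<le> 1/2 \<or> 1 \<le> 3 * real s * x"
      proof (rule weak_loading_error(2)[OF no near4 _ s(1) Q x(1)])
        show "d i \<le> Max (d ` {..<s})" if "i < s" for i using that by (intro Max_ge) auto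
      qed
      then show ?thesis using False by (simp add: W_def V_def)
    qed
    have XQ: "X * Q \<in> carrier_mat t s" using X Q by simp
    have "inv_mat (1\<^sub>m s) = 1\<^sub>m s" by (rule inv_mat_eqI[of _ s]) auto
    then have b1: "?err \<le> frob_norm (X * Q * D') + frob_norm Fw"
      using frob_norm_minus_le[OF mult_carrier_mat[OF XQ D(2)] Fc(1)] H Fc by simp
    have b2: "frob_norm (X * Q * D') \<le> 1 / sqrt dmin * frob_norm (X * Q)"
      unfolding D'_def by (rule frob_mult_dmat_le[OF XQ sc0 sc])
    have b3: "frob_norm (X * Q) \<le> q * sqrt (real s)"
    proof -
      have "X * Q = F * L\<^sup>T * Q + E * Q" unfolding X_def panel_def by (rule add_mult_distrib_mat[OF FL E Q(1)])
      then have "frob_norm (X * Q) \<le> frob_norm (F * L\<^sup>T * Q) + frob_norm (E * Q)"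
        using frob_norm_add_le[OF mult_carrier_mat[OF FL Q(1)] mult_carrier_mat[OF E Q(1)]] by simp
      moreover have "frob_norm (F * L\<^sup>T * Q) \<le> frob_norm F * frob_norm L * sqrt (real s)"
      proof -
        have "frob_norm (F * L\<^sup>T) \<le> frob_norm F * frob_norm L" using frob_norm_mult_le[OF F, of "L\<^sup>T" n] L by simp
        then have "frob_norm (F * L\<^sup>T) * sqrt (real s) \<le> frob_norm F * frob_norm L * sqrt (real s)"
          by (rule mult_right_mono) simp
        then show ?thesis using frob_norm_mult_le[OF FL Q(1)] unfolding Qn by linarith
      qed
      moreover have "frob_norm (E * Q) \<le> spec_norm E * sqrt (real s)" using frob_norm_mult_le_spec[OF E Q(1)] Qn by simp
      ultimately show ?thesis by (simp add: q_def algebra_simps)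
    qed
    have "?err \<le> 1 / sqrt dmin * (q * sqrt (real s)) + frob_norm F"
      using b1 b2 mult_left_mono[OF b3 sc0] Fwn by linarith
    also have "\<dots> \<le> (1 / sqrt dmin * (q * sqrt (real s)) + frob_norm F) * (3 * real s * x)"
      using mult_left_mono[OF x1, of "1 / sqrt dmin * (q * sqrt (real s)) + frob_norm F"] sc0 q0 by simp
    also have "\<dots> \<le> 1 / sqrt dmin * (3 * real s * sqrt (real s) * q * x + 3 * real s * sqrt (real s) * y)
        + 3 * real s * frob_norm F * x"
      using mult_nonneg_nonneg[OF sc0, of "3 * real s * sqrt (real s) * y"] y0 by (simp add: algebra_simps)
    finally show ?thesis .
  qed
  show ?thesis using goal unfolding X_def[symmetric] est by (simp add: Fw_def q_def y_def)
qed

section \<open>Bounds in probability\<close>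

text \<open>\<open>bigOp\<close> with a predicate in place of the inequality, so that many bounds
  can share one constant and one event. A predicate that ignores the constant expresses a bound at
  fixed precision.\<close>

definition whp :: "(nat \<Rightarrow> 'a measure) \<Rightarrow> (real \<Rightarrow> nat \<Rightarrow> 'a \<Rightarrow> bool) \<Rightarrow> bool" where
  "whp M P \<longleftrightarrow> (\<forall>\<delta>>0. \<exists>C n0. \<forall>n\<ge>n0. \<exists>E\<in>sets (M n). measure (M n) E \<ge> 1 - \<delta> \<and> (\<forall>\<omega>\<in>E. P C n \<omega>))"

text \<open>Conjunctions replace two constants by their maximum, which requires monotonicity in the
  constant.\<close>

definition increasing :: "(real \<Rightarrow> nat \<Rightarrow> 'a \<Rightarrow> bool) \<Rightarrow> bool" where
  "increasing P \<longleftrightarrow> (\<forall>C C' n \<omega>. C \<le> C' \<longrightarrow> P C n \<omega> \<longrightarrow> P C' n \<omega>)"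

lemma bigOp_whp: "bigOp M X a \<longleftrightarrow> whp M (\<lambda>C n \<omega>. \<bar>X n \<omega>\<bar> \<le> C * a n)"
  by (simp add: bigOp_def whp_def)

lemma to_zero_whp: "to_zero_in_prob M Z \<Longrightarrow> 0 < \<eta> \<Longrightarrow> whp M (\<lambda>C n \<omega>. \<bar>Z n \<omega>\<bar> \<le> \<eta>)"
  unfolding to_zero_in_prob_def whp_def by blast

lemma prob_Int_ge:
  assumes "prob_space M" "E1 \<in> sets M" "E2 \<in> sets M" "measure M E1 \<ge> 1 - a" "measure M E2 \<ge> 1 - b"
  shows "measure M (E1 \<inter> E2) \<ge> 1 - (a + b)"
proof -
  interpret prob_space M by fact
  have "measure M (E1 - E2) = measure M E1 - measure M (E1 \<inter> E2)"
    using finite_measure_Diff' assms(2,3) by simp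
  moreover have "measure M (E1 - E2) \<le> measure M (space M - E2)"
    by (rule finite_measure_mono) (use assms(2,3) sets.sets_into_space in auto)
  moreover have "measure M (space M - E2) = 1 - measure M E2" by (rule prob_compl[OF assms(3)])
  ultimately show ?thesis using assms(4,5) by linarith
qed

text \<open>Each event receives half of the exceptional probability.\<close>

lemma whp_conj:
  assumes prob: "\<And>n. prob_space (M n)" and P: "whp M P" "increasing P" and Q: "whp M Q" "increasing Q"
  shows "whp M (\<lambda>C n \<omega>. P C n \<omega> \<and> Q C n \<omega>)" and "increasing (\<lambda>C n \<omega>. P C n \<omega> \<and> Q C n \<omega>)"
proof -
  show "whp M (\<lambda>C n \<omega>. P C n \<omega> \<and> Q C n \<omega>)"
    unfolding whp_def
  proof (intro allI impI)
    fix \<delta> :: real assume "0 < \<delta>"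
    then have d: "0 < \<delta> / 2" by simp
    obtain C1 n1 where 1: "\<And>n. n \<ge> n1 \<Longrightarrow> \<exists>E\<in>sets (M n). measure (M n) E \<ge> 1 - \<delta>/2 \<and> (\<forall>\<omega>\<in>E. P C1 n \<omega>)"
      using P(1) d unfolding whp_def by blast
    obtain C2 n2 where 2: "\<And>n. n \<ge> n2 \<Longrightarrow> \<exists>E\<in>sets (M n). measure (M n) E \<ge> 1 - \<delta>/2 \<and> (\<forall>\<omega>\<in>E. Q C2 n \<omega>)"
      using Q(1) d unfolding whp_def by blast
    show "\<exists>C n0. \<forall>n\<ge>n0. \<exists>E\<in>sets (M n). measure (M n) E \<ge> 1 - \<delta> \<and> (\<forall>\<omega>\<in>E. P C n \<omega> \<and> Q C n \<omega>)"
    proof (intro exI allI impI)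
      fix n assume n: "max n1 n2 \<le> n"
      obtain E1 where E1: "E1 \<in> sets (M n)" "measure (M n) E1 \<ge> 1 - \<delta>/2" "\<forall>\<omega>\<in>E1. P C1 n \<omega>" using 1 n by auto
      obtain E2 where E2: "E2 \<in> sets (M n)" "measure (M n) E2 \<ge> 1 - \<delta>/2" "\<forall>\<omega>\<in>E2. Q C2 n \<omega>" using 2 n by auto
      have "measure (M n) (E1 \<inter> E2) \<ge> 1 - \<delta>" using prob_Int_ge[OF prob E1(1) E2(1) E1(2) E2(2)] by simp
      moreover have "\<forall>\<omega>\<in>E1 \<inter> E2. P (max C1 C2) n \<omega> \<and> Q (max C1 C2) n \<omega>"
        using E1(3) E2(3) P(2) Q(2) unfolding increasing_def by (meson IntD1 IntD2 max.cobounded1 max.cobounded2)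
      ultimately show "\<exists>E\<in>sets (M n). measure (M n) E \<ge> 1 - \<delta> \<and> (\<forall>\<omega>\<in>E. P (max C1 C2) n \<omega> \<and> Q (max C1 C2) n \<omega>)"
        using E1(1) E2(1) by blast
    qed
  qed
  show "increasing (\<lambda>C n \<omega>. P C n \<omega> \<and> Q C n \<omega>)" using P(2) Q(2) unfolding increasing_def by blast
qed

lemma whp_ball:
  assumes prob: "\<And>n. prob_space (M n)" and I: "finite I"
    and P: "\<And>k. k \<in> I \<Longrightarrow> whp M (P k)" "\<And>k. k \<in> I \<Longrightarrow> increasing (P k)"
  shows "whp M (\<lambda>C n \<omega>. \<forall>k\<in>I. P k C n \<omega>) \<and> increasing (\<lambda>C n \<omega>. \<forall>k\<in>I. P k C n \<omega>)"
  using I P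
proof (induction I rule: finite_induct)
  case empty
  have "\<exists>E\<in>sets (M n). measure (M n) E \<ge> 1 - \<delta>" if "0 < \<delta>" for \<delta> n
    using prob_space.prob_space[OF prob] that by (intro bexI[of _ "space (M n)"]) auto
  then show ?case by (simp add: whp_def increasing_def)
next
  case (insert k I)
  have "whp M (\<lambda>C n \<omega>. P k C n \<omega> \<and> (\<forall>k\<in>I. P k C n \<omega>))" "increasing (\<lambda>C n \<omega>. P k C n \<omega> \<and> (\<forall>k\<in>I. P k C n \<omega>))"
    using insert by (auto intro!: whp_conj prob)
  then show ?case by simp
qed

text \<open>Transfer of deterministic inequalities: the new constant depends only on the old one,
  and the event is inherited, so the predicates themselves may be nonmeasurable.\<close>

lemma whp_imp:
  assumes prob: "\<And>n. prob_space (M n)" and P: "whp M P"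
    and imp: "\<And>C. \<exists>C'. \<forall>\<^sub>F n in sequentially. \<forall>\<omega>\<in>space (M n). P C n \<omega> \<longrightarrow> Q C' n \<omega>"
  shows "whp M Q"
  unfolding whp_def
proof (intro allI impI)
  fix \<delta> :: real assume "0 < \<delta>"
  then obtain C n1 where 1: "\<And>n. n \<ge> n1 \<Longrightarrow> \<exists>E\<in>sets (M n). measure (M n) E \<ge> 1 - \<delta> \<and> (\<forall>\<omega>\<in>E. P C n \<omega>)"
    using P unfolding whp_def by blast
  obtain C' n2 where 2: "\<And>n. n \<ge> n2 \<Longrightarrow> \<forall>\<omega>\<in>space (M n). P C n \<omega> \<longrightarrow> Q C' n \<omega>"
    using imp[of C] unfolding eventually_sequentially by blast
  show "\<exists>C n0. \<forall>n\<ge>n0. \<exists>E\<in>sets (M n). measure (M n) E \<ge> 1 - \<delta> \<and> (\<forall>\<omega>\<in>E. Q C n \<omega>)"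
  proof (intro exI allI impI)
    fix n assume n: "max n1 n2 \<le> n"
    obtain E where "E \<in> sets (M n)" "measure (M n) E \<ge> 1 - \<delta>" "\<forall>\<omega>\<in>E. P C n \<omega>" using 1 n by auto
    then show "\<exists>E\<in>sets (M n). measure (M n) E \<ge> 1 - \<delta> \<and> (\<forall>\<omega>\<in>E. Q C' n \<omega>)"
      using 2[of n] n sets.sets_into_space by fastforce
  qed
qed

text \<open>Markov's inequality for the whole sum. Only linearity of the integral is used, so the
  summands may depend on each other arbitrarily.\<close>

lemma whp_markov_sum:
  fixes v :: "nat \<Rightarrow> nat \<Rightarrow> 'a \<Rightarrow> real"
  assumes prob: "\<And>n. prob_space (M n)"
    and meas: "\<And>n i. i < m n \<Longrightarrow> v n i \<in> borel_measurable (M n)" and nonneg: "\<And>n i \<omega>. 0 \<le> v n i \<omega>"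
    and bound: "\<And>n i. i < m n \<Longrightarrow> (\<integral>\<^sup>+\<omega>. ennreal (v n i \<omega>) \<partial>M n) \<le> ennreal c"
    and m: "\<forall>\<^sub>F n in sequentially. 0 < m n"
  shows "whp M (\<lambda>C n \<omega>. (\<Sum>i<m n. v n i \<omega>) \<le> C * real (m n))"
  unfolding whp_def
proof (intro allI impI)
  fix \<delta> :: real assume d: "0 < \<delta>"
  obtain n0 where n0: "\<And>n. n \<ge> n0 \<Longrightarrow> 0 < m n" using m unfolding eventually_sequentially by blast
  \<comment> \<open>\<open>ennreal\<close> truncates a negative \<open>c\<close> to 0, so a positive
    majorant is taken; \<open>C = c' / \<delta>\<close> makes the Markov bound equal to
    \<open>\<delta>\<close>.\<close>
  define c' where "c' = max c 1"
  define C where "C = c' / \<delta>"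
  have c': "0 < c'" "ennreal c \<le> ennreal c'" by (auto simp: c'_def intro: ennreal_leI)
  have C: "0 < C" using d c' by (simp add: C_def)
  show "\<exists>C n0. \<forall>n\<ge>n0. \<exists>E\<in>sets (M n). measure (M n) E \<ge> 1 - \<delta> \<and> (\<forall>\<omega>\<in>E. (\<Sum>i<m n. v n i \<omega>) \<le> C * real (m n))"
  proof (intro exI allI impI)
    fix n assume "n0 \<le> n"
    then have mn: "0 < m n" using n0 by simp
    interpret prob_space "M n" by (rule prob)
    define u where "u = (\<lambda>\<omega>. \<Sum>i<m n. v n i \<omega>)"
    define a where "a = C * real (m n)"
    have a: "0 < a" using C mn by (simp add: a_def)
    have u: "u \<in> borel_measurable (M n)" unfolding u_def using meas by (intro borel_measurable_sum) auto
    have u0: "0 \<le> u \<omega>" for \<omega> unfolding u_def using nonneg by (intro sum_nonneg) auto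
    define B where "B = {\<omega> \<in> space (M n). 1 \<le> ennreal (1/a) * ennreal (u \<omega>)}"
    have Bs: "B \<in> sets (M n)" unfolding B_def using u by measurable
    have "(\<integral>\<^sup>+\<omega>. ennreal (u \<omega>) \<partial>M n) = (\<integral>\<^sup>+\<omega>. (\<Sum>i<m n. ennreal (v n i \<omega>)) \<partial>M n)"
      unfolding u_def using nonneg by simp
    also have "\<dots> = (\<Sum>i<m n. (\<integral>\<^sup>+\<omega>. ennreal (v n i \<omega>) \<partial>M n))"
      by (rule nn_integral_sum) (use meas in auto)
    also have "\<dots> \<le> (\<Sum>i<m n. ennreal c')"
      using bound c'(2) by (intro sum_mono) (auto intro: order_trans)
    also have "\<dots> = ennreal (real (m n) * c')"
      using c' by (simp add: ennreal_mult'' ennreal_of_nat_eq_real_of_nat)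
    finally have int: "(\<integral>\<^sup>+\<omega>. ennreal (u \<omega>) \<partial>M n) \<le> ennreal (real (m n) * c')" .
    have "emeasure (M n) B \<le> ennreal (1/a) * (\<integral>\<^sup>+\<omega>. ennreal (u \<omega>) * indicator (space (M n)) \<omega> \<partial>M n)"
      unfolding B_def by (rule nn_integral_Markov_inequality) (use u in auto)
    also have "(\<integral>\<^sup>+\<omega>. ennreal (u \<omega>) * indicator (space (M n)) \<omega> \<partial>M n) = (\<integral>\<^sup>+\<omega>. ennreal (u \<omega>) \<partial>M n)"
      by (intro nn_integral_cong) simp
    also have "ennreal (1/a) * (\<integral>\<^sup>+\<omega>. ennreal (u \<omega>) \<partial>M n) \<le> ennreal (1/a) * ennreal (real (m n) * c')"
      by (rule mult_left_mono[OF int]) simp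
    also have "\<dots> = ennreal ((1/a) * (real (m n) * c'))" using a by (intro ennreal_mult'[symmetric]) simp
    also have "(1/a) * (real (m n) * c') = \<delta>" using mn c' d by (simp add: a_def C_def)
    finally have "measure (M n) B \<le> \<delta>" using d by (simp add: emeasure_eq_measure)
    then have "measure (M n) (space (M n) - B) \<ge> 1 - \<delta>" using prob_compl[OF Bs] by simp
    moreover have "\<forall>\<omega>\<in>space (M n) - B. u \<omega> \<le> a"
    proof
      fix \<omega> assume "\<omega> \<in> space (M n) - B"
      moreover have "ennreal (1/a) * ennreal (u \<omega>) = ennreal (1/a * u \<omega>)"
        using a u0 by (intro ennreal_mult[symmetric]) auto
      ultimately have "\<not> 1 \<le> ennreal (1/a * u \<omega>)" unfolding B_def by auto
      then have "\<not> 1 \<le> 1/a * u \<omega>" using ennreal_leI[of 1 "1/a * u \<omega>"] by auto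
      then show "u \<omega> \<le> a" using a by (simp add: field_simps)
    qed
    ultimately show "\<exists>E\<in>sets (M n). measure (M n) E \<ge> 1 - \<delta> \<and> (\<forall>\<omega>\<in>E. (\<Sum>i<m n. v n i \<omega>) \<le> C * real (m n))"
      using Bs by (intro bexI[of _ "space (M n) - B"]) (auto simp: u_def a_def)
  qed
qed

text \<open>Finitely many factors share their constants, by minimum and maximum.\<close>

lemma same_order_uniform:
  assumes "finite I" "\<And>i. i \<in> I \<Longrightarrow> same_order (a i) (b i)"
  shows "\<exists>c C. 0 < c \<and> 0 < C \<and> (\<forall>\<^sub>F n in sequentially. \<forall>i\<in>I. 0 < b i n \<and> c * b i n \<le> a i n \<and> a i n \<le> C * b i n)"
  using assms
proof (induction I rule: finite_induct)
  case empty
  show ?case by (rule exI[of _ 1])+ simp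
next
  case (insert k I)
  obtain c C where 1: "0 < c" "0 < C" "\<forall>\<^sub>F n in sequentially. \<forall>i\<in>I. 0 < b i n \<and> c * b i n \<le> a i n \<and> a i n \<le> C * b i n"
    using insert.IH[OF insert.prems[OF insertI2]] by blast
  obtain c' C' where 2: "0 < c'" "c' \<le> C'" "\<forall>\<^sub>F n in sequentially. 0 < b k n \<and> c' * b k n \<le> a k n \<and> a k n \<le> C' * b k n"
    using insert.prems[of k] unfolding same_order_def by auto
  have "\<forall>\<^sub>F n in sequentially. \<forall>i\<in>insert k I. 0 < b i n \<and> min c c' * b i n \<le> a i n \<and> a i n \<le> max C C' * b i n"
    using 1(3) 2(3)
  proof eventually_elim
    case (elim n)
    show ?case
    proof
      fix i assume "i \<in> insert k I"
      then have b: "0 < b i n" and l: "c * b i n \<le> a i n \<or> c' * b i n \<le> a i n"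
        and u: "a i n \<le> C * b i n \<or> a i n \<le> C' * b i n" using elim by auto
      have "min c c' * b i n \<le> c * b i n" "min c c' * b i n \<le> c' * b i n"
        "C * b i n \<le> max C C' * b i n" "C' * b i n \<le> max C C' * b i n"
        using b by (auto intro!: mult_right_mono)
      then show "0 < b i n \<and> min c c' * b i n \<le> a i n \<and> a i n \<le> max C C' * b i n"
        using b l u by linarith
    qed
  qed
  then show ?case using 1(1,2) 2(1,2) by (intro exI[of _ "min c c'"] exI[of _ "max C C'"]) auto
qed

text \<open>\<open>R - P\<close> is \<open>(1\<^sub>m n - P) * R\<close> minus the transpose of
  \<open>(1\<^sub>m n - R) * P\<close>.\<close>

lemma proj_diff_le:
  assumes P: "is_proj n P" and R: "is_proj n R"
    and x: "frob_norm ((1\<^sub>m n - R) * P) = x" "frob_norm ((1\<^sub>m n - P) * R) = x"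
  shows "frob_norm (R - P) \<le> 2 * x"
proof -
  have Pc: "P \<in> carrier_mat n n" "P\<^sup>T = P" using P by (auto simp: is_proj_def)
  have Rc: "R \<in> carrier_mat n n" "R\<^sup>T = R" using R by (auto simp: is_proj_def)
  have PR: "P * R \<in> carrier_mat n n" and RP: "R * P \<in> carrier_mat n n" using Pc Rc by auto
  have e1: "(1\<^sub>m n - P) * R = R - P * R"
    using minus_mult_distrib_mat[OF one_carrier_mat Pc(1) Rc(1)] Rc by simp
  have e2: "(1\<^sub>m n - R) * P = P - R * P"
    using minus_mult_distrib_mat[OF one_carrier_mat Rc(1) Pc(1)] Pc by simp
  have c2: "P - R * P \<in> carrier_mat n n" and c1: "R - P * R \<in> carrier_mat n n" using PR RP by auto
  have "(P - R * P)\<^sup>T = P - P * R"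
    using transpose_minus[OF Pc(1) RP] transpose_mult[OF Rc(1) Pc(1)] Pc Rc by simp
  moreover have "R - P = (R - P * R) - (P - P * R)" using Pc Rc PR by (intro eq_matI) (auto simp del: index_mult_mat(1))
  ultimately have "R - P = (R - P * R) - (P - R * P)\<^sup>T" by simp
  then have "frob_norm (R - P) \<le> frob_norm (R - P * R) + frob_norm ((P - R * P)\<^sup>T)"
    using frob_norm_minus_le[OF c1, of "(P - R * P)\<^sup>T"] c2 by simp
  then show ?thesis using x unfolding e1 e2 frob_norm_transpose by simp
qed

text \<open>The normalised Gram matrix is \<open>S\<close> plus an error of spectral norm at most
  \<open>\<eta>\<close>, and the trace form turns both into quadratic forms in
  \<open>Z\<close>.\<close>

lemma factor_gram:
  assumes F: "F \<in> carrier_mat t r" and S: "S \<in> carrier_mat r r" and t: "0 < t"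
    and close: "spec_norm ((1 / real t) \<cdot>\<^sub>m (F\<^sup>T * F) - S) \<le> \<eta>" and Z: "Z \<in> carrier_mat r m"
  shows "\<bar>(frob_norm (F * Z))\<^sup>2 - real t * mip (S * Z) Z\<bar> \<le> real t * (\<eta> * (frob_norm Z)\<^sup>2)"
proof -
  define D where "D = (1 / real t) \<cdot>\<^sub>m (F\<^sup>T * F) - S"
  have FF: "F\<^sup>T * F \<in> carrier_mat r r" and FT: "F\<^sup>T \<in> carrier_mat r t" and FZ: "F * Z \<in> carrier_mat t m" using F Z by auto
  have D: "D \<in> carrier_mat r r" using S by (simp add: D_def)
  have DZ: "D * Z \<in> carrier_mat r m" and SZ: "S * Z \<in> carrier_mat r m" using D S Z by auto
  have "F\<^sup>T * F = real t \<cdot>\<^sub>m (D + S)" using FF S t by (intro eq_matI) (auto simp: D_def simp del: index_mult_mat(1))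
  then have "F\<^sup>T * F * Z = real t \<cdot>\<^sub>m (D * Z + S * Z)"
    using mult_smult_assoc_mat[OF add_carrier_mat[OF S, of D] Z, of "real t"] add_mult_distrib_mat[OF D S Z] by simp
  moreover have "(frob_norm (F * Z))\<^sup>2 = mip (F\<^sup>T * F * Z) Z"
  proof -
    have "(frob_norm (F * Z))\<^sup>2 = mip Z (F\<^sup>T * (F * Z))" using mip_mult_left[OF F Z FZ] by (simp add: frob_norm_sq)
    also have "F\<^sup>T * (F * Z) = F\<^sup>T * F * Z" by (rule assoc_mult_mat[OF FT F Z, symmetric])
    also have "mip Z (F\<^sup>T * F * Z) = mip (F\<^sup>T * F * Z) Z" by (rule mip_commute[OF Z mult_carrier_mat[OF FF Z]])
    finally show ?thesis .
  qed
  ultimately have "(frob_norm (F * Z))\<^sup>2 = real t * (mip (D * Z) Z + mip (S * Z) Z)"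
    by (simp add: mip_smult_left mip_add_left[OF DZ SZ])
  then have e: "(frob_norm (F * Z))\<^sup>2 - real t * mip (S * Z) Z = real t * mip (D * Z) Z" by (simp add: algebra_simps)
  have "\<bar>mip (D * Z) Z\<bar> \<le> frob_norm (D * Z) * frob_norm Z" by (rule mip_le_frob[OF DZ Z])
  also have "\<dots> \<le> (\<eta> * frob_norm Z) * frob_norm Z"
    using frob_norm_mult_le_spec[OF D Z] mult_right_mono[OF close frob_norm_nonneg[of Z]]
    by (intro mult_right_mono) (auto simp: D_def)
  finally have "\<bar>mip (D * Z) Z\<bar> \<le> \<eta> * (frob_norm Z)\<^sup>2" by (simp add: power2_eq_square)
  then show ?thesis unfolding e using t by (simp add: abs_mult)
qed

text \<open>Half of the coercivity constant is spent on the sampling error, leaving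
  \<open>c / 2\<close> below; the upper bound is the case where \<open>Z\<close> is the
  identity.\<close>

lemma factor_gram_bounds:
  assumes F: "F \<in> carrier_mat t r" and S: "S \<in> carrier_mat r r" and t: "0 < t"
    and pd: "\<forall>v\<in>carrier_vec r. c * (v \<bullet> v) \<le> v \<bullet> (S *\<^sub>v v)"
    and close: "spec_norm ((1 / real t) \<cdot>\<^sub>m (F\<^sup>T * F) - S) \<le> c / 2"
  shows "\<And>Z m. Z \<in> carrier_mat r m \<Longrightarrow> c / 2 * real t * (frob_norm Z)\<^sup>2 \<le> (frob_norm (F * Z))\<^sup>2"
    and "(frob_norm F)\<^sup>2 \<le> (mip S (1\<^sub>m r) + c / 2 * real r) * real t"
proof -
  fix Z :: "real Matrix.mat" and m assume Z: "Z \<in> carrier_mat r m"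
  have "c * (frob_norm Z)\<^sup>2 = (\<Sum>j<m. c * (col Z j \<bullet> col Z j))"
    by (simp add: frob_norm_sq_cols[OF Z] vnorm_sq_scalar sum_distrib_left)
  also have "\<dots> \<le> mip (S * Z) Z" unfolding mip_vec[OF S Z] using pd Z by (intro sum_mono) auto
  finally have "real t * (c * (frob_norm Z)\<^sup>2) \<le> real t * mip (S * Z) Z" by (intro mult_left_mono) auto
  then show "c / 2 * real t * (frob_norm Z)\<^sup>2 \<le> (frob_norm (F * Z))\<^sup>2"
    using abs_le_D2[OF factor_gram[OF F S t close Z]] by (simp add: algebra_simps)
next
  show "(frob_norm F)\<^sup>2 \<le> (mip S (1\<^sub>m r) + c / 2 * real r) * real t"
    using abs_le_D1[OF factor_gram[OF F S t close one_carrier_mat]] F S by (simp add: frob_norm_one algebra_simps)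
qed

section \<open>Rates\<close>

lemma near_on_frob_le:
  assumes no: "near_on n r L d" and dmax: "0 \<le> dmax" "\<And>i. i < r \<Longrightarrow> d i \<le> dmax"
  shows "frob_norm L \<le> sqrt dmax * sqrt (2 * real r)"
proof -
  have L: "L \<in> carrier_mat n r" and dp: "\<forall>i<r. 0 < d i" using no by (auto simp: near_on_def)
  have "frob_norm (scaled r L d * dmat r (\<lambda>i. sqrt (d i))) \<le> sqrt dmax * frob_norm (scaled r L d)"
    by (rule frob_mult_dmat_le[OF scaled_carrier[OF L]]) (use dmax dp in \<open>auto intro: less_imp_le\<close>)
  also have "\<dots> \<le> sqrt dmax * sqrt (2 * real r)"
    using near_on_scaled_bound[OF no] dmax by (intro mult_left_mono) auto
  finally show ?thesis using scaled_unscale[OF L dp] by simp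
qed

text \<open>The 2 in front comes from \<open>proj_diff_le\<close>, the power of \<open>r\<close>
  from \<open>panel_projection_error\<close>, and the last bracket from the bounds on the
  factor-noise product and on the noise.\<close>

definition panel_const :: "nat \<Rightarrow> real \<Rightarrow> real \<Rightarrow> real \<Rightarrow> real" where
  "panel_const r c0 CL C = 2 * (18 * (real r)\<^sup>2 * sqrt (real r) * (2 * sqrt (2 * real r * CL * C) + C)) / c0"

text \<open>The noise is at most a multiple of \<open>n * sqrt t + t\<close>, because
  \<open>max n t \<le> n * sqrt t + t\<close>; division by \<open>dmin * t\<close> gives the two
  terms. For sources \<open>dmin\<close> is the dimension, for the target it is of the order of the
  weakest strength.\<close>

lemma panel_rate:
  assumes no: "near_on n r L d" and dmin: "0 < dmin" "\<And>i. i < r \<Longrightarrow> dmin \<le> d i"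
    and dmax: "0 \<le> CL" "\<And>i. i < r \<Longrightarrow> d i \<le> CL * real n"
    and t: "0 < t" and n: "0 < n"
    and F: "F \<in> carrier_mat t r" and E: "E \<in> carrier_mat t n"
    and c0: "0 < c0" and sig: "\<And>Z m. Z \<in> carrier_mat r m \<Longrightarrow> c0 * real t * (frob_norm Z)\<^sup>2 \<le> (frob_norm (F * Z))\<^sup>2"
    and lead: "leading_eigvecs ((1 / (real n * real t)) \<cdot>\<^sub>m ((panel F L E)\<^sup>T * panel F L E)) r Q"
    and C: "0 \<le> C" "(frob_norm (F\<^sup>T * E))\<^sup>2 \<le> C * (real n * real t)" "(spec_norm E)\<^sup>2 \<le> C * real (max n t)"
  shows "frob_norm (Q * Q\<^sup>T - proj L) \<le> panel_const r c0 CL C * (real n / (dmin * sqrt (real t)) + 1 / dmin)"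
proof -
  define x where "x = frob_norm ((1\<^sub>m n - Q * Q\<^sup>T) * proj L)"
  define a where "a = 18 * (real r)\<^sup>2 * sqrt (real r)"
  define b where "b = 2 * sqrt (2 * real r * CL * C) + C"
  have L: "L \<in> carrier_mat n r" using no by (simp add: near_on_def)
  have Q: "Q \<in> carrier_mat n r" "Q\<^sup>T * Q = 1\<^sub>m r"
    using lead by (auto simp: leading_eigvecs_def panel_def E[THEN carrier_matD(2)])
  have err: "c0 * dmin * real t * x \<le> a * (2 * frob_norm L * frob_norm (F\<^sup>T * E) + (spec_norm E)\<^sup>2)"
    "frob_norm ((1\<^sub>m n - proj L) * (Q * Q\<^sup>T)) = x"
    unfolding x_def a_def by (rule panel_projection_error[OF no _ _ t n F E c0 _ lead]; use dmin sig in auto)+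
  have d: "frob_norm (Q * Q\<^sup>T - proj L) \<le> 2 * x"
    by (rule proj_diff_le[OF near_on_is_proj(1)[OF no] is_proj_orthonormal(1)[OF Q]]) (use err(2) in \<open>simp_all add: x_def\<close>)
  have a0: "0 \<le> a" and b0: "0 \<le> b" using dmax C by (simp_all add: a_def b_def)
  have st: "1 \<le> sqrt (real t)" "sqrt (real t) * sqrt (real t) = real t" using t by auto
  have "frob_norm L * frob_norm (F\<^sup>T * E) \<le> (sqrt (CL * real n) * sqrt (2 * real r)) * sqrt (C * (real n * real t))"
  proof (rule mult_mono)
    show "frob_norm L \<le> sqrt (CL * real n) * sqrt (2 * real r)" by (rule near_on_frob_le[OF no]) (use dmax in auto)
    show "frob_norm (F\<^sup>T * E) \<le> sqrt (C * (real n * real t))" using C(2) by (rule real_le_rsqrt)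
  qed (use dmax in auto)
  also have "\<dots> = sqrt (2 * real r * CL * C) * (real n * sqrt (real t))" by (simp add: real_sqrt_mult)
  finally have m1: "frob_norm L * frob_norm (F\<^sup>T * E) \<le> sqrt (2 * real r * CL * C) * (real n * sqrt (real t))" .
  have nt: "real n \<le> real n * sqrt (real t)" using mult_left_mono[OF st(1), of "real n"] by simp
  have "(spec_norm E)\<^sup>2 \<le> C * (real n * sqrt (real t) + real t)"
  proof -
    have "real (max n t) \<le> real n * sqrt (real t) + real t" using nt by linarith
    then show ?thesis using C(3) mult_left_mono[OF _ C(1)] order_trans by blast
  qed
  then have "2 * frob_norm L * frob_norm (F\<^sup>T * E) + (spec_norm E)\<^sup>2 \<le> b * (real n * sqrt (real t) + real t)"
  proof -
    assume s: "(spec_norm E)\<^sup>2 \<le> C * (real n * sqrt (real t) + real t)"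
    have "0 \<le> sqrt (2 * real r * CL * C) * real t" using dmax C by simp
    then show ?thesis using s m1 by (simp add: b_def algebra_simps)
  qed
  then have "c0 * dmin * real t * x \<le> a * (b * (real n * sqrt (real t) + real t))"
    by (rule order_trans[OF err(1) mult_left_mono[OF _ a0]])
  then have "x * (c0 * (dmin * real t)) \<le> a * b * (real n * sqrt (real t) + real t)" by (simp add: mult_ac)
  then have "x \<le> a * b * (real n * sqrt (real t) + real t) / (c0 * (dmin * real t))"
    using c0 dmin t by (simp add: pos_le_divide_eq)
  also have "\<dots> = a * b / c0 * ((real n * sqrt (real t) + real t) / (dmin * real t))" by simp
  also have "(real n * sqrt (real t) + real t) / (dmin * real t) = real n / (dmin * sqrt (real t)) + 1 / dmin"
  proof -
    have "real n * sqrt (real t) / (dmin * real t) = real n / (dmin * sqrt (real t))"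
      using st t dmin(1) by (metis (no_types, opaque_lifting) less_numeral_extra(1) mult.assoc mult_divide_mult_cancel_right not_one_le_zero)
    then show ?thesis using t dmin(1) by (simp add: add_divide_distrib)
  qed
  finally have "x \<le> a * b / c0 * (real n / (dmin * sqrt (real t)) + 1 / dmin)" .
  moreover have "panel_const r c0 CL C * (real n / (dmin * sqrt (real t)) + 1 / dmin)
      = 2 * (a * b / c0 * (real n / (dmin * sqrt (real t)) + 1 / dmin))"
    by (simp add: panel_const_def a_def b_def)
  ultimately show ?thesis using d by linarith
qed

text \<open>The weight \<open>T k / TT\<close> multiplies each panel rate, and
  \<open>T k / sqrt (T k) = sqrt (T k)\<close> produces the announced terms. The constant is a
  common majorant of \<open>2 * K\<close> for the panel errors and 8 for the mismatch, divided by
  the gap.\<close>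

lemma weak_space_rate:
  fixes T r :: "nat \<Rightarrow> nat" and Lam Qh :: "nat \<Rightarrow> real Matrix.mat" and A :: "nat set"
  defines "TT \<equiv> real (\<Sum>k\<in>insert 0 A. T k)"
  assumes A: "finite A" "0 \<notin> A" and T: "\<And>k. k \<in> insert 0 A \<Longrightarrow> 0 < T k" and n: "0 < n" and na: "0 < na"
    and s: "s \<le> r 0" "\<And>k. k \<in> A \<Longrightarrow> s \<le> r k"
    and no0: "near_on n (r 0) (Lam 0) d0" and noA: "\<And>k. k \<in> A \<Longrightarrow> near_on n (r k) (Lam k) (d k)"
    and P0: "proj (Lam 0) = proj (Defs.cols (Lam 0) (r 0 - s) (r 0)) + proj (Defs.cols (Lam 0) 0 (r 0 - s))"
    and Pk: "\<And>k. k \<in> A \<Longrightarrow> proj (Lam k) = proj (Defs.cols (Lam k) 0 s) + proj (Defs.cols (Lam k) s (r k))"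
    and eps: "\<And>k. k \<in> A \<Longrightarrow> frob_norm (proj (Defs.cols (Lam k) 0 s) - proj (Defs.cols (Lam 0) (r 0 - s) (r 0))) \<le> eps"
    and kappa: "0 < kappa" "spec_norm ((1 / TT) \<cdot>\<^sub>m (real (T 0) \<cdot>\<^sub>m proj (Defs.cols (Lam 0) 0 (r 0 - s))
        + msum n A (\<lambda>k. real (T k) \<cdot>\<^sub>m proj (Defs.cols (Lam k) s (r k))))) \<le> 1 - kappa"
    and Qh: "\<And>k. k \<in> insert 0 A \<Longrightarrow> Qh k \<in> carrier_mat n (r k)" "\<And>k. k \<in> insert 0 A \<Longrightarrow> (Qh k)\<^sup>T * Qh k = 1\<^sub>m (r k)"
    and K: "0 \<le> K"
    and rate0: "frob_norm (Qh 0 * (Qh 0)\<^sup>T - proj (Lam 0)) \<le> K * (real n / (na * sqrt (real (T 0))) + 1 / na)"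
    and rateA: "\<And>k. k \<in> A \<Longrightarrow> frob_norm (Qh k * (Qh k)\<^sup>T - proj (Lam k)) \<le> K * (1 / sqrt (real (T k)) + 1 / real n)"
    and lead: "leading_eigvecs ((1 / TT) \<cdot>\<^sub>m msum n (insert 0 A) (\<lambda>k. real (T k) \<cdot>\<^sub>m (Qh k * (Qh k)\<^sup>T))) s Q"
  shows "frob_norm ((1\<^sub>m n - Q * Q\<^sup>T) * proj (Defs.cols (Lam 0) (r 0 - s) (r 0)))
      \<le> (2 * K + 8) / kappa * (sqrt (real (T 0)) * real n / (TT * na) + real (T 0) / (TT * na)
          + (\<Sum>k\<in>A. sqrt (real (T k)) / TT + real (T k) / (TT * real n)) + (1 / TT) * (\<Sum>k\<in>A. real (T k) * eps))"
    and "frob_norm ((1\<^sub>m n - proj (Defs.cols (Lam 0) (r 0 - s) (r 0))) * (Q * Q\<^sup>T))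
      = frob_norm ((1\<^sub>m n - Q * Q\<^sup>T) * proj (Defs.cols (Lam 0) (r 0 - s) (r 0)))"
    and "proj (Defs.cols (Lam 0) 0 (r 0 - s)) * proj (Defs.cols (Lam 0) (r 0 - s) (r 0)) = 0\<^sub>m n n"
proof -
  define P where "P = proj (Defs.cols (Lam 0) (r 0 - s) (r 0))"
  define Ps where "Ps = proj (Defs.cols (Lam 0) 0 (r 0 - s))"
  define PT where "PT = (\<lambda>k. proj (Defs.cols (Lam k) 0 s))"
  define PTc where "PTc = (\<lambda>k. proj (Defs.cols (Lam k) s (r k)))"
  define R where "R = (\<lambda>k. Qh k * (Qh k)\<^sup>T)"
  define tau where "tau = (\<lambda>k. real (T k) / TT)"
  define rho where "rho = (\<lambda>k. if k = 0 then K * (real n / (na * sqrt (real (T 0))) + 1 / na)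
      else K * (1 / sqrt (real (T k)) + 1 / real n))"
  have TTs: "TT = (\<Sum>k\<in>insert 0 A. real (T k))" by (simp add: TT_def)
  have TT: "0 < TT" unfolding TTs by (rule sum_pos) (use A T in auto)
  have isP: "is_proj n P" "mip P P = real s"
    using near_on_is_proj(1,2)[OF near_on_cols(1)[OF no0, of "r 0 - s" "r 0"]] s(1) by (simp_all add: P_def)
  have isPs: "is_proj n Ps" using near_on_is_proj(1)[OF near_on_cols(1)[OF no0, of 0 "r 0 - s"]] by (simp add: Ps_def)
  have isP0: "is_proj n (P + Ps)" using near_on_is_proj(1)[OF no0] P0 by (simp add: P_def Ps_def)
  have isPT: "is_proj n (PT k)" and isPTc: "is_proj n (PTc k)" and isPk: "is_proj n (PT k + PTc k)" if k: "k \<in> A" for k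
    using near_on_is_proj(1)[OF near_on_cols(1)[OF noA[OF k], of 0 s]] near_on_is_proj(1)[OF near_on_cols(1)[OF noA[OF k], of s "r k"]]
      near_on_is_proj(1)[OF noA[OF k]] Pk[OF k] s(2)[OF k]
    by (simp_all add: PT_def PTc_def)
  have isR: "is_proj n (R k)" if "k \<in> insert 0 A" for k
    unfolding R_def by (rule is_proj_orthonormal(1)[OF Qh[OF that]])
  have Psc: "Ps \<in> carrier_mat n n" using isPs by (simp add: is_proj_def)
  have cT: "PTc k \<in> carrier_mat n n" if "k \<in> A" for k using isPTc[OF that] by (simp add: is_proj_def)
  have cR: "R k \<in> carrier_mat n n" if "k \<in> insert 0 A" for k using isR[OF that] by (simp add: is_proj_def)
  have scale: "(1 / TT) \<cdot>\<^sub>m msum n I (\<lambda>k. real (T k) \<cdot>\<^sub>m M k) = msum n I (\<lambda>k. tau k \<cdot>\<^sub>m M k)"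
    if M: "\<And>k. k \<in> I \<Longrightarrow> M k \<in> carrier_mat n n" for I M
  proof (rule eq_matI)
    fix i j assume "i < dim_row (msum n I (\<lambda>k. tau k \<cdot>\<^sub>m M k))" "j < dim_col (msum n I (\<lambda>k. tau k \<cdot>\<^sub>m M k))"
    then have ij: "i < n" "j < n" by (auto simp: msum_def)
    have "(\<Sum>k\<in>I. (tau k \<cdot>\<^sub>m M k) $$ (i,j)) = (\<Sum>k\<in>I. (1 / TT) * (real (T k) \<cdot>\<^sub>m M k) $$ (i,j))"
      using ij by (intro sum.cong refl) (simp add: carrier_matD[OF M] tau_def)
    then show "((1 / TT) \<cdot>\<^sub>m msum n I (\<lambda>k. real (T k) \<cdot>\<^sub>m M k)) $$ (i,j) = msum n I (\<lambda>k. tau k \<cdot>\<^sub>m M k) $$ (i,j)"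
      using ij by (simp add: msum_def sum_distrib_left del: index_smult_mat(1)) (simp add: msum_def sum_distrib_left)
  qed (auto simp: msum_def)
  define B where "B = tau 0 \<cdot>\<^sub>m Ps + msum n A (\<lambda>k. tau k \<cdot>\<^sub>m PTc k)"
  have "(1 / TT) \<cdot>\<^sub>m (real (T 0) \<cdot>\<^sub>m Ps + M) = tau 0 \<cdot>\<^sub>m Ps + (1 / TT) \<cdot>\<^sub>m M" if "M \<in> carrier_mat n n" for M
    using Psc that by (intro eq_matI) (auto simp: tau_def distrib_left add_divide_distrib)
  then have "(1 / TT) \<cdot>\<^sub>m (real (T 0) \<cdot>\<^sub>m Ps + msum n A (\<lambda>k. real (T k) \<cdot>\<^sub>m PTc k)) = B"
    using scale[of A PTc, OF cT] by (simp add: B_def)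
  then have specB: "spec_norm B \<le> 1 - kappa" using kappa(2) by (simp add: Ps_def PTc_def)
  have lead': "leading_eigvecs (msum n (insert 0 A) (\<lambda>k. tau k \<cdot>\<^sub>m R k)) s Q"
    using lead scale[of "insert 0 A" R, OF cR] by (simp add: R_def)
  have tau: "0 \<le> tau k" for k using TT by (simp add: tau_def)
  have tau1: "(\<Sum>k\<in>insert 0 A. tau k) = 1"
    unfolding tau_def sum_divide_distrib[symmetric] using TT TTs by simp
  have rho0: "frob_norm (R 0 - (P + Ps)) \<le> rho 0" using rate0 P0 by (simp add: R_def P_def Ps_def rho_def)
  have rho: "frob_norm (R k - (PT k + PTc k)) \<le> rho k" if k: "k \<in> A" for k
  proof -
    have "k \<noteq> 0" using k A(2) by metis
    then show ?thesis using rateA[OF k] Pk[OF k] by (simp add: R_def PT_def PTc_def rho_def)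
  qed
  have ep: "frob_norm (PT k - P) \<le> eps" if "k \<in> A" for k using eps[OF that] by (simp add: PT_def P_def)
  note agg = aggregate_projection_error[OF A tau tau1 isP isPs isP0 isPT isPTc isPk isR rho0 rho ep B_def specB lead']
  show "frob_norm ((1\<^sub>m n - proj (Defs.cols (Lam 0) (r 0 - s) (r 0))) * (Q * Q\<^sup>T))
      = frob_norm ((1\<^sub>m n - Q * Q\<^sup>T) * proj (Defs.cols (Lam 0) (r 0 - s) (r 0)))"
    using agg(2) by (simp only: P_def)
  show "proj (Defs.cols (Lam 0) 0 (r 0 - s)) * proj (Defs.cols (Lam 0) (r 0 - s) (r 0)) = 0\<^sub>m n n"
    using is_proj_orthogonal[OF isP(1) isPs isP0] by (simp add: P_def Ps_def)
  define z where "z = sqrt (real (T 0)) * real n / (TT * na) + real (T 0) / (TT * na)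
          + (\<Sum>k\<in>A. sqrt (real (T k)) / TT + real (T k) / (TT * real n))"
  define e where "e = (1 / TT) * (\<Sum>k\<in>A. real (T k) * eps)"
  have sq: "real (T k) / sqrt (real (T k)) = sqrt (real (T k))" for k
    by (metis mult_eq_0_iff nonzero_mult_div_cancel_left of_nat_0_le_iff real_sqrt_mult_self abs_of_nonneg div_0)
  have tr0: "tau 0 * rho 0 = K * (sqrt (real (T 0)) * real n / (TT * na) + real (T 0) / (TT * na))"
  proof -
    have "tau 0 * rho 0 = K * ((real (T 0) / sqrt (real (T 0))) * real n / (TT * na) + real (T 0) / (TT * na))"
      using TT na by (simp add: tau_def rho_def field_simps)
    then show ?thesis unfolding sq .
  qed
  have trk: "tau k * rho k = K * (sqrt (real (T k)) / TT + real (T k) / (TT * real n))" if k: "k \<in> A" for k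
  proof -
    have "k \<noteq> 0" using k A(2) by metis
    then have "tau k * rho k = K * ((real (T k) / sqrt (real (T k))) / TT + real (T k) / (TT * real n))"
      using TT n by (simp add: tau_def rho_def field_simps)
    then show ?thesis unfolding sq .
  qed
  have S1: "(\<Sum>k\<in>insert 0 A. tau k * rho k) = K * z"
    using A tr0 by (simp add: trk z_def distrib_left sum_distrib_left)
  have S2: "(\<Sum>k\<in>A. tau k * eps) = e" by (simp add: tau_def e_def sum_distrib_left)
  have z0: "0 \<le> z" unfolding z_def using TT na by (intro add_nonneg_nonneg sum_nonneg) auto
  \<comment> \<open>\<open>eps\<close> is known to be nonnegative only if there is a source;
    otherwise the sum is empty.\<close>
  have e0: "0 \<le> e"
  proof -
    have "0 \<le> eps" if "k \<in> A" for k using order_trans[OF frob_norm_nonneg eps[OF that]] .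
    then show ?thesis unfolding e_def using TT by (intro mult_nonneg_nonneg sum_nonneg) auto
  qed
  have "kappa * frob_norm ((1\<^sub>m n - Q * Q\<^sup>T) * P) \<le> 2 * (K * z + 4 * e)" using agg(1) S1 S2 by simp
  also have "\<dots> \<le> (2 * K + 8) * (z + e)" using K z0 e0 by (simp add: algebra_simps)
  finally have "frob_norm ((1\<^sub>m n - Q * Q\<^sup>T) * P) \<le> (2 * K + 8) / kappa * (z + e)"
    using kappa(1) by (simp add: field_simps)
  then show "frob_norm ((1\<^sub>m n - Q * Q\<^sup>T) * proj (Defs.cols (Lam 0) (r 0 - s) (r 0)))
      \<le> (2 * K + 8) / kappa * (sqrt (real (T 0)) * real n / (TT * na) + real (T 0) / (TT * na)
          + (\<Sum>k\<in>A. sqrt (real (T k)) / TT + real (T k) / (TT * real n)) + (1 / TT) * (\<Sum>k\<in>A. real (T k) * eps))"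
    by (simp only: P_def z_def e_def)
qed

text \<open>Regroups the squared norm into a sum over units of the variables whose second moments
  (A4) bounds, so that \<open>whp_markov_sum\<close> applies.\<close>

lemma frob_factor_noise:
  assumes t: "0 < t"
  shows "(frob_norm ((fmat t r g)\<^sup>T * emat t n e))\<^sup>2
    = real t * (\<Sum>i<n. (vnorm (Matrix.vec r (\<lambda>j. (1 / sqrt (real t)) * (\<Sum>l<t. g l $ j * e l i))))\<^sup>2)"
proof -
  have F: "(fmat t r g)\<^sup>T \<in> carrier_mat r t" and E: "emat t n e \<in> carrier_mat t n"
    by (auto simp: fmat_def emat_def)
  have ent: "((fmat t r g)\<^sup>T * emat t n e) $$ (j,i) = (\<Sum>l<t. g l $ j * e l i)" if "j < r" "i < n" for i j
    unfolding mult_mat_entry[OF F E that] using that by (intro sum.cong) (auto simp: fmat_def emat_def)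
  have "(frob_norm ((fmat t r g)\<^sup>T * emat t n e))\<^sup>2 = (\<Sum>j<r. \<Sum>i<n. (\<Sum>l<t. g l $ j * e l i)\<^sup>2)"
    unfolding frob_norm_sq mip_carrier[OF mult_carrier_mat[OF F E]]
    by (intro sum.cong refl) (simp add: ent power2_eq_square del: index_mult_mat)
  also have "\<dots> = (\<Sum>i<n. \<Sum>j<r. (\<Sum>l<t. g l $ j * e l i)\<^sup>2)" by (rule sum.swap)
  also have "\<dots> = real t * (\<Sum>i<n. (\<Sum>j<r. (\<Sum>l<t. g l $ j * e l i)\<^sup>2) / real t)"
    using t by (simp flip: sum_divide_distrib)
  also have "(\<Sum>i<n. (\<Sum>j<r. (\<Sum>l<t. g l $ j * e l i)\<^sup>2) / real t)
      = (\<Sum>i<n. (vnorm (Matrix.vec r (\<lambda>j. (1 / sqrt (real t)) * (\<Sum>l<t. g l $ j * e l i))))\<^sup>2)"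
    using t by (intro sum.cong refl) (simp add: vnorm_sq power_divide flip: sum_divide_distrib)
  finally show ?thesis .
qed

text \<open>The counterpart for the target loadings in (A4), summed over periods, with every column
  normalised by its own strength.\<close>

lemma frob_noise_scaled:
  assumes L: "L \<in> carrier_mat n r"
  shows "(frob_norm (emat t n e * scaled r L d))\<^sup>2
    = (\<Sum>l<t. (vnorm (Matrix.vec r (\<lambda>j. (1 / sqrt (d j)) * (\<Sum>i<n. L $$ (i,j) * e l i))))\<^sup>2)"
proof -
  have E: "emat t n e \<in> carrier_mat t n" by (auto simp: emat_def)
  have V: "scaled r L d \<in> carrier_mat n r" using L by simp
  have ent: "(emat t n e * scaled r L d) $$ (l,j) = (1 / sqrt (d j)) * (\<Sum>i<n. L $$ (i,j) * e l i)" if "l < t" "j < r" for l j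
  proof -
    have "(emat t n e * scaled r L d) $$ (l,j) = (\<Sum>i<n. e l i * (L $$ (i,j) * (1 / sqrt (d j))))"
      unfolding mult_mat_entry[OF E V that] unfolding scaled_def using that
      by (intro sum.cong refl) (simp add: emat_def mult_dmat_index[OF L] del: index_mult_mat)
    then show ?thesis by (simp add: sum_distrib_left mult_ac)
  qed
  show ?thesis
    unfolding frob_norm_sq mip_carrier[OF mult_carrier_mat[OF E V]] vnorm_sq
    by (intro sum.cong refl) (simp_all add: ent power2_eq_square del: index_mult_mat)
qed

text \<open>Brings the source condition of (A2), with its common factor \<open>1 / N\<close>, into
  the shape of \<open>scaled_gram\<close>.\<close>

lemma dmat_const_conj:
  assumes M: "M \<in> carrier_mat r r"
  shows "dmat r (\<lambda>_. a) * M * dmat r (\<lambda>_. a) = (a * a) \<cdot>\<^sub>m M"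
proof -
  have d: "dmat r (\<lambda>_. a) = a \<cdot>\<^sub>m 1\<^sub>m r" by (rule eq_matI) (auto simp: dmat_def)
  have "dmat r (\<lambda>_. a) * M = a \<cdot>\<^sub>m M"
    unfolding d using mult_smult_assoc_mat[of "1\<^sub>m r" r r M r a] M by simp
  moreover have "(a \<cdot>\<^sub>m M) * dmat r (\<lambda>_. a) = a \<cdot>\<^sub>m (a \<cdot>\<^sub>m M)"
    unfolding d using mult_smult_distrib[of "a \<cdot>\<^sub>m M" r r "1\<^sub>m r" r a] M by simp
  moreover have "a \<cdot>\<^sub>m (a \<cdot>\<^sub>m M) = (a * a) \<cdot>\<^sub>m M" using M by (intro eq_matI) auto
  ultimately show ?thesis by simp
qed

text \<open>The threshold offsets the factor \<open>sqrt r\<close> between the two norms; 1/4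
  instead of the 1/2 in \<open>near_on\<close> leaves room for the sampling error in the
  rotation.\<close>

lemma gram_defect_le:
  assumes L: "L \<in> carrier_mat n r" and r: "0 < r"
    and small: "spec_norm (dmat r (\<lambda>i. 1 / sqrt (d i)) * (L\<^sup>T * L) * dmat r (\<lambda>i. 1 / sqrt (d i)) - 1\<^sub>m r) < 1 / (4 * sqrt (real r))"
  shows "frob_norm ((scaled r L d)\<^sup>T * scaled r L d - 1\<^sub>m r) \<le> 1/4"
proof -
  let ?G = "(scaled r L d)\<^sup>T * scaled r L d - 1\<^sub>m r"
  have "?G \<in> carrier_mat r r" by simp
  then have "frob_norm ?G \<le> spec_norm ?G * sqrt (real r)" by (rule frob_norm_le_spec)
  also have "\<dots> \<le> 1 / (4 * sqrt (real r)) * sqrt (real r)"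
    using small unfolding scaled_gram[OF L] by (intro mult_right_mono) auto
  finally show ?thesis using r by simp
qed

text \<open>Bookkeeping over the reals: the ratio \<open>sqrt n / sqrt na\<close>, being at least 1,
  absorbs the term in which it is missing, and the projected noise \<open>y\<close> is what becomes
  \<open>1 / sqrt na\<close>.\<close>

lemma factor_rate:
  fixes n t na x fF fL sE y Rt :: real
  assumes err: "err \<le> 1 / sqrt (c1 * na) * (p * (fF * fL + sE) * x + p * y) + q * fF * x"
    and pos: "0 < c1" "0 < na" "na \<le> n" "0 < t" "0 \<le> p" "0 \<le> q" "0 \<le> x" "0 \<le> Kx" "0 \<le> Rt" "x \<le> Kx * Rt"
    and bF: "0 \<le> fF" "fF \<le> b1 * sqrt t" and bL: "0 \<le> fL" "fL \<le> b2 * sqrt n"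
    and bE: "sE \<le> b3 * (sqrt n * sqrt t)" and by': "y \<le> b3 * sqrt t"
    and b: "0 \<le> b1" "0 \<le> b2" "0 \<le> b3"
  shows "err / sqrt t \<le> (Kx * (p * (b1 * b2 + b3) / sqrt c1 + q * b1) + p * b3 / sqrt c1) * (sqrt n / sqrt na * Rt + 1 / sqrt na)"
proof -
  define u where "u = sqrt n / sqrt na"
  have st: "0 < sqrt t" and sna: "0 < sqrt na" and sc: "0 < sqrt c1" using pos by simp_all
  have u1: "1 \<le> u" using pos sna by (simp add: u_def)
  have "fF * fL \<le> (b1 * sqrt t) * (b2 * sqrt n)" by (rule mult_mono) (use bF bL b pos in auto)
  then have "fF * fL + sE \<le> (b1 * b2 + b3) * (sqrt n * sqrt t)" using bE by (simp add: algebra_simps)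
  then have "p * (fF * fL + sE) * x \<le> p * ((b1 * b2 + b3) * (sqrt n * sqrt t)) * x"
    using pos by (intro mult_right_mono mult_left_mono) auto
  moreover have "p * y \<le> p * (b3 * sqrt t)" using by' pos by (intro mult_left_mono) auto
  ultimately have "1 / sqrt (c1 * na) * (p * (fF * fL + sE) * x + p * y)
      \<le> 1 / sqrt (c1 * na) * (p * ((b1 * b2 + b3) * (sqrt n * sqrt t)) * x + p * (b3 * sqrt t))"
    using pos by (intro mult_left_mono[OF add_mono]) auto
  moreover have "q * fF * x \<le> q * (b1 * sqrt t) * x" using bF pos by (intro mult_right_mono mult_left_mono) auto
  ultimately have "err \<le> 1 / sqrt (c1 * na) * (p * ((b1 * b2 + b3) * (sqrt n * sqrt t)) * x + p * (b3 * sqrt t)) + q * (b1 * sqrt t) * x"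
    using err by linarith
  also have "\<dots> = sqrt t * ((p * (b1 * b2 + b3) / sqrt c1) * (u * x) + (p * b3 / sqrt c1) * (1 / sqrt na) + q * b1 * x)"
    using sna sc by (simp add: u_def real_sqrt_mult field_simps)
  finally have "err / sqrt t \<le> (p * (b1 * b2 + b3) / sqrt c1) * (u * x) + (p * b3 / sqrt c1) * (1 / sqrt na) + q * b1 * x"
    using st by (simp add: pos_divide_le_eq mult.commute)
  also have "\<dots> \<le> (p * (b1 * b2 + b3) / sqrt c1) * (u * x) + (p * b3 / sqrt c1) * (1 / sqrt na) + q * b1 * (u * x)"
    using mult_right_mono[OF u1 pos(7)] pos b order_trans[OF zero_le_one u1] by (intro add_mono mult_left_mono) auto
  also have "\<dots> = (p * (b1 * b2 + b3) / sqrt c1 + q * b1) * (u * x) + (p * b3 / sqrt c1) * (1 / sqrt na)"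
    by (simp add: algebra_simps)
  also have "\<dots> \<le> (p * (b1 * b2 + b3) / sqrt c1 + q * b1) * (u * (Kx * Rt)) + (p * b3 / sqrt c1) * (1 / sqrt na)"
    using pos b u1 sc by (intro add_mono mult_left_mono) auto
  also have "\<dots> \<le> (Kx * (p * (b1 * b2 + b3) / sqrt c1 + q * b1) + p * b3 / sqrt c1) * (u * Rt + 1 / sqrt na)"
  proof -
    define g where "g = p * (b1 * b2 + b3) / sqrt c1 + q * b1"
    define h where "h = p * b3 / sqrt c1"
    have "0 \<le> g" "0 \<le> h" unfolding g_def h_def using pos b sc by auto
    then have "0 \<le> Kx * g * (1 / sqrt na)" "0 \<le> h * (u * Rt)" using pos sna u1 by auto
    then show ?thesis unfolding g_def[symmetric] h_def[symmetric] by (simp add: algebra_simps)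
  qed
  finally show ?thesis by (simp add: u_def)
qed

theorem theorem1:
  fixes M :: "nat \<Rightarrow> 'a measure"
    and K s :: nat and A :: "nat set" and r :: "nat \<Rightarrow> nat"
    and alpha :: "nat \<Rightarrow> real" and Mc kappa :: real
    and N :: "nat \<Rightarrow> nat" and T :: "nat \<Rightarrow> nat \<Rightarrow> nat"
    and Lam :: "nat \<Rightarrow> nat \<Rightarrow> real Matrix.mat"
    and ds dw :: "nat \<Rightarrow> nat \<Rightarrow> real" and eps :: "nat \<Rightarrow> real"
    and Sig :: "nat \<Rightarrow> real Matrix.mat"
    and f :: "nat \<Rightarrow> nat \<Rightarrow> nat \<Rightarrow> 'a \<Rightarrow> real Matrix.vec"
    and e :: "nat \<Rightarrow> nat \<Rightarrow> nat \<Rightarrow> nat \<Rightarrow> 'a \<Rightarrow> real"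
    and Qh :: "nat \<Rightarrow> nat \<Rightarrow> 'a \<Rightarrow> real Matrix.mat"
    and Qw :: "nat \<Rightarrow> 'a \<Rightarrow> real Matrix.mat"
  defines "I0 \<equiv> insert 0 A"
    and "Tt \<equiv> \<lambda>n. real (\<Sum>k\<in>insert 0 A. T k n)"
    and "F \<equiv> \<lambda>k n \<omega>. fmat (T k n) (r k) (\<lambda>t. f k n t \<omega>)"
    and "E \<equiv> \<lambda>k n \<omega>. emat (T k n) (N n) (\<lambda>t i. e k n t i \<omega>)"
    and "X \<equiv> \<lambda>k n \<omega>. panel (fmat (T k n) (r k) (\<lambda>t. f k n t \<omega>)) (Lam k n)
                              (emat (T k n) (N n) (\<lambda>t i. e k n t i \<omega>))"
    and "dd \<equiv> \<lambda>n i. if i < r 0 - s then ds n i else dw n (i - (r 0 - s))"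
    and "L0s \<equiv> \<lambda>n. cols (Lam 0 n) 0 (r 0 - s)"
    and "L0w \<equiv> \<lambda>n. cols (Lam 0 n) (r 0 - s) (r 0)"
    and "LamT \<equiv> \<lambda>k n. cols (Lam k n) 0 s"
    and "LamTc \<equiv> \<lambda>k n. cols (Lam k n) s (r k)"
    and "Rate \<equiv> \<lambda>n. let TT = real (\<Sum>k\<in>insert 0 A. T k n) in
                   sqrt (real (T 0 n)) * real (N n) / (TT * real (N n) powr alpha (s - 1))
                   + real (T 0 n) / (TT * real (N n) powr alpha (s - 1))
                   + (\<Sum>k\<in>A. sqrt (real (T k n)) / TT + real (T k n) / (TT * real (N n)))
                   + (1 / TT) * (\<Sum>k\<in>A. real (T k n) * eps n)"
  assumes prob: "\<And>n. prob_space (M n)"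
    and A_sub: "A \<subseteq> {1..K}"
    and s_pos: "0 < s" and s_le0: "s \<le> r 0" and s_leA: "\<And>k. k \<in> A \<Longrightarrow> s \<le> r k"
    and alpha_pos: "0 < alpha (s - 1)" and alpha_lt1: "alpha 0 < 1"
    and alpha_mono: "\<And>i j. i \<le> j \<Longrightarrow> j < s \<Longrightarrow> alpha j \<le> alpha i"
    and N_lim: "filterlim N at_top sequentially"
    and T_lim: "\<And>k. k \<in> I0 \<Longrightarrow> filterlim (\<lambda>n. T k n) at_top sequentially"
    and Lam_dim: "\<And>k n. k \<in> I0 \<Longrightarrow> Lam k n \<in> carrier_mat (N n) (r k)"
    and f_dim: "\<And>k n t \<omega>. k \<in> I0 \<Longrightarrow> dim_vec (f k n t \<omega>) = r k"
    and f_meas: "\<And>k n t j. k \<in> I0 \<Longrightarrow> (\<lambda>\<omega>. f k n t \<omega> $ j) \<in> borel_measurable (M n)"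
    and e_meas: "\<And>k n t i. k \<in> I0 \<Longrightarrow> (\<lambda>\<omega>. e k n t i \<omega>) \<in> borel_measurable (M n)"
    \<comment> \<open>(A1)\<close>
    and A1_mom: "\<And>k n t. k \<in> I0 \<Longrightarrow> t < T k n \<Longrightarrow>
        (\<integral>\<^sup>+\<omega>. ennreal (vnorm (f k n t \<omega>) ^ 4) \<partial>M n) \<le> ennreal Mc"
    and A1_Sig_dim: "\<And>k. k \<in> I0 \<Longrightarrow> Sig k \<in> carrier_mat (r k) (r k)"
    and A1_lim: "\<And>k. k \<in> I0 \<Longrightarrow> to_zero_in_prob M
        (\<lambda>n \<omega>. spec_norm ((1 / real (T k n)) \<cdot>\<^sub>m ((F k n \<omega>)\<^sup>T * F k n \<omega>) - Sig k))"
    and A1_pd: "\<And>k. k \<in> I0 \<Longrightarrow> pos_def (Sig k)"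
    and A1_distinct: "\<And>k. k \<in> I0 \<Longrightarrow>
        \<exists>mu. inj_on mu {..<r k} \<and> (\<forall>j<r k. eigenvalue (Sig k) (mu j))"
    \<comment> \<open>(A2)\<close>
    and A2_max: "\<And>k n. k \<in> I0 \<Longrightarrow> max_norm (Lam k n) \<le> Mc"
    and A2_ds: "\<And>i. i < r 0 - s \<Longrightarrow> same_order (\<lambda>n. ds n i) (\<lambda>n. real (N n))"
    and A2_dw: "\<And>i. i < s \<Longrightarrow> same_order (\<lambda>n. dw n i) (\<lambda>n. real (N n) powr alpha i)"
    and A2_L0: "(\<lambda>n. spec_norm (dmat (r 0) (\<lambda>i. 1 / sqrt (dd n i)) * ((Lam 0 n)\<^sup>T * Lam 0 n)
                  * dmat (r 0) (\<lambda>i. 1 / sqrt (dd n i)) - 1\<^sub>m (r 0))) \<longlonglongrightarrow> 0"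
    and A2_Lk: "\<And>k. k \<in> A \<Longrightarrow>
        (\<lambda>n. spec_norm ((1 / real (N n)) \<cdot>\<^sub>m ((Lam k n)\<^sup>T * Lam k n) - 1\<^sub>m (r k))) \<longlonglongrightarrow> 0"
    \<comment> \<open>(A3)\<close>
    and A3: "\<And>k. k \<in> I0 \<Longrightarrow>
        bigOp M (\<lambda>n \<omega>. (spec_norm (E k n \<omega>))^2) (\<lambda>n. real (max (N n) (T k n)))"
    \<comment> \<open>(A4)\<close>
    and A4_0: "\<And>n t. t < T 0 n \<Longrightarrow>
        (\<integral>\<^sup>+\<omega>. ennreal ((vnorm (vec (r 0) (\<lambda>j. (1 / sqrt (dd n j)) *
            (\<Sum>i<N n. Lam 0 n $$ (i,j) * e 0 n t i \<omega>))))^2) \<partial>M n) \<le> ennreal Mc"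
    and A4_k: "\<And>k n t. k \<in> A \<Longrightarrow> t < T k n \<Longrightarrow>
        (\<integral>\<^sup>+\<omega>. ennreal ((vnorm (vec (r k) (\<lambda>j. (1 / sqrt (real (N n))) *
            (\<Sum>i<N n. Lam k n $$ (i,j) * e k n t i \<omega>))))^2) \<partial>M n) \<le> ennreal Mc"
    and A4_f: "\<And>k n i. k \<in> I0 \<Longrightarrow> i < N n \<Longrightarrow>
        (\<integral>\<^sup>+\<omega>. ennreal ((vnorm (vec (r k) (\<lambda>j. (1 / sqrt (real (T k n))) *
            (\<Sum>t<T k n. f k n t \<omega> $ j * e k n t i \<omega>))))^2) \<partial>M n) \<le> ennreal Mc"
    \<comment> \<open>block structure of the loadings\<close>
    and P0_split: "\<And>n. proj (Lam 0 n) = proj (L0w n) + proj (L0s n)"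
    and Pk_split: "\<And>k n. k \<in> A \<Longrightarrow> proj (Lam k n) = proj (LamT k n) + proj (LamTc k n)"
    \<comment> \<open>(A5)\<close>
    and A5_eps: "\<And>k n. k \<in> A \<Longrightarrow> frob_norm (proj (LamT k n) - proj (L0w n)) \<le> eps n"
    and kappa_pos: "0 < kappa"
    and A5_kappa: "\<And>n. spec_norm ((1 / Tt n) \<cdot>\<^sub>m (real (T 0 n) \<cdot>\<^sub>m proj (L0s n)
        + msum (N n) A (\<lambda>k. real (T k n) \<cdot>\<^sub>m proj (LamTc k n)))) \<le> 1 - kappa"
    \<comment> \<open>(A6)(1)\<close>
    and A6_1: "(\<lambda>n. real (N n) / (sqrt (real (T 0 n)) * real (N n) powr alpha (s - 1))) \<longlonglongrightarrow> 0"
    \<comment> \<open>oracle TransPCA estimators (any choice of leading eigenvectors)\<close>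
    and Qh_def: "\<forall>\<^sub>F n in sequentially. \<forall>\<omega>\<in>space (M n). \<forall>k\<in>I0.
        leading_eigvecs ((1 / (real (N n) * real (T k n))) \<cdot>\<^sub>m ((X k n \<omega>)\<^sup>T * X k n \<omega>)) (r k) (Qh k n \<omega>)"
    and Qw_def: "\<forall>\<^sub>F n in sequentially. \<forall>\<omega>\<in>space (M n).
        leading_eigvecs ((1 / Tt n) \<cdot>\<^sub>m msum (N n) I0 (\<lambda>k. real (T k n) \<cdot>\<^sub>m (Qh k n \<omega> * (Qh k n \<omega>)\<^sup>T)))
          s (Qw n \<omega>)"
  shows "\<exists>H :: nat \<Rightarrow> 'a \<Rightarrow> real Matrix.mat.
     (\<forall>n \<omega>. H n \<omega> \<in> carrier_mat s s \<and> invertible_mat (H n \<omega>)) \<and>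
     bigOp M (\<lambda>n \<omega>. spec_norm (Qw n \<omega> * dmat s (\<lambda>i. sqrt (dw n i)) - L0w n * H n \<omega>) / sqrt (real (N n)))
             (\<lambda>n. sqrt (real (N n) powr alpha 0) / sqrt (real (N n)) * Rate n) \<and>
     bigOp M (\<lambda>n \<omega>. spec_norm (X 0 n \<omega> * (Qw n \<omega> * dmat s (\<lambda>i. sqrt (dw n i))) * dmat s (\<lambda>i. 1 / dw n i)
                      - cols (F 0 n \<omega>) (r 0 - s) (r 0) * (inv_mat (H n \<omega>))\<^sup>T) / sqrt (real (T 0 n)))
             (\<lambda>n. sqrt (real (N n)) / sqrt (real (N n) powr alpha (s - 1)) * Rate n
                  + 1 / sqrt (real (N n) powr alpha (s - 1)))"
proof -
  have I0: "finite I0" "0 \<in> I0" "finite A" "0 \<notin> A"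
    using A_sub finite_subset[of A "{1..K}"] by (auto simp: I0_def)
  have T_pos: "\<forall>\<^sub>F n in sequentially. 0 < T k n" if "k \<in> I0" for k
    using T_lim[OF that] unfolding filterlim_at_top by (auto elim!: allE[of _ 1] eventually_mono)
  have N_pos: "\<forall>\<^sub>F n in sequentially. 0 < N n"
    using N_lim unfolding filterlim_at_top by (auto elim!: allE[of _ 1] eventually_mono)
  have "\<forall>k\<in>I0. \<exists>c>0. \<forall>v\<in>carrier_vec (r k). c * (v \<bullet> v) \<le> v \<bullet> (Sig k *\<^sub>v v)"
    using pos_def_coercive[OF A1_pd] A1_Sig_dim by fastforce
  \<comment> \<open>\<open>cS k\<close> is a lower eigenvalue bound for the limit
    \<open>Sig k\<close>; it fixes the precision demanded in \<open>G3\<close>.\<close>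
  then obtain cS where cS: "\<And>k. k \<in> I0 \<Longrightarrow> 0 < cS k"
    "\<And>k. k \<in> I0 \<Longrightarrow> \<forall>v\<in>carrier_vec (r k). cS k * (v \<bullet> v) \<le> v \<bullet> (Sig k *\<^sub>v v)"
    by metis
  define V0 where "V0 = (\<lambda>n. scaled (r 0) (Lam 0 n) (dd n))"
  have Fc: "F k n \<omega> \<in> carrier_mat (T k n) (r k)" and Ec: "E k n \<omega> \<in> carrier_mat (T k n) (N n)" for k n \<omega>
    by (simp_all add: F_def E_def fmat_def emat_def)
  have X: "X k n \<omega> = panel (F k n \<omega>) (Lam k n) (E k n \<omega>)" for k n \<omega> by (simp add: X_def F_def E_def)

  \<comment> \<open>All the randomness enters through these four bounds: factor-noise products, size
    of the noise, factor Gram matrices, and noise along the target loadings. The constant is absent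
    from \<open>G3\<close>, whose precision is fixed.\<close>
  define G1 where "G1 = (\<lambda>k C n \<omega>. (frob_norm ((F k n \<omega>)\<^sup>T * E k n \<omega>))\<^sup>2 \<le> C * (real (N n) * real (T k n)))"
  define G2 where "G2 = (\<lambda>k C n \<omega>. (spec_norm (E k n \<omega>))\<^sup>2 \<le> C * real (max (N n) (T k n)))"
  define G3 where "G3 = (\<lambda>k (C::real) n \<omega>. spec_norm ((1 / real (T k n)) \<cdot>\<^sub>m ((F k n \<omega>)\<^sup>T * F k n \<omega>) - Sig k) \<le> cS k / 2)"
  define G4 where "G4 = (\<lambda>C n \<omega>. (frob_norm (E 0 n \<omega> * V0 n))\<^sup>2 \<le> C * real (T 0 n))"
  have inc: "increasing (G1 k)" "increasing (G2 k)" "increasing (G3 k)" "increasing G4" for k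
    unfolding increasing_def G1_def G2_def G3_def G4_def by (auto intro: order_trans[OF _ mult_right_mono])
  have w1: "whp M (G1 k)" if k: "k \<in> I0" for k
  proof -
    define v where "v = (\<lambda>n i \<omega>. (vnorm (Matrix.vec (r k) (\<lambda>j. (1 / sqrt (real (T k n))) *
        (\<Sum>t<T k n. f k n t \<omega> $ j * e k n t i \<omega>))))\<^sup>2)"
    have "whp M (\<lambda>C n \<omega>. (\<Sum>i<N n. v n i \<omega>) \<le> C * real (N n))"
    proof (rule whp_markov_sum[OF prob _ _ _ N_pos, where v = v and c = Mc])
      show "v n i \<in> borel_measurable (M n)" for n i
        unfolding v_def vnorm_sq using f_meas[OF k] e_meas[OF k]
        by (auto intro!: borel_measurable_sum borel_measurable_power borel_measurable_times borel_measurable_const)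
      show "(\<integral>\<^sup>+\<omega>. ennreal (v n i \<omega>) \<partial>M n) \<le> ennreal Mc" if "i < N n" for n i
        unfolding v_def by (rule A4_f[OF k that])
    qed (simp add: v_def)
    then show ?thesis
    proof (rule whp_imp[OF prob])
      fix C :: real
      have "\<forall>\<^sub>F n in sequentially. \<forall>\<omega>\<in>space (M n). (\<Sum>i<N n. v n i \<omega>) \<le> C * real (N n) \<longrightarrow> G1 k C n \<omega>"
        using T_pos[OF k]
      proof eventually_elim
        case (elim n)
        have "(frob_norm ((F k n \<omega>)\<^sup>T * E k n \<omega>))\<^sup>2 = real (T k n) * (\<Sum>i<N n. v n i \<omega>)" for \<omega>
          unfolding F_def E_def v_def by (rule frob_factor_noise[OF elim])
        moreover have "real (T k n) * (\<Sum>i<N n. v n i \<omega>) \<le> C * (real (N n) * real (T k n))"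
          if "(\<Sum>i<N n. v n i \<omega>) \<le> C * real (N n)" for \<omega>
          using mult_left_mono[OF that, of "real (T k n)"] by (simp add: mult_ac)
        ultimately show ?case by (simp add: G1_def)
      qed
      then show "\<exists>C'. \<forall>\<^sub>F n in sequentially. \<forall>\<omega>\<in>space (M n). (\<Sum>i<N n. v n i \<omega>) \<le> C * real (N n) \<longrightarrow> G1 k C' n \<omega>" ..
    qed
  qed
  have w2: "whp M (G2 k)" if k: "k \<in> I0" for k
    using A3[OF k] unfolding bigOp_whp G2_def by simp
  have w3: "whp M (G3 k)" if k: "k \<in> I0" for k
    using to_zero_whp[OF A1_lim[OF k], of "cS k / 2"] cS(1)[OF k] unfolding G3_def by simp
  have w4: "whp M G4"
  proof -
    define v where "v = (\<lambda>n t \<omega>. (vnorm (Matrix.vec (r 0) (\<lambda>j. (1 / sqrt (dd n j)) *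
            (\<Sum>i<N n. Lam 0 n $$ (i,j) * e 0 n t i \<omega>))))\<^sup>2)"
    have "whp M (\<lambda>C n \<omega>. (\<Sum>t<T 0 n. v n t \<omega>) \<le> C * real (T 0 n))"
    proof (rule whp_markov_sum[OF prob _ _ _ T_pos[OF I0(2)], where v = v and c = Mc])
      show "v n t \<in> borel_measurable (M n)" for n t
        unfolding v_def vnorm_sq using e_meas[OF I0(2)]
        by (auto intro!: borel_measurable_sum borel_measurable_power borel_measurable_times borel_measurable_const)
      show "(\<integral>\<^sup>+\<omega>. ennreal (v n t \<omega>) \<partial>M n) \<le> ennreal Mc" if "t < T 0 n" for n t
        unfolding v_def by (rule A4_0[OF that])
    qed (simp add: v_def)
    moreover have "(frob_norm (E 0 n \<omega> * V0 n))\<^sup>2 = (\<Sum>t<T 0 n. v n t \<omega>)" for n \<omega>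
      unfolding E_def V0_def v_def by (rule frob_noise_scaled[OF Lam_dim[OF I0(2)]])
    ultimately show ?thesis by (simp add: G4_def)
  qed
  \<comment> \<open>One predicate with one constant, from which both conclusions are derived
    deterministically.\<close>
  define G where "G = (\<lambda>C n \<omega>. (\<forall>k\<in>I0. G1 k C n \<omega> \<and> G2 k C n \<omega> \<and> G3 k C n \<omega>) \<and> G4 C n \<omega>)"
  have G: "whp M G" and G_inc: "increasing G"
  proof -
    have a: "whp M (\<lambda>C n \<omega>. G1 k C n \<omega> \<and> G2 k C n \<omega> \<and> G3 k C n \<omega>) \<and> increasing (\<lambda>C n \<omega>. G1 k C n \<omega> \<and> G2 k C n \<omega> \<and> G3 k C n \<omega>)"
      if k: "k \<in> I0" for k
      using whp_conj[OF prob w1[OF k] inc(1) whp_conj[OF prob w2[OF k] inc(2) w3[OF k] inc(3)]] by blast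
    have b: "whp M (\<lambda>C n \<omega>. \<forall>k\<in>I0. G1 k C n \<omega> \<and> G2 k C n \<omega> \<and> G3 k C n \<omega>)
        \<and> increasing (\<lambda>C n \<omega>. \<forall>k\<in>I0. G1 k C n \<omega> \<and> G2 k C n \<omega> \<and> G3 k C n \<omega>)"
      by (rule whp_ball[OF prob I0(1)]) (use a in blast)+
    show "whp M G" "increasing G" unfolding G_def using whp_conj[OF prob _ _ w4 inc(4)] b by blast+
  qed

  define na where "na = (\<lambda>n. real (N n) powr alpha (s - 1))"
  obtain cs Cs where so_s: "0 < cs" "0 < Cs" "\<forall>\<^sub>F n in sequentially. \<forall>i\<in>{..<r 0 - s}.
      0 < real (N n) \<and> cs * real (N n) \<le> ds n i \<and> ds n i \<le> Cs * real (N n)"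
    using same_order_uniform[of "{..<r 0 - s}" "\<lambda>i n. ds n i" "\<lambda>i n. real (N n)"] A2_ds by auto
  obtain cw Cw where so_w: "0 < cw" "0 < Cw" "\<forall>\<^sub>F n in sequentially. \<forall>i\<in>{..<s}.
      0 < real (N n) powr alpha i \<and> cw * real (N n) powr alpha i \<le> dw n i \<and> dw n i \<le> Cw * real (N n) powr alpha i"
    using same_order_uniform[of "{..<s}" "\<lambda>i n. dw n i" "\<lambda>i n. real (N n) powr alpha i"] A2_dw by auto
  \<comment> \<open>Constants common to strong and weak factors. Taking \<open>CL\<close> at least 1
    also covers the sources, whose strengths are exactly \<open>N\<close>.\<close>
  define c1 where "c1 = min cs cw"
  define CL where "CL = max (max Cs Cw) 1"
  have c1: "0 < c1" and CL: "1 \<le> CL" using so_s so_w by (auto simp: c1_def CL_def)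

  \<comment> \<open>Nonrandom facts for large \<open>n\<close>. Lower bounds use the weakest
    strength \<open>na\<close> and upper bounds the order \<open>N\<close>, except for the weak
    strengths, whose order \<open>N powr alpha 0\<close> enters the loading rate.\<close>
  define Ev where "Ev = (\<lambda>n. 0 < N n \<and> (\<forall>k\<in>I0. 0 < T k n) \<and> 0 < na n \<and> na n \<le> real (N n) \<and>
    (\<forall>i<r 0. c1 * na n \<le> dd n i \<and> dd n i \<le> CL * real (N n)) \<and> (\<forall>i<s. dw n i \<le> CL * real (N n) powr alpha 0))"
  have T_all: "\<forall>\<^sub>F n in sequentially. \<forall>k\<in>I0. 0 < T k n"
    using T_pos by (intro eventually_ball_finite[OF I0(1)] ballI)
  have Ev: "\<forall>\<^sub>F n in sequentially. Ev n"
    using N_pos T_all so_s(3) so_w(3)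
  proof eventually_elim
    case (elim n)
    have N1: "1 \<le> real (N n)" using elim(1) by simp
    \<comment> \<open>The exponents decrease: index \<open>s - 1\<close> belongs to the weakest
      factor and index 0 to the strongest of the weak ones.\<close>
    have al: "alpha (s - 1) \<le> alpha i" "alpha i \<le> alpha 0" if "i < s" for i
      using alpha_mono[of i "s - 1"] alpha_mono[of 0 i] that s_pos by auto
    have naN: "na n \<le> real (N n) powr alpha i" "real (N n) powr alpha i \<le> real (N n) powr alpha 0" if "i < s" for i
      unfolding na_def using al[OF that] N1 by (auto intro: powr_mono)
    have N0: "real (N n) powr alpha 0 \<le> real (N n)" using powr_mono[of "alpha 0" 1 "real (N n)"] alpha_lt1 N1 by simp
    have naN': "na n \<le> real (N n)" using naN[OF s_pos] N0 by linarith
    have w: "c1 * na n \<le> dw n i \<and> dw n i \<le> CL * real (N n) powr alpha 0" if i: "i < s" for i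
    proof -
      have "c1 * na n \<le> cw * real (N n) powr alpha i"
        using naN(1)[OF i] c1 so_w(1) by (intro mult_mono) (auto simp: c1_def na_def)
      moreover have "Cw * real (N n) powr alpha i \<le> CL * real (N n) powr alpha 0"
        using naN(2)[OF i] so_w(2) CL by (intro mult_mono) (auto simp: CL_def)
      moreover have "cw * real (N n) powr alpha i \<le> dw n i \<and> dw n i \<le> Cw * real (N n) powr alpha i"
        using bspec[OF elim(4), of i] i by simp
      ultimately show ?thesis by linarith
    qed
    have sd: "c1 * na n \<le> ds n i \<and> ds n i \<le> CL * real (N n)" if i: "i < r 0 - s" for i
    proof -
      have "c1 * na n \<le> cs * real (N n)"
        using naN' c1 so_s(1) by (intro mult_mono) (auto simp: c1_def na_def)
      moreover have "Cs * real (N n) \<le> CL * real (N n)" by (intro mult_right_mono) (auto simp: CL_def)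
      moreover have "cs * real (N n) \<le> ds n i \<and> ds n i \<le> Cs * real (N n)"
        using bspec[OF elim(3), of i] i by simp
      ultimately show ?thesis by linarith
    qed
    have "c1 * na n \<le> dd n i \<and> dd n i \<le> CL * real (N n)" if i: "i < r 0" for i
    proof (cases "i < r 0 - s")
      case True
      then show ?thesis using sd by (simp add: dd_def)
    next
      case False
      then have "i - (r 0 - s) < s" using i s_le0 by simp
      moreover have "CL * real (N n) powr alpha 0 \<le> CL * real (N n)" using N0 CL by (intro mult_left_mono) auto
      ultimately show ?thesis using w[of "i - (r 0 - s)"] False by (simp add: dd_def)
    qed
    then show ?case using elim(1,2) naN' w by (auto simp: Ev_def na_def)
  qed
  define Nr where "Nr = (\<lambda>n. near_on (N n) (r 0) (Lam 0 n) (dd n) \<and>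
    frob_norm ((V0 n)\<^sup>T * V0 n - 1\<^sub>m (r 0)) \<le> 1/4 \<and> (\<forall>k\<in>A. near_on (N n) (r k) (Lam k n) (\<lambda>_. real (N n))))"
  have Nr: "\<forall>\<^sub>F n in sequentially. Nr n"
  proof -
    have r_pos: "0 < r k" if "k \<in> I0" for k
      using s_le0 s_leA[of k] s_pos that by (cases "k = 0") (auto simp: I0_def)
    have e0: "\<forall>\<^sub>F n in sequentially. spec_norm (dmat (r 0) (\<lambda>i. 1 / sqrt (dd n i)) * ((Lam 0 n)\<^sup>T * Lam 0 n)
        * dmat (r 0) (\<lambda>i. 1 / sqrt (dd n i)) - 1\<^sub>m (r 0)) < 1 / (4 * sqrt (real (r 0)))"
      using order_tendstoD(2)[OF A2_L0] r_pos[OF I0(2)] by simp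
    have "\<forall>\<^sub>F n in sequentially. spec_norm ((1 / real (N n)) \<cdot>\<^sub>m ((Lam k n)\<^sup>T * Lam k n) - 1\<^sub>m (r k))
        < 1 / (4 * sqrt (real (r k)))" if "k \<in> A" for k
      using order_tendstoD(2)[OF A2_Lk[OF that]] r_pos[of k] that by (simp add: I0_def)
    with I0(3) have "\<forall>\<^sub>F n in sequentially. \<forall>k\<in>A. spec_norm ((1 / real (N n)) \<cdot>\<^sub>m ((Lam k n)\<^sup>T * Lam k n) - 1\<^sub>m (r k))
        < 1 / (4 * sqrt (real (r k)))"
      by (intro eventually_ball_finite ballI)
    then show ?thesis using e0 Ev
    proof eventually_elim
      case (elim n)
      have N0: "0 < real (N n)" using elim(3) by (simp add: Ev_def)
      have L0: "Lam 0 n \<in> carrier_mat (N n) (r 0)" by (rule Lam_dim[OF I0(2)])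
      have d0: "frob_norm ((V0 n)\<^sup>T * V0 n - 1\<^sub>m (r 0)) \<le> 1/4"
        unfolding V0_def by (rule gram_defect_le[OF L0 r_pos[OF I0(2)] elim(2)])
      have dpos: "0 < dd n i" if "i < r 0" for i
      proof -
        have "0 < c1 * na n" "c1 * na n \<le> dd n i" using elim(3) c1 that by (auto simp: Ev_def)
        then show ?thesis by linarith
      qed
      have "near_on (N n) (r k) (Lam k n) (\<lambda>_. real (N n))" if k: "k \<in> A" for k
      proof -
        have kI: "k \<in> I0" using k by (simp add: I0_def)
        have L: "Lam k n \<in> carrier_mat (N n) (r k)" by (rule Lam_dim[OF kI])
        have "dmat (r k) (\<lambda>i. 1 / sqrt (real (N n))) * ((Lam k n)\<^sup>T * Lam k n) * dmat (r k) (\<lambda>i. 1 / sqrt (real (N n)))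
            = (1 / real (N n)) \<cdot>\<^sub>m ((Lam k n)\<^sup>T * Lam k n)"
          using dmat_const_conj[of "(Lam k n)\<^sup>T * Lam k n" "r k" "1 / sqrt (real (N n))"] L N0 by simp
        then have "frob_norm ((scaled (r k) (Lam k n) (\<lambda>_. real (N n)))\<^sup>T * scaled (r k) (Lam k n) (\<lambda>_. real (N n)) - 1\<^sub>m (r k)) \<le> 1/4"
          using elim(1) k by (intro gram_defect_le[OF L r_pos[OF kI]]) simp
        then show ?thesis using L N0 by (simp add: near_on_def)
      qed
      moreover have "near_on (N n) (r 0) (Lam 0 n) (dd n)"
        using d0 L0 dpos by (simp add: near_on_def V0_def)
      ultimately show ?case using d0 by (simp add: Nr_def)
    qed
  qed
  define x where "x = (\<lambda>n \<omega>. frob_norm ((1\<^sub>m (N n) - Qw n \<omega> * (Qw n \<omega>)\<^sup>T) * proj (L0w n)))"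
  define H where "H = (\<lambda>n \<omega>. rotation s (L0w n) (dw n) (Qw n \<omega>))"
  define Weak where "Weak = (\<lambda>K n \<omega>. x n \<omega> \<le> K * Rate n \<and>
    x n \<omega> = frob_norm ((1\<^sub>m (N n) - proj (L0w n)) * (Qw n \<omega> * (Qw n \<omega>)\<^sup>T)) \<and>
    proj (L0s n) * proj (L0w n) = 0\<^sub>m (N n) (N n) \<and>
    Qw n \<omega> \<in> carrier_mat (N n) s \<and> (Qw n \<omega>)\<^sup>T * Qw n \<omega> = 1\<^sub>m s)"
  \<comment> \<open>\<open>C\<close> is nonnegative because it appears under square roots;
    \<open>K\<close> depends on \<open>C\<close> but neither on \<open>n\<close> nor on the
    outcome.\<close>
  have core: "\<exists>K. 0 \<le> K \<and> (\<forall>\<^sub>F n in sequentially. \<forall>\<omega>\<in>space (M n). G C n \<omega> \<longrightarrow> Weak K n \<omega>)" if C: "0 \<le> C" for C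
  proof -
    define pc where "pc = (\<lambda>k. panel_const (r k) (cS k / 2) CL C)"
    have pc: "0 \<le> pc k" if "k \<in> I0" for k
      using cS(1)[OF that] C CL by (simp add: pc_def panel_const_def)
    \<comment> \<open>Dominates both \<open>pc k\<close>, used for the sources, and
      \<open>pc 0 / c1\<close>, which arises for the target from the least strength
      \<open>c1 * na n\<close>.\<close>
    define K where "K = (\<Sum>k\<in>I0. pc k) * (1 + 1 / c1)"
    have K: "0 \<le> K" unfolding K_def using pc c1 by (intro mult_nonneg_nonneg sum_nonneg) auto
    have pcK: "pc k \<le> K" "pc k / c1 \<le> K" if k: "k \<in> I0" for k
    proof -
      have le: "pc k \<le> (\<Sum>k\<in>I0. pc k)" by (rule member_le_sum[OF k]) (use pc I0 in auto)
      show "pc k \<le> K" unfolding K_def using mult_mono[OF le, of 1 "1 + 1 / c1"] c1 le pc[OF k] by simp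
      show "pc k / c1 \<le> K" unfolding K_def using mult_mono[OF le, of "1 / c1" "1 + 1 / c1"] c1 le pc[OF k] by simp
    qed
    have "\<forall>\<^sub>F n in sequentially. \<forall>\<omega>\<in>space (M n). G C n \<omega> \<longrightarrow> Weak ((2 * K + 8) / kappa) n \<omega>"
      using Ev Nr Qh_def Qw_def
    proof eventually_elim
      case (elim n)
      show ?case
      proof (intro ballI impI)
        fix \<omega> assume \<omega>: "\<omega> \<in> space (M n)" and g: "G C n \<omega>"
        have Np: "0 < N n" and Tp: "\<And>k. k \<in> I0 \<Longrightarrow> 0 < T k n" and nap: "0 < na n"
          and dd1: "\<And>i. i < r 0 \<Longrightarrow> c1 * na n \<le> dd n i" and dd2: "\<And>i. i < r 0 \<Longrightarrow> dd n i \<le> CL * real (N n)"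
          using elim(1) by (auto simp: Ev_def)
        have no0: "near_on (N n) (r 0) (Lam 0 n) (dd n)" and noA: "\<And>k. k \<in> A \<Longrightarrow> near_on (N n) (r k) (Lam k n) (\<lambda>_. real (N n))"
          using elim(2) by (auto simp: Nr_def)
        have lead: "leading_eigvecs ((1 / (real (N n) * real (T k n))) \<cdot>\<^sub>m
            ((panel (F k n \<omega>) (Lam k n) (E k n \<omega>))\<^sup>T * panel (F k n \<omega>) (Lam k n) (E k n \<omega>))) (r k) (Qh k n \<omega>)"
          if "k \<in> I0" for k using elim(3) \<omega> that unfolding X by blast
        have Qhc: "Qh k n \<omega> \<in> carrier_mat (N n) (r k)" "(Qh k n \<omega>)\<^sup>T * Qh k n \<omega> = 1\<^sub>m (r k)" if "k \<in> I0" for k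
          using lead[OF that] carrier_matD[OF Ec[of k n \<omega>]] by (auto simp: leading_eigvecs_def panel_def)
        have sig: "cS k / 2 * real (T k n) * (frob_norm Z)\<^sup>2 \<le> (frob_norm (F k n \<omega> * Z))\<^sup>2"
          if k: "k \<in> I0" and Z: "Z \<in> carrier_mat (r k) m" for k Z m
          by (rule factor_gram_bounds(1)[OF Fc A1_Sig_dim[OF k] Tp[OF k] cS(2)[OF k] _ Z])
            (use g k in \<open>simp add: G_def G3_def\<close>)
        have rate: "frob_norm (Qh k n \<omega> * (Qh k n \<omega>)\<^sup>T - proj (Lam k n))
            \<le> pc k * (real (N n) / (dm * sqrt (real (T k n))) + 1 / dm)"
          if k: "k \<in> I0" and no: "near_on (N n) (r k) (Lam k n) d" and dm: "0 < dm" "\<And>i. i < r k \<Longrightarrow> dm \<le> d i"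
            "\<And>i. i < r k \<Longrightarrow> d i \<le> CL * real (N n)" for k d dm
          unfolding pc_def
        proof (rule panel_rate[OF no dm(1) _ _ _ Tp[OF k] Np Fc Ec _ _ lead[OF k] C])
          show "dm \<le> d i" if "i < r k" for i using dm(2) that .
          show "d i \<le> CL * real (N n)" if "i < r k" for i using dm(3) that .
          show "cS k / 2 * real (T k n) * (frob_norm Z)\<^sup>2 \<le> (frob_norm (F k n \<omega> * Z))\<^sup>2" if "Z \<in> carrier_mat (r k) m" for Z m
            using sig[OF k that] .
        qed (use CL cS(1)[OF k] g k in \<open>auto simp: G_def G1_def G2_def\<close>)
        have r0: "frob_norm (Qh 0 n \<omega> * (Qh 0 n \<omega>)\<^sup>T - proj (Lam 0 n)) \<le> K * (real (N n) / (na n * sqrt (real (T 0 n))) + 1 / na n)"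
        proof -
          have "frob_norm (Qh 0 n \<omega> * (Qh 0 n \<omega>)\<^sup>T - proj (Lam 0 n))
              \<le> pc 0 * (real (N n) / (c1 * na n * sqrt (real (T 0 n))) + 1 / (c1 * na n))"
            by (rule rate[OF I0(2) no0]) (use c1 nap dd1 dd2 in auto)
          also have "\<dots> = pc 0 / c1 * (real (N n) / (na n * sqrt (real (T 0 n))) + 1 / na n)"
            using c1 by (simp add: field_simps)
          also have "\<dots> \<le> K * (real (N n) / (na n * sqrt (real (T 0 n))) + 1 / na n)"
            using pcK(2)[OF I0(2)] nap by (intro mult_right_mono) auto
          finally show ?thesis .
        qed
        have rA: "frob_norm (Qh k n \<omega> * (Qh k n \<omega>)\<^sup>T - proj (Lam k n)) \<le> K * (1 / sqrt (real (T k n)) + 1 / real (N n))"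
          if k: "k \<in> A" for k
        proof -
          have kI: "k \<in> I0" using k by (simp add: I0_def)
          have "frob_norm (Qh k n \<omega> * (Qh k n \<omega>)\<^sup>T - proj (Lam k n))
              \<le> pc k * (real (N n) / (real (N n) * sqrt (real (T k n))) + 1 / real (N n))"
            by (rule rate[OF kI noA[OF k]]) (use Np CL in auto)
          also have "\<dots> = pc k * (1 / sqrt (real (T k n)) + 1 / real (N n))" using Np by simp
          also have "\<dots> \<le> K * (1 / sqrt (real (T k n)) + 1 / real (N n))"
            using pcK(1)[OF kI] by (intro mult_right_mono) auto
          finally show ?thesis .
        qed
        have leadw: "leading_eigvecs ((1 / real (\<Sum>k\<in>insert 0 A. T k n)) \<cdot>\<^sub>m msum (N n) (insert 0 A)
            (\<lambda>k. real (T k n) \<cdot>\<^sub>m (Qh k n \<omega> * (Qh k n \<omega>)\<^sup>T))) s (Qw n \<omega>)"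
          using elim(4) \<omega> by (simp add: Tt_def I0_def)
        then have Qw: "Qw n \<omega> \<in> carrier_mat (N n) s" "(Qw n \<omega>)\<^sup>T * Qw n \<omega> = 1\<^sub>m s"
          by (auto simp: leading_eigvecs_def msum_def)
        have W: "frob_norm ((1\<^sub>m (N n) - Qw n \<omega> * (Qw n \<omega>)\<^sup>T) * proj (L0w n))
            \<le> (2 * K + 8) / kappa * (sqrt (real (T 0 n)) * real (N n) / (real (\<Sum>k\<in>insert 0 A. T k n) * na n)
              + real (T 0 n) / (real (\<Sum>k\<in>insert 0 A. T k n) * na n)
              + (\<Sum>k\<in>A. sqrt (real (T k n)) / real (\<Sum>k\<in>insert 0 A. T k n) + real (T k n) / (real (\<Sum>k\<in>insert 0 A. T k n) * real (N n)))
              + (1 / real (\<Sum>k\<in>insert 0 A. T k n)) * (\<Sum>k\<in>A. real (T k n) * eps n))"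
          "frob_norm ((1\<^sub>m (N n) - proj (L0w n)) * (Qw n \<omega> * (Qw n \<omega>)\<^sup>T))
            = frob_norm ((1\<^sub>m (N n) - Qw n \<omega> * (Qw n \<omega>)\<^sup>T) * proj (L0w n))"
          "proj (L0s n) * proj (L0w n) = 0\<^sub>m (N n) (N n)"
          unfolding L0w_def L0s_def
          by (rule weak_space_rate[where T = "\<lambda>k. T k n" and r = r and Lam = "\<lambda>k. Lam k n" and Qh = "\<lambda>k. Qh k n \<omega>"
                and d = "\<lambda>_ _. real (N n)" and eps = "eps n" and kappa = kappa,
                OF I0(3,4) _ Np nap s_le0 s_leA no0 noA _ _ _ kappa_pos _ _ _ K r0 rA leadw];
              use Tp Qhc P0_split[of n] Pk_split[of _ n] A5_eps[of _ n] A5_kappa[of n] in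
                \<open>simp add: I0_def L0w_def L0s_def LamT_def LamTc_def Tt_def\<close>)+
        then show "Weak ((2 * K + 8) / kappa) n \<omega>"
          using Qw by (simp only: Weak_def x_def Rate_def Let_def na_def simp_thms)
      qed
    qed
    moreover have "0 \<le> (2 * K + 8) / kappa" using K kappa_pos by simp
    ultimately show ?thesis by blast
  qed
  \<comment> \<open>The weak columns of the target come last, so shifting the index by
    \<open>r 0 - s\<close> recovers \<open>dw\<close>.\<close>
  have dd_dw: "(\<lambda>i. dd n (r 0 - s + i)) = dw n" for n by (simp add: dd_def)
  have weak: "near_on (N n) s (L0w n) (dw n)" "frob_norm ((scaled s (L0w n) (dw n))\<^sup>T * scaled s (L0w n) (dw n) - 1\<^sub>m s) \<le> 1/4"
    if "Nr n" for n
    using near_on_cols[of "N n" "r 0" "Lam 0 n" "dd n" "r 0 - s" "r 0", unfolded dd_dw] that s_le0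
    by (auto simp: Nr_def V0_def L0w_def)
  \<comment> \<open>The constant supplied by \<open>whp_imp\<close> may be negative; enlarging it
    makes \<open>core\<close> applicable.\<close>
  have G_max: "G C n \<omega> \<Longrightarrow> G (max C 0) n \<omega>" for C n \<omega>
    using G_inc unfolding increasing_def by (meson max.cobounded1)
  define U1 where "U1 = (\<lambda>n \<omega>. Qw n \<omega> * dmat s (\<lambda>i. sqrt (dw n i)) - L0w n * H n \<omega>)"
  define U2 where "U2 = (\<lambda>n \<omega>. X 0 n \<omega> * (Qw n \<omega> * dmat s (\<lambda>i. sqrt (dw n i))) * dmat s (\<lambda>i. 1 / dw n i)
      - Defs.cols (F 0 n \<omega>) (r 0 - s) (r 0) * (inv_mat (H n \<omega>))\<^sup>T)"
  have concl1: "bigOp M (\<lambda>n \<omega>. spec_norm (U1 n \<omega>) / sqrt (real (N n)))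
      (\<lambda>n. sqrt (real (N n) powr alpha 0) / sqrt (real (N n)) * Rate n)"
    unfolding bigOp_whp
  proof (rule whp_imp[OF prob G])
    fix C :: real
    obtain K where K: "0 \<le> K" and ev: "\<forall>\<^sub>F n in sequentially. \<forall>\<omega>\<in>space (M n). G (max C 0) n \<omega> \<longrightarrow> Weak K n \<omega>"
      using core[of "max C 0"] by auto
    have "\<forall>\<^sub>F n in sequentially. \<forall>\<omega>\<in>space (M n). G C n \<omega> \<longrightarrow> \<bar>spec_norm (U1 n \<omega>) / sqrt (real (N n))\<bar>
        \<le> 12 * (real s)\<^sup>2 * sqrt CL * K * (sqrt (real (N n) powr alpha 0) / sqrt (real (N n)) * Rate n)"
      using ev Ev Nr
    proof eventually_elim
      case (elim n)
      show ?case
      proof (intro ballI impI)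
        fix \<omega> assume \<omega>: "\<omega> \<in> space (M n)" and "G C n \<omega>"
        then have g: "G (max C 0) n \<omega>" by (intro G_max)
        have Np: "0 < N n" and dmax: "\<And>i. i < s \<Longrightarrow> dw n i \<le> CL * real (N n) powr alpha 0"
          using elim(2) by (auto simp: Ev_def)
        have xb: "x n \<omega> \<le> K * Rate n" and Qw: "Qw n \<omega> \<in> carrier_mat (N n) s" "(Qw n \<omega>)\<^sup>T * Qw n \<omega> = 1\<^sub>m s"
          using elim(1) \<omega> g by (auto simp: Weak_def)
        have "spec_norm (U1 n \<omega>) \<le> frob_norm (U1 n \<omega>)" by (rule spec_norm_le_frob)
        also have "\<dots> \<le> 12 * (real s)\<^sup>2 * sqrt (CL * real (N n) powr alpha 0) * x n \<omega>"
          unfolding U1_def H_def by (rule weak_loading_error(1)[OF weak[OF elim(3)] dmax s_pos Qw]) (simp_all add: x_def)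
        also have "\<dots> \<le> 12 * (real s)\<^sup>2 * sqrt (CL * real (N n) powr alpha 0) * (K * Rate n)"
          using xb CL by (intro mult_left_mono) auto
        finally have "spec_norm (U1 n \<omega>) / sqrt (real (N n))
            \<le> 12 * (real s)\<^sup>2 * sqrt (CL * real (N n) powr alpha 0) * (K * Rate n) / sqrt (real (N n))"
          by (rule divide_right_mono) simp
        then show "\<bar>spec_norm (U1 n \<omega>) / sqrt (real (N n))\<bar>
            \<le> 12 * (real s)\<^sup>2 * sqrt CL * K * (sqrt (real (N n) powr alpha 0) / sqrt (real (N n)) * Rate n)"
          by (simp add: real_sqrt_mult mult_ac)
      qed
    qed
    then show "\<exists>C'. \<forall>\<^sub>F n in sequentially. \<forall>\<omega>\<in>space (M n). G C n \<omega> \<longrightarrow> \<bar>spec_norm (U1 n \<omega>) / sqrt (real (N n))\<bar>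
        \<le> C' * (sqrt (real (N n) powr alpha 0) / sqrt (real (N n)) * Rate n)" ..
  qed
  have concl2: "bigOp M (\<lambda>n \<omega>. spec_norm (U2 n \<omega>) / sqrt (real (T 0 n)))
      (\<lambda>n. sqrt (real (N n)) / sqrt (real (N n) powr alpha (s - 1)) * Rate n + 1 / sqrt (real (N n) powr alpha (s - 1)))"
    unfolding bigOp_whp
  proof (rule whp_imp[OF prob G])
    fix C :: real
    define C0 where "C0 = max C 0"
    obtain K where K: "0 \<le> K" and ev: "\<forall>\<^sub>F n in sequentially. \<forall>\<omega>\<in>space (M n). G C0 n \<omega> \<longrightarrow> Weak K n \<omega>"
      using core[of C0] by (auto simp: C0_def)
    \<comment> \<open>The absolute value makes \<open>CF\<close> nonnegative without a separate
      argument about the trace of \<open>Sig 0\<close>.\<close>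
    define CF where "CF = \<bar>mip (Sig 0) (1\<^sub>m (r 0)) + cS 0 / 2 * real (r 0)\<bar>"
    define p where "p = 3 * real s * sqrt (real s)"
    define b1 where "b1 = sqrt CF"
    define b2 where "b2 = sqrt CL * sqrt (2 * real (r 0))"
    define b3 where "b3 = sqrt C0"
    \<comment> \<open>The constant of \<open>factor_rate\<close> with
      \<open>q = 3 * s\<close>.\<close>
    define K2 where "K2 = K * (p * (b1 * b2 + b3) / sqrt c1 + 3 * real s * b1) + p * b3 / sqrt c1"
    have nonneg: "0 \<le> p" "0 \<le> b1" "0 \<le> b2" "0 \<le> b3" "0 \<le> C0"
      using CL by (auto simp: p_def b1_def b2_def b3_def CF_def C0_def)
    have "\<forall>\<^sub>F n in sequentially. \<forall>\<omega>\<in>space (M n). G C n \<omega> \<longrightarrow> \<bar>spec_norm (U2 n \<omega>) / sqrt (real (T 0 n))\<bar>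
        \<le> K2 * (sqrt (real (N n)) / sqrt (real (N n) powr alpha (s - 1)) * Rate n + 1 / sqrt (real (N n) powr alpha (s - 1)))"
      using ev Ev Nr
    proof eventually_elim
      case (elim n)
      show ?case
      proof (intro ballI impI)
        fix \<omega> assume \<omega>: "\<omega> \<in> space (M n)" and "G C n \<omega>"
        then have g: "G C0 n \<omega>" unfolding C0_def by (intro G_max)
        have Np: "0 < N n" and Tp: "0 < T 0 n" and nap: "0 < na n" "na n \<le> real (N n)"
          and dd1: "\<And>i. i < r 0 \<Longrightarrow> c1 * na n \<le> dd n i" and dd2: "\<And>i. i < r 0 \<Longrightarrow> dd n i \<le> CL * real (N n)"
          using elim(2) I0(2) by (auto simp: Ev_def)
        have no0: "near_on (N n) (r 0) (Lam 0 n) (dd n)" using elim(3) by (simp add: Nr_def)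
        have dmin: "c1 * na n \<le> dw n i" if "i < s" for i
          using dd1[of "r 0 - s + i"] that s_le0 fun_cong[OF dd_dw, of n i] by simp
        have xb: "x n \<omega> \<le> K * Rate n" and x2: "x n \<omega> = frob_norm ((1\<^sub>m (N n) - proj (L0w n)) * (Qw n \<omega> * (Qw n \<omega>)\<^sup>T))"
          and orth: "proj (L0s n) * proj (L0w n) = 0\<^sub>m (N n) (N n)"
          and Qw: "Qw n \<omega> \<in> carrier_mat (N n) s" "(Qw n \<omega>)\<^sup>T * Qw n \<omega> = 1\<^sub>m s"
          using elim(1) \<omega> g by (auto simp: Weak_def)
        have g1: "(spec_norm (E 0 n \<omega>))\<^sup>2 \<le> C0 * real (max (N n) (T 0 n))"
          and g3: "spec_norm ((1 / real (T 0 n)) \<cdot>\<^sub>m ((F 0 n \<omega>)\<^sup>T * F 0 n \<omega>) - Sig 0) \<le> cS 0 / 2"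
          and g4: "(frob_norm (E 0 n \<omega> * V0 n))\<^sup>2 \<le> C0 * real (T 0 n)"
          using g I0(2) by (auto simp: G_def G2_def G3_def G4_def)
        have err: "frob_norm (U2 n \<omega>) \<le> 1 / sqrt (c1 * na n) *
            (p * (frob_norm (F 0 n \<omega>) * frob_norm (Lam 0 n) + spec_norm (E 0 n \<omega>)) * x n \<omega> + p * frob_norm (E 0 n \<omega> * V0 n))
            + 3 * real s * frob_norm (F 0 n \<omega>) * x n \<omega>"
          unfolding U2_def H_def X p_def V0_def
          by (rule weak_factor_error[OF no0 s_pos s_le0 _ _ _ weak(2)[OF elim(3)] orth _ dmin Qw _ x2 Fc Ec])
            (use c1 nap in \<open>simp_all add: L0w_def L0s_def dd_dw x_def\<close>)
        have x0: "0 \<le> x n \<omega>" by (simp add: x_def)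
        have Rt: "0 \<le> Rate n"
        proof -
          have "0 \<le> eps n" if "k \<in> A" for k using order_trans[OF frob_norm_nonneg A5_eps[OF that, of n]] .
          then show ?thesis unfolding Rate_def Let_def
            by (intro add_nonneg_nonneg sum_nonneg mult_nonneg_nonneg divide_nonneg_nonneg of_nat_0_le_iff) auto
        qed
        have bF: "frob_norm (F 0 n \<omega>) \<le> b1 * sqrt (real (T 0 n))"
        proof -
          have "(frob_norm (F 0 n \<omega>))\<^sup>2 \<le> (mip (Sig 0) (1\<^sub>m (r 0)) + cS 0 / 2 * real (r 0)) * real (T 0 n)"
            by (rule factor_gram_bounds(2)[OF Fc A1_Sig_dim[OF I0(2)] Tp cS(2)[OF I0(2)] g3])
          also have "\<dots> \<le> CF * real (T 0 n)" by (intro mult_right_mono) (auto simp: CF_def)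
          finally have "frob_norm (F 0 n \<omega>) \<le> sqrt (CF * real (T 0 n))" by (rule real_le_rsqrt)
          then show ?thesis by (simp add: b1_def real_sqrt_mult)
        qed
        have bL: "frob_norm (Lam 0 n) \<le> b2 * sqrt (real (N n))"
        proof -
          have "frob_norm (Lam 0 n) \<le> sqrt (CL * real (N n)) * sqrt (2 * real (r 0))"
            by (rule near_on_frob_le[OF no0]) (use CL dd2 in auto)
          then show ?thesis by (simp add: b2_def real_sqrt_mult mult_ac)
        qed
        have bE: "spec_norm (E 0 n \<omega>) \<le> b3 * (sqrt (real (N n)) * sqrt (real (T 0 n)))"
        proof -
          \<comment> \<open>For positive integers the maximum is at most the product. This gives the
            noise the same order as \<open>frob_norm F * frob_norm Lam\<close>, the term to which it
            is added.\<close>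
          have "max (N n) (T 0 n) \<le> N n * T 0 n" using Np Tp by simp
          then have "real (max (N n) (T 0 n)) \<le> real (N n) * real (T 0 n)" by (metis of_nat_le_iff of_nat_mult)
          then have "(spec_norm (E 0 n \<omega>))\<^sup>2 \<le> C0 * (real (N n) * real (T 0 n))"
            using g1 mult_left_mono[OF _ nonneg(5)] order_trans by blast
          then have "spec_norm (E 0 n \<omega>) \<le> sqrt (C0 * (real (N n) * real (T 0 n)))" by (rule real_le_rsqrt)
          then show ?thesis by (simp add: b3_def real_sqrt_mult)
        qed
        have bV: "frob_norm (E 0 n \<omega> * V0 n) \<le> b3 * sqrt (real (T 0 n))"
          using real_le_rsqrt[OF g4] by (simp add: b3_def real_sqrt_mult)
        have "frob_norm (U2 n \<omega>) / sqrt (real (T 0 n)) \<le> K2 * (sqrt (real (N n)) / sqrt (na n) * Rate n + 1 / sqrt (na n))"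
          unfolding K2_def
          by (rule factor_rate[OF err c1 nap _ nonneg(1) _ x0 K Rt xb _ bF _ bL bE bV nonneg(2-4)]) (use Tp in auto)
        moreover have "spec_norm (U2 n \<omega>) / sqrt (real (T 0 n)) \<le> frob_norm (U2 n \<omega>) / sqrt (real (T 0 n))"
          by (intro divide_right_mono spec_norm_le_frob) simp
        ultimately show "\<bar>spec_norm (U2 n \<omega>) / sqrt (real (T 0 n))\<bar>
            \<le> K2 * (sqrt (real (N n)) / sqrt (real (N n) powr alpha (s - 1)) * Rate n + 1 / sqrt (real (N n) powr alpha (s - 1)))"
          by (simp add: na_def)
      qed
    qed
    then show "\<exists>C'. \<forall>\<^sub>F n in sequentially. \<forall>\<omega>\<in>space (M n). G C n \<omega> \<longrightarrow> \<bar>spec_norm (U2 n \<omega>) / sqrt (real (T 0 n))\<bar>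
        \<le> C' * (sqrt (real (N n)) / sqrt (real (N n) powr alpha (s - 1)) * Rate n + 1 / sqrt (real (N n) powr alpha (s - 1)))" ..
  qed
  show ?thesis
    using rotation_invertible concl1 concl2 unfolding U1_def U2_def
    by (intro exI[of _ H]) (simp add: H_def)
qed

end
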